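(* Let $X$ be a complex Banach space and let $-A\colon \mathsf D(A)\subseteq X\to X$ be the infinitesimal generator of a strongly measurable semigroup $(S(t))_{t\ge 0}$ on $X$ which is uniformly bounded, i.e., $\|S(t)\|_{\mathscr L(X)}\le M_0e^{-wt}$ for all $t\ge0$, for some $M_0\in[1,\infty)$ and $w\in[0,\infty)$. Let $s\in(0,\infty)\setminus\mathbb N$, $p\in[1,\infty]$ and $t_0\in\mathbb R$. Suppose that $g\equiv x$ on $(-\infty,t_0]$ for some given $x\in\mathsf D(A^{(s-1)\vee0})$, and that $s\in(0,1)$ or $(S(t))_{t\ge0}$ is uniformly exponentially stable (i.e., $w\in(0,\infty)$). Then the mild solution $u$ with initial datum $g$ of the Dirichlet problem $\mathfrak D^su=0$ on $(t_0,\infty)$, $u=g$ on $(-\infty,t_0]$, becomes $$u(t)=\overline\Gamma(s,(t-t_0)A)x\qquad\text{for all }t\in(t_0,\infty).$$ If, in addition, $s\in(0,1)$ or $(S(t))_{t\ge0}$ is bounded analytic, then for all $t\in(t_0,\infty)$ $$\|u(t)\|_X\le\Bigl[M_0\,\overline\Gamma(\{s\},w(t-t_0))+e^{-w(t-t_0)}\sum_{k=1}^{\lfloor s\rfloor}\frac{M_{\{s\}+k-1}}{\Gamma(\{s\}+k)}\Bigr]\|x\|_X,$$ where $w\in[0,\infty)$ and $M_0\in[1,\infty)$ are the constants in the semigroup bound above and $M_{\{s\}},M_{\{s\}+1},\dots,M_{s-1}\in[1,\infty)$ (needed only if $s>1$) are the constants $M_\beta$ in the analytic semigroup estimate recalled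 in the context.
   Context: Semigroups: $(S(t))_{t\ge0}\subseteq\mathscr L(X)$ is a strongly measurable semigroup if $S(0)=\mathrm{Id}_X$, $S(t+r)=S(t)S(r)$ for all $t,r\ge0$, and $t\mapsto S(t)x$ is strongly measurable on $[0,\infty)$ for every $x\in X$. If $\|S(t)\|_{\mathscr L(X)}\le M_0e^{-wt}$ for all $t\ge 0$, a linear operator $G$ is its infinitesimal generator if for all $\lambda\in\mathbb C$ with $\operatorname{Re}\lambda>w$ the operator $\lambda\,\mathrm{Id}_X-G$ has a bounded inverse and $\langle(\lambda\,\mathrm{Id}_X-G)^{-1}x,x^*\rangle=\int_0^\infty e^{-\lambda t}\langle S(t)x,x^*\rangle\,\mathrm dt$ for all $x\in X$, $x^*\in X^*$. The semigroup is bounded analytic if $(0,\infty)\ni t\mapsto S(t)\in\mathscr L(X)$ admits a bounded holomorphic extension to a sector $\{z\in\mathbb C:|\arg z|<\varphi\}$ for some $\varphi\in(0,\pi/2)$. Analytic semigroup estimate: if $(S(t))_{t\ge0}$ is in addition bounded analytic, then for every $\beta\in[0,\infty)$ there exists $M_\beta\in[1,\infty)$ such that $\|A^\beta S(t)\|_{\mathscr L(X)}\le M_\beta t^{-\beta}e^{-wt}$ for all $t\in(0,\infty)$. Fractional powers: $A^0=\mathrm{Id}_X$. If $w>0$, then for $\alpha>0$, $A^{-\alpha}=\frac1{\Gamma(\alpha)}\int_0^\infty\sigma^{\alpha-1}S(\sigma)\,\mathrm d\sigma\in\mathscr L(X)$ (integral in the strong sense), and $A^\alpha=(A^{-\alpha})^{-1}$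 with domain the range of $A^{-\alpha}$. Incomplete gamma functions: for $\alpha>0$, $z\ge0$, $\overline\Gamma(\alpha,z)=\frac1{\Gamma(\alpha)}\int_z^\infty\zeta^{\alpha-1}e^{-\zeta}\,\mathrm d\zeta$. For $\alpha\in(0,1)$ and $t>0$, $\overline\Gamma(\alpha,tA)\in\mathscr L(X)$ is defined by $\overline\Gamma(\alpha,tA)x=\frac{t^\alpha\sin(\pi\alpha)}{\pi}\int_t^\infty\sigma^{-1}(\sigma-t)^{-\alpha}S(\sigma)x\,\mathrm d\sigma$. For $\alpha\in(1,\infty)\setminus\mathbb N$, $\overline\Gamma(\alpha,tA)x=\overline\Gamma(\{\alpha\},tA)x+\sum_{k=1}^{\lfloor\alpha\rfloor}\frac{t^{k+\{\alpha\}-1}}{\Gamma(k+\{\alpha\})}A^{k+\{\alpha\}-1}S(t)x$ for $x\in\mathsf D(A^{\alpha-1})$. Fractional parabolic calculus on $I=(-\infty,t_0]$, with exponent $p\in[1,\infty]$: for $\sigma>0$, $\mathfrak I^\sigma v(t)=\frac1{\Gamma(\sigma)}\int_0^\infty\tau^{\sigma-1}S(\tau)v(t-\tau)\,\mathrm d\tau$, and $\mathfrak I^0=\mathrm{Id}$. The operator $\partial_t+A$ on $L^p(I;X)$ has domain $L^p(I;\mathsf D(A))\cap W^{1,p}(I;X)$, with iterated domains for its integer powers, and $\mathfrak D^\sigma v=(\partial_t+A)^{\lceil\sigma\rceil}\mathfrak I^{\lceil\sigma\rceil-\sigma}v$ for those $v\in L^p(I;X)$ with $\mathfrak I^{\lceil\sigma\rceil-\sigma}v\in\mathsf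 D((\partial_t+A)^{\lceil\sigma\rceil})$. The operator $\mathfrak D^s$ in the Dirichlet problem is defined in the same way with $I$ replaced by $\mathbb R$. Mild solution ($s\notin\mathbb N$): for $g\in C_{\mathrm b}((-\infty,t_0];X)\cap\mathsf D(\mathfrak D^{(s-1)\vee0})$ with $\mathfrak D^{(s-1)\vee0}g\in C_{\mathrm b}((-\infty,t_0];X)$, the mild solution with initial datum $g$ is defined by $u(t)=g(t)$ for $t\le t_0$ and, for $t>t_0$, $$u(t)=\frac{\sin(\pi\{s\})}{\pi}\int_0^\infty\frac{\tau^{-\{s\}}}{\tau+1}S((t-t_0)(\tau+1))g(t_0-(t-t_0)\tau)\,\mathrm d\tau+\sum_{k=1}^{\lfloor s\rfloor}\frac{(t-t_0)^{\{s\}+k-1}}{\Gamma(\{s\}+k)}S(t-t_0)\mathfrak D^{\{s\}+k-1}g(t_0).$$ Here $\{s\}=s-\lfloor s\rfloor$, $a\vee b=\max\{a,b\}$, and $C_{\mathrm b}$ denotes bounded continuous functions.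
   Formalization: For s>1 and p<∞ the result is asserted only when the constant g lies in D(𝔇^{s-1}), as the definition of the mild solution requires; a nonzero constant on (-∞,t_0] is not in L^p, so this forces x=0. For p=∞ admissibility of g is proved. *)

theory Defs
  imports "HOL-Analysis.Analysis"
begin

class complex_banach = banach +
  fixes scaleC :: "complex \<Rightarrow> 'a \<Rightarrow> 'a" (infixr "*\<^sub>C" 75)
  assumes scaleC_add_right: "a *\<^sub>C (x + y) = a *\<^sub>C x + a *\<^sub>C y"
    and scaleC_add_left: "(a + b) *\<^sub>C x = a *\<^sub>C x + b *\<^sub>C x"
    and scaleC_scaleC: "a *\<^sub>C (b *\<^sub>C x) = (a * b) *\<^sub>C x"
    and scaleC_of_real: "complex_of_real r *\<^sub>C x = r *\<^sub>R x"
    and norm_scaleC: "norm (a *\<^sub>C x) = cmod a * norm x"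

(* Elements of L(X) are functions satisfying bounded_clinear; their operator norm is onorm. *)
definition bounded_clinear :: "('a::complex_banach \<Rightarrow> 'a) \<Rightarrow> bool" where
  "bounded_clinear T \<longleftrightarrow> bounded_linear T \<and> (\<forall>c x. T (c *\<^sub>C x) = c *\<^sub>C T x)"

definition dual_functional :: "('a::complex_banach \<Rightarrow> complex) \<Rightarrow> bool" where
  "dual_functional f \<longleftrightarrow> bounded_linear f \<and> (\<forall>c x. f (c *\<^sub>C x) = c * f x)"

(* A possibly unbounded operator is a domain D together with a function A, whose values
   outside D are irrelevant. *)
definition linear_operator :: "'a::complex_banach set \<Rightarrow> ('a \<Rightarrow> 'a) \<Rightarrow> bool" where
  "linear_operator D A \<longleftrightarrow> 0 \<in> D
     \<and> (\<forall>x\<in>D. \<forall>y\<in>D. x + y \<in> D \<and> A (x + y) = A x + A y)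
     \<and> (\<forall>c. \<forall>x\<in>D. c *\<^sub>C x \<in> D \<and> A (c *\<^sub>C x) = c *\<^sub>C A x)"

definition operator_graph :: "'a set \<Rightarrow> ('a \<Rightarrow> 'a) \<Rightarrow> ('a \<times> 'a) set" where
  "operator_graph D A = {(x, A x) | x. x \<in> D}"

(* Strong (Lebesgue-)measurability of a function with values in the subspace V of 'b:
   almost everywhere the limit of V-valued simple functions. Integrals of vector-valued
   functions are taken with the gauge integral, because the library's Bochner integral is
   restricted to second countable spaces; the two agree for Bochner integrable functions. *)
definition strongly_measurable_into ::
    "'b::real_normed_vector set \<Rightarrow> real set \<Rightarrow> (real \<Rightarrow> 'b) \<Rightarrow> bool" where
  "strongly_measurable_into V I f \<longleftrightarrow>
     (\<exists>s. (\<forall>n. simple_function (lebesgue_on I) (s n) \<and> s n ` I \<subseteq> V) \<and>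
          (AE t in lebesgue_on I. f t \<in> V \<and> (\<lambda>n. s n t) \<longlonglongrightarrow> f t))"

definition Lp_into ::
    "ennreal \<Rightarrow> real set \<Rightarrow> 'b::real_normed_vector set \<Rightarrow> (real \<Rightarrow> 'b) set" where
  "Lp_into p I V = {f. strongly_measurable_into V I f \<and>
     (if p = \<infinity> then (\<exists>C. AE t in lebesgue_on I. norm (f t) \<le> C)
      else integrable (lebesgue_on I) (\<lambda>t. norm (f t) powr enn2real p))}"

abbreviation Lp :: "ennreal \<Rightarrow> real set \<Rightarrow> (real \<Rightarrow> 'b::real_normed_vector) set" where
  "Lp p I \<equiv> Lp_into p I UNIV"

(* L^p(I; D(A)), where D(A) with its graph norm is identified with the graph of A in X x X. *)
definition Lp_domain ::
    "ennreal \<Rightarrow> real set \<Rightarrow> 'a::complex_banach set \<Rightarrow> ('a \<Rightarrow> 'a) \<Rightarrow> (real \<Rightarrow> 'a) set" where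
  "Lp_domain p I D A = {v. (\<lambda>t. (v t, A (v t))) \<in> Lp_into p I (operator_graph D A)}"

definition Cb :: "real set \<Rightarrow> (real \<Rightarrow> 'a::complex_banach) set" where
  "Cb I = {f. continuous_on I f \<and> bounded (f ` I)}"

definition test_function :: "real set \<Rightarrow> (real \<Rightarrow> real) \<Rightarrow> bool" where
  "test_function I \<phi> \<longleftrightarrow> (\<forall>n. (deriv ^^ n) \<phi> differentiable_on UNIV) \<and>
     (\<exists>K. compact K \<and> K \<subseteq> interior I \<and> (\<forall>t. t \<notin> K \<longrightarrow> \<phi> t = 0))"

definition weak_derivative ::
    "real set \<Rightarrow> (real \<Rightarrow> 'a::complex_banach) \<Rightarrow> (real \<Rightarrow> 'a) \<Rightarrow> bool" where
  "weak_derivative I v v' \<longleftrightarrow> (\<forall>\<phi>. test_function I \<phi> \<longrightarrow>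
     integral I (\<lambda>t. deriv \<phi> t *\<^sub>R v t) = - integral I (\<lambda>t. \<phi> t *\<^sub>R v' t))"

definition strongly_measurable_semigroup :: "(real \<Rightarrow> 'a::complex_banach \<Rightarrow> 'a) \<Rightarrow> bool" where
  "strongly_measurable_semigroup S \<longleftrightarrow>
     (\<forall>t\<ge>0. bounded_clinear (S t)) \<and> S 0 = id \<and>
     (\<forall>t\<ge>0. \<forall>r\<ge>0. S (t + r) = S t \<circ> S r) \<and>
     (\<forall>x. strongly_measurable_into UNIV {0..} (\<lambda>t. S t x))"

definition infinitesimal_generator ::
    "real \<Rightarrow> (real \<Rightarrow> 'a::complex_banach \<Rightarrow> 'a) \<Rightarrow> 'a set \<Rightarrow> ('a \<Rightarrow> 'a) \<Rightarrow> bool" where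
  "infinitesimal_generator w S D G \<longleftrightarrow> linear_operator D G \<and>
     (\<forall>\<mu>. Re \<mu> > w \<longrightarrow>
       (\<exists>R. bounded_clinear R \<and>
          (\<forall>y. R y \<in> D \<and> \<mu> *\<^sub>C R y - G (R y) = y) \<and>
          (\<forall>x\<in>D. R (\<mu> *\<^sub>C x - G x) = x) \<and>
          (\<forall>x f. dual_functional f \<longrightarrow>
             ((\<lambda>t. exp (- \<mu> * complex_of_real t) * f (S t x)) has_integral f (R x)) {0..})))"

definition sector :: "real \<Rightarrow> complex set" where
  "sector \<phi> = {z. z \<noteq> 0 \<and> \<bar>Arg z\<bar> < \<phi>}"

definition operator_holomorphic_on ::
    "(complex \<Rightarrow> 'a::complex_banach \<Rightarrow> 'a) \<Rightarrow> complex set \<Rightarrow> bool" where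
  "operator_holomorphic_on T \<Omega> \<longleftrightarrow> (\<forall>z\<in>\<Omega>. \<exists>T'. bounded_clinear T' \<and>
     ((\<lambda>h. onorm (\<lambda>x. inverse h *\<^sub>C (T (z + h) x - T z x) - T' x)) \<longlongrightarrow> 0) (at 0))"

definition bounded_analytic :: "(real \<Rightarrow> 'a::complex_banach \<Rightarrow> 'a) \<Rightarrow> bool" where
  "bounded_analytic S \<longleftrightarrow> (\<exists>\<phi> T. 0 < \<phi> \<and> \<phi> < pi / 2 \<and>
     (\<forall>z\<in>sector \<phi>. bounded_clinear (T z)) \<and>
     (\<exists>C. \<forall>z\<in>sector \<phi>. onorm (T z) \<le> C) \<and>
     operator_holomorphic_on T (sector \<phi>) \<and>
     (\<forall>t>0. T (complex_of_real t) = S t))"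

(* The negative power of A of order alpha > 0; meaningful for exponentially stable S. *)
definition neg_power :: "(real \<Rightarrow> 'a::complex_banach \<Rightarrow> 'a) \<Rightarrow> real \<Rightarrow> 'a \<Rightarrow> 'a" where
  "neg_power S \<alpha> x = (1 / Gamma \<alpha>) *\<^sub>R integral {0..} (\<lambda>\<sigma>. (\<sigma> powr (\<alpha> - 1)) *\<^sub>R S \<sigma> x)"

definition power_domain :: "(real \<Rightarrow> 'a::complex_banach \<Rightarrow> 'a) \<Rightarrow> real \<Rightarrow> 'a set" where
  "power_domain S \<alpha> = (if \<alpha> = 0 then UNIV else range (neg_power S \<alpha>))"

definition frac_power :: "(real \<Rightarrow> 'a::complex_banach \<Rightarrow> 'a) \<Rightarrow> real \<Rightarrow> 'a \<Rightarrow> 'a" where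
  "frac_power S \<alpha> x = (if \<alpha> = 0 then x else the_inv (neg_power S \<alpha>) x)"

(* C is an admissible constant M_beta in the analytic semigroup estimate with rate w. *)
definition analytic_estimate ::
    "(real \<Rightarrow> 'a::complex_banach \<Rightarrow> 'a) \<Rightarrow> real \<Rightarrow> real \<Rightarrow> real \<Rightarrow> bool" where
  "analytic_estimate S w \<beta> C \<longleftrightarrow> 1 \<le> C \<and>
     (\<forall>t>0. range (S t) \<subseteq> power_domain S \<beta> \<and>
        bounded_clinear (\<lambda>x. frac_power S \<beta> (S t x)) \<and>
        onorm (\<lambda>x. frac_power S \<beta> (S t x)) \<le> C * t powr (- \<beta>) * exp (- w * t))"

definition upper_gamma :: "real \<Rightarrow> real \<Rightarrow> real" where
  "upper_gamma \<alpha> z = (1 / Gamma \<alpha>) * integral {z..} (\<lambda>\<zeta>. \<zeta> powr (\<alpha> - 1) * exp (- \<zeta>))"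

(* The operator obtained by inserting tA into upper_gamma alpha, for non-integer alpha > 0
   and t > 0. For alpha in (0,1) the sum is empty and frac alpha = alpha. *)
definition upper_gamma_op ::
    "(real \<Rightarrow> 'a::complex_banach \<Rightarrow> 'a) \<Rightarrow> real \<Rightarrow> real \<Rightarrow> 'a \<Rightarrow> 'a" where
  "upper_gamma_op S \<alpha> t x =
     (t powr frac \<alpha> * sin (pi * frac \<alpha>) / pi) *\<^sub>R
       integral {t..} (\<lambda>\<sigma>. (inverse \<sigma> * (\<sigma> - t) powr (- frac \<alpha>)) *\<^sub>R S \<sigma> x)
     + (\<Sum>k = 1..nat \<lfloor>\<alpha>\<rfloor>.
          (t powr (real k + frac \<alpha> - 1) / Gamma (real k + frac \<alpha>)) *\<^sub>R
            frac_power S (real k + frac \<alpha> - 1) (S t x))"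

definition parabolic_integral ::
    "(real \<Rightarrow> 'a::complex_banach \<Rightarrow> 'a) \<Rightarrow> real \<Rightarrow> (real \<Rightarrow> 'a) \<Rightarrow> real \<Rightarrow> 'a" where
  "parabolic_integral S \<sigma> v t =
     (if \<sigma> = 0 then v t
      else (1 / Gamma \<sigma>) *\<^sub>R integral {0..} (\<lambda>\<tau>. (\<tau> powr (\<sigma> - 1)) *\<^sub>R S \<tau> (v (t - \<tau>))))"

(* The operator d/dt + A on L^p(I; X) as a relation between representatives: v lies in the
   domain and h is a representative of v' + A v. *)
definition parabolic_operator ::
    "ennreal \<Rightarrow> real set \<Rightarrow> 'a::complex_banach set \<Rightarrow> ('a \<Rightarrow> 'a) \<Rightarrow>
      (real \<Rightarrow> 'a) \<Rightarrow> (real \<Rightarrow> 'a) \<Rightarrow> bool" where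
  "parabolic_operator p I D A v h \<longleftrightarrow> v \<in> Lp_domain p I D A \<and> v \<in> Lp p I \<and>
     (\<exists>v'\<in>Lp p I. weak_derivative I v v' \<and> (AE t in lebesgue_on I. h t = v' t + A (v t)))"

(* v lies in the domain of the fractional derivative of order sigma, and f represents its
   image; ^^ is the iteration of relations. *)
definition parabolic_derivative ::
    "(real \<Rightarrow> 'a::complex_banach \<Rightarrow> 'a) \<Rightarrow> 'a set \<Rightarrow> ('a \<Rightarrow> 'a) \<Rightarrow> ennreal \<Rightarrow> real set \<Rightarrow> real \<Rightarrow>
      (real \<Rightarrow> 'a) \<Rightarrow> (real \<Rightarrow> 'a) \<Rightarrow> bool" where
  "parabolic_derivative S D A p I \<sigma> v f \<longleftrightarrow> v \<in> Lp p I \<and>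
     (\<exists>h. (parabolic_operator p I D A ^^ nat \<lceil>\<sigma>\<rceil>)
             (parabolic_integral S (of_int \<lceil>\<sigma>\<rceil> - \<sigma>) v) h \<and>
          (AE t in lebesgue_on I. f t = h t))"

(* Value at t0 of the continuous representative of the fractional derivative. *)
definition parabolic_derivative_at ::
    "(real \<Rightarrow> 'a::complex_banach \<Rightarrow> 'a) \<Rightarrow> 'a set \<Rightarrow> ('a \<Rightarrow> 'a) \<Rightarrow> ennreal \<Rightarrow> real \<Rightarrow> real \<Rightarrow>
      (real \<Rightarrow> 'a) \<Rightarrow> 'a" where
  "parabolic_derivative_at S D A p t0 \<sigma> v =
     (THE y. \<exists>f. parabolic_derivative S D A p {..t0} \<sigma> v f \<and> continuous_on {..t0} f \<and> f t0 = y)"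

definition admissible_datum ::
    "(real \<Rightarrow> 'a::complex_banach \<Rightarrow> 'a) \<Rightarrow> 'a set \<Rightarrow> ('a \<Rightarrow> 'a) \<Rightarrow> ennreal \<Rightarrow> real \<Rightarrow> real \<Rightarrow>
      (real \<Rightarrow> 'a) \<Rightarrow> bool" where
  "admissible_datum S D A p t0 s g \<longleftrightarrow> g \<in> Cb {..t0} \<and>
     (\<exists>f\<in>Cb {..t0}. parabolic_derivative S D A p {..t0} (max (s - 1) 0) g f)"

(* The formula defining the mild solution (s not an integer). For s > 1 it is meaningful only
   for an admissible datum; for 0 < s < 1 the sum is empty and p, D, A play no role. *)
definition mild_solution ::
    "(real \<Rightarrow> 'a::complex_banach \<Rightarrow> 'a) \<Rightarrow> 'a set \<Rightarrow> ('a \<Rightarrow> 'a) \<Rightarrow> ennreal \<Rightarrow> real \<Rightarrow> real \<Rightarrow>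
      (real \<Rightarrow> 'a) \<Rightarrow> real \<Rightarrow> 'a" where
  "mild_solution S D A p t0 s g t =
     (if t \<le> t0 then g t else
        (sin (pi * frac s) / pi) *\<^sub>R
          integral {0..} (\<lambda>\<tau>. (\<tau> powr (- frac s) / (\<tau> + 1)) *\<^sub>R
            S ((t - t0) * (\<tau> + 1)) (g (t0 - (t - t0) * \<tau>)))
        + (\<Sum>k = 1..nat \<lfloor>s\<rfloor>.
             ((t - t0) powr (frac s + real k - 1) / Gamma (frac s + real k)) *\<^sub>R
               S (t - t0) (parabolic_derivative_at S D A p t0 (frac s + real k - 1) g)))"

end

theory Submission
  imports Defs
begin

text \<open>On a constant past \<open>g = x\<close> every integral over the past factors through \<open>x\<close>. In the
integral term of the mild solution, the substitution \<open>\<sigma> = (t - t\<^sub>0) (\<tau> + 1)\<close> turns the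
weight \<open>\<tau> powr (- frac s) / (\<tau> + 1)\<close> into the one that defines \<open>upper_gamma_op\<close>
(\<open>mild_solution_integral_part\<close>). For \<open>s < 1\<close> there is nothing else.

For \<open>s > 1\<close> one has to evaluate the fractional parabolic derivatives of a constant, and
the answer is \<open>D\<^sup>\<sigma> x = A\<^sup>\<sigma> x\<close>. If \<open>x = A\<^sup>-\<^sup>\<sigma> z\<close> and \<open>n = \<lceil>\<sigma>\<rceil>\<close>, the parabolic integral of order
\<open>n - \<sigma>\<close> of the constant \<open>x\<close> is the constant \<open>A\<^sup>-\<^sup>(\<^sup>n\<^sup>-\<^sup>\<sigma>\<^sup>) A\<^sup>-\<^sup>\<sigma> z = A\<^sup>-\<^sup>n z\<close>, and on constants \<open>\<partial>\<^sub>t + A\<close>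
acts as \<open>A\<close>, so that \<open>n\<close> applications lead back to \<open>z\<close> (\<open>parabolic_derivative_constant\<close>). Three
facts carry this.

First, \<open>A\<^sup>-\<^sup>\<alpha> A\<^sup>-\<^sup>\<beta> = A\<^sup>-\<^sup>(\<^sup>\<alpha>\<^sup>+\<^sup>\<beta>\<^sup>)\<close>. The operators \<open>x \<mapsto> \<integral> a(t) S(t) x dt\<close> are multiplied by
convolving their kernels (\<open>phillips_convolution\<close>); the powers \<open>t\<^sup>\<alpha>\<^sup>-\<^sup>1 / \<Gamma>(\<alpha>)\<close> form a
convolution semigroup by Euler's Beta integral. The product rule is a Fubini argument.
It is carried out on scalars, after composition with real functionals, which separate
points by the Hahn-Banach theorem.

Second, \<open>A\<^sup>-\<^sup>1 = \<integral> S(t) dt\<close> inverts \<open>A\<close> (\<open>neg_power_one_inverse\<close>). The generator is only known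
through its resolvent \<open>R(\<mu>) = \<integral> e\<^sup>-\<^sup>\<mu>\<^sup>t S(t) dt\<close> for \<open>\<mu> > w\<close>; the same product rule gives the
resolvent identity between \<open>R(\<mu>)\<close> and \<open>\<integral> S(t) dt\<close>, which transports the information to
\<open>\<mu> = 0\<close>. Injectivity of all \<open>A\<^sup>-\<^sup>\<alpha>\<close> follows.

Third, the value at \<open>t\<^sub>0\<close> of the fractional derivative is well defined: \<open>\<partial>\<^sub>t + A\<close> is a
relation between representatives, and it is single valued up to null sets because weak
derivatives are unique (\<open>weak_derivative_unique\<close>, a vector-valued du Bois-Reymond lemma).
If \<open>p < \<infinity>\<close>, a constant datum in \<open>L\<^sup>p\<close> of a half-line is zero, so constants may be treated for
all \<open>p\<close> at once. The remaining step \<open>S(t) A\<^sup>\<sigma> x = A\<^sup>\<sigma> S(t) x\<close> holds since \<open>S(t)\<close> commutes with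
the integrals defining negative powers.

For the norm bound, the terms of the sum are estimated by the analytic estimate. The
integral term is dominated by the same integral with \<open>M\<^sub>0 e\<^sup>-\<^sup>w\<^sup>\<sigma> \<bar>x\<bar>\<close> in place of \<open>S(\<sigma>) x\<close>,
which equals \<open>M\<^sub>0 upper_gamma (frac s) (w (t - t\<^sub>0)) \<bar>x\<bar>\<close>: this is the scalar case \<open>A = w\<close> of
the integral formula (\<open>upper_gamma_integral_representation\<close>).\<close>

section \<open>Strong measurability and the gauge integral\<close>

text \<open>Over a fine division the Riemann sums of \<open>f\<close> and \<open>g\<close> differ by at most a Riemann sum of the
pointwise bound \<open>h\<close>, so the Cauchy criterion passes from \<open>g\<close> to \<open>f\<close>: gauge integrability
survives approximation in \<open>L\<^sup>1\<close>.\<close>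

lemma integrable_on_cbox_approx:
  fixes f :: "real \<Rightarrow> 'b::banach"
  assumes "\<And>e. e > 0 \<Longrightarrow> \<exists>g h. g integrable_on cbox a b \<and> h integrable_on cbox a b \<and>
     integral (cbox a b) h < e \<and> (\<forall>x. norm (f x - g x) \<le> h x)"
  shows "f integrable_on cbox a b"
  unfolding integrable_Cauchy
proof (intro allI impI)
  fix e :: real assume "e > 0"
  then have e6: "e/6 > 0" by simp
  obtain g h where g: "g integrable_on cbox a b" and h: "h integrable_on cbox a b"
    and hi: "integral (cbox a b) h < e/6" and fg: "\<And>x. norm (f x - g x) \<le> h x"
    using assms[OF e6] by blast
  obtain d1 where d1: "gauge d1" "\<And>D. D tagged_division_of cbox a b \<and> d1 fine D \<Longrightarrow>
      norm ((\<Sum>(x,K)\<in>D. measure lborel K *\<^sub>R g x) - integral (cbox a b) g) < e/6"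
    using integrable_integral[OF g, unfolded has_integral] e6 by metis
  obtain d2 where d2: "gauge d2" "\<And>D. D tagged_division_of cbox a b \<and> d2 fine D \<Longrightarrow>
      norm ((\<Sum>(x,K)\<in>D. measure lborel K *\<^sub>R h x) - integral (cbox a b) h) < e/6"
    using integrable_integral[OF h, unfolded has_integral] e6 by metis
  have close: "norm ((\<Sum>(x,K)\<in>D. measure lborel K *\<^sub>R f x) - integral (cbox a b) g) < e/2"
    if D: "D tagged_division_of cbox a b" "d1 fine D" "d2 fine D" for D
  proof -
    have "norm ((\<Sum>(x,K)\<in>D. measure lborel K *\<^sub>R f x) - (\<Sum>(x,K)\<in>D. measure lborel K *\<^sub>R g x))
        = norm (\<Sum>(x,K)\<in>D. measure lborel K *\<^sub>R (f x - g x))"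
      by (simp add: sum_subtractf[symmetric] scaleR_diff_right case_prod_unfold)
    also have "\<dots> \<le> (\<Sum>(x,K)\<in>D. measure lborel K *\<^sub>R h x)"
      unfolding case_prod_unfold
      by (intro sum_norm_le) (auto intro!: mult_left_mono fg)
    also have "\<dots> < e/6 + e/6"
      using d2(2)[of D] D hi by (auto simp: abs_if split: if_splits)
    finally have 1: "norm ((\<Sum>(x,K)\<in>D. measure lborel K *\<^sub>R f x) - (\<Sum>(x,K)\<in>D. measure lborel K *\<^sub>R g x)) < e/6 + e/6" .
    have 2: "norm ((\<Sum>(x,K)\<in>D. measure lborel K *\<^sub>R g x) - integral (cbox a b) g) < e/6"
      using d1(2)[of D] D by auto
    show ?thesis using norm_triangle_ineq[of "(\<Sum>(x,K)\<in>D. measure lborel K *\<^sub>R f x) - (\<Sum>(x,K)\<in>D. measure lborel K *\<^sub>R g x)"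
            "(\<Sum>(x,K)\<in>D. measure lborel K *\<^sub>R g x) - integral (cbox a b) g"] 1 2 by simp
  qed
  show "\<exists>\<gamma>. gauge \<gamma> \<and>
          (\<forall>\<D>1 \<D>2. \<D>1 tagged_division_of (cbox a b) \<and> \<gamma> fine \<D>1 \<and>
            \<D>2 tagged_division_of (cbox a b) \<and> \<gamma> fine \<D>2 \<longrightarrow>
            norm ((\<Sum>(x,K)\<in>\<D>1. measure lborel K *\<^sub>R f x) - (\<Sum>(x,K)\<in>\<D>2. measure lborel K *\<^sub>R f x)) < e)"
  proof (intro exI[of _ "\<lambda>x. d1 x \<inter> d2 x"] conjI allI impI)
    show "gauge (\<lambda>x. d1 x \<inter> d2 x)" using d1(1) d2(1) by (rule gauge_Int)
    fix D1 D2 assume "D1 tagged_division_of cbox a b \<and> (\<lambda>x. d1 x \<inter> d2 x) fine D1 \<and>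
            D2 tagged_division_of (cbox a b) \<and> (\<lambda>x. d1 x \<inter> d2 x) fine D2"
    then have "norm ((\<Sum>(x,K)\<in>D1. measure lborel K *\<^sub>R f x) - integral (cbox a b) g) < e/2"
       "norm ((\<Sum>(x,K)\<in>D2. measure lborel K *\<^sub>R f x) - integral (cbox a b) g) < e/2"
      using close[of D1] close[of D2] by (auto simp only: fine_Int)
    then show "norm ((\<Sum>(x,K)\<in>D1. measure lborel K *\<^sub>R f x) - (\<Sum>(x,K)\<in>D2. measure lborel K *\<^sub>R f x)) < e"
      by (rule norm_triangle_half_l)
  qed
qed

lemma integrable_on_UNIV_approx:
  fixes f :: "real \<Rightarrow> 'b::banach"
  assumes ex: "\<And>e. e > 0 \<Longrightarrow> \<exists>g h. g integrable_on UNIV \<and> h integrable_on UNIV \<and>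
     integral UNIV h < e \<and> (\<forall>x. norm (f x - g x) \<le> h x)"
  shows "f integrable_on UNIV"
proof -
  have box: "f integrable_on cbox a b" for a b
  proof (rule integrable_on_cbox_approx)
    fix e :: real assume "e > 0"
    then obtain g h where g: "g integrable_on UNIV" and h: "h integrable_on UNIV"
      and hi: "integral UNIV h < e" and fg: "\<And>x. norm (f x - g x) \<le> h x"
      using ex by blast
    have h0: "0 \<le> h x" for x using fg[of x] norm_ge_zero order_trans by blast
    have "integral (cbox a b) h \<le> integral UNIV h"
      by (rule integral_subset_le) (use h h0 integrable_on_subcbox[OF h] in auto)
    then show "\<exists>g h. g integrable_on cbox a b \<and> h integrable_on cbox a b \<and>
     integral (cbox a b) h < e \<and> (\<forall>x. norm (f x - g x) \<le> h x)"
      using integrable_on_subcbox[OF g] integrable_on_subcbox[OF h] hi fg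
      by (intro exI[of _ g] exI[of _ h]) auto
  qed
  show ?thesis
  proof (rule integrable_alt_subset[THEN iffD2], intro conjI allI impI)
    show "(\<lambda>x. if x \<in> UNIV then f x else 0) integrable_on cbox a b" for a b
      using box by simp
    fix e :: real assume "e > 0"
    then obtain g h where g: "g integrable_on UNIV" and h: "h integrable_on UNIV"
      and hi: "integral UNIV h < e/4" and fg: "\<And>x. norm (f x - g x) \<le> h x"
      using ex[of "e/4"] by auto
    have gb: "g integrable_on cbox a b" and hb: "h integrable_on cbox a b" for a b
      using integrable_on_subcbox[OF g] integrable_on_subcbox[OF h] by auto
    have h0: "0 \<le> h x" for x using fg[of x] norm_ge_zero order_trans by blast
    have diff: "norm (integral (cbox a b) f - integral (cbox a b) g) < e/4" for a b
    proof -
      have "norm (integral (cbox a b) (\<lambda>x. f x - g x)) \<le> integral (cbox a b) h"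
        by (rule integral_norm_bound_integral[OF integrable_diff[OF box gb] hb fg])
      also have "\<dots> \<le> integral UNIV h"
        by (rule integral_subset_le) (use h h0 hb in auto)
      finally show ?thesis using hi by (simp only: integral_diff[OF box gb])
    qed
    have e4: "e/4 > 0" using \<open>e > 0\<close> by simp
    obtain B where B: "B > 0" "\<And>a b c d. ball 0 B \<subseteq> cbox a b \<and> ball 0 B \<subseteq> cbox c d \<Longrightarrow>
      norm (integral (cbox a b) (\<lambda>x. if x \<in> UNIV then g x else 0) -
       integral (cbox c d) (\<lambda>x. if x \<in> UNIV then g x else 0)) < e/4"
      using integrable_altD(2)[OF g e4] by blast
    show "\<exists>B>0. \<forall>a b c d. ball 0 B \<subseteq> cbox a b \<and> cbox a b \<subseteq> cbox c d \<longrightarrow>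
       norm (integral (cbox a b) (\<lambda>x. if x \<in> UNIV then f x else 0) -
         integral (cbox c d) (\<lambda>x. if x \<in> UNIV then f x else 0)) < e"
    proof (intro exI[of _ B] conjI allI impI B(1))
      fix a b c d :: real assume "ball 0 B \<subseteq> cbox a b \<and> cbox a b \<subseteq> cbox c d"
      then have "ball 0 B \<subseteq> cbox a b \<and> ball 0 B \<subseteq> cbox c d" by blast
      then have "norm (integral (cbox a b) g - integral (cbox c d) g) < e/4"
        using B(2)[of a b c d] by simp
      moreover note diff[of a b] diff[of c d]
      ultimately have "norm (integral (cbox a b) f - integral (cbox a b) g)
          + norm (integral (cbox a b) g - integral (cbox c d) g)
          + norm (integral (cbox c d) f - integral (cbox c d) g) < e" (is "norm ?A + norm ?B + norm ?C < e")
        using \<open>e > 0\<close> by linarith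
      then have "norm (?A + ?B - ?C) < e"
        using norm_triangle_ineq4[of "?A + ?B" ?C] norm_triangle_ineq[of ?A ?B] by linarith
      then show "norm (integral (cbox a b) (\<lambda>x. if x \<in> UNIV then f x else 0) -
         integral (cbox c d) (\<lambda>x. if x \<in> UNIV then f x else 0)) < e"
        by (simp add: algebra_simps)
    qed
  qed
qed

text \<open>Strong measurability on the whole line. Functions on a subinterval are extended by
zero, which keeps all integrals over one measure space.\<close>

definition ae_simple_limit :: "(real \<Rightarrow> 'b::real_normed_vector) \<Rightarrow> bool" where
  "ae_simple_limit f \<longleftrightarrow> (\<exists>s. (\<forall>n. simple_function lebesgue (s n)) \<and>
      (AE t in lebesgue. (\<lambda>n. s n t) \<longlonglongrightarrow> f t))"

lemma strongly_measurable_into_extend_zero: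
  fixes f :: "real \<Rightarrow> 'b::real_normed_vector"
  assumes "strongly_measurable_into V I f" "I \<in> sets lebesgue"
  shows "ae_simple_limit (\<lambda>t. if t \<in> I then f t else 0)"
proof -
  obtain s where s: "\<And>n. simple_function (lebesgue_on I) (s n)"
    and ae: "AE t in lebesgue_on I. f t \<in> V \<and> (\<lambda>n. s n t) \<longlonglongrightarrow> f t"
    using assms(1) unfolding strongly_measurable_into_def by blast
  have "simple_function lebesgue (\<lambda>t. if t \<in> I then s n t else 0)" for n
    unfolding simple_function_def
  proof safe
    have "finite (insert 0 (s n ` I))" using s[of n] by (auto simp: simple_function_def)
    then show "finite ((\<lambda>t. if t \<in> I then s n t else 0) ` space lebesgue)"
      by (rule rev_finite_subset) auto
    fix x
    have *: "s n -` {y} \<inter> I \<in> sets lebesgue" for y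
    proof (cases "y \<in> s n ` I")
      case True
      then have "s n -` {y} \<inter> I \<in> sets (lebesgue_on I)"
        using s[of n] by (auto simp: simple_function_def)
      then show ?thesis using assms(2) by (simp add: sets_restrict_space_iff)
    next
      case False then have "s n -` {y} \<inter> I = {}" by auto then show ?thesis by simp
    qed
    define y where "y = (if x \<in> I then s n x else 0)"
    have "(\<lambda>t. if t \<in> I then s n t else 0) -` {y} \<inter> space lebesgue
        = (s n -` {y} \<inter> I) \<union> (if y = 0 then -I else {})" by (auto split: if_splits)
    also have "\<dots> \<in> sets lebesgue"
    proof (rule sets.Un[OF *])
      have "- I \<in> sets lebesgue" using sets.compl_sets[OF assms(2)] by (simp add: Compl_eq_Diff_UNIV)
      then show "(if y = 0 then - I else {}) \<in> sets lebesgue" by simp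
    qed
    finally show "(\<lambda>t. if t \<in> I then s n t else 0) -` {if x \<in> I then s n x else 0} \<inter> space lebesgue
       \<in> sets lebesgue" unfolding y_def .
  qed
  moreover have "AE t in lebesgue. t \<in> I \<longrightarrow> (f t \<in> V \<and> (\<lambda>n. s n t) \<longlonglongrightarrow> f t)"
    using ae assms(2) by (subst (asm) AE_restrict_space_iff) auto
  then have "AE t in lebesgue. (\<lambda>n. if t \<in> I then s n t else 0) \<longlonglongrightarrow> (if t \<in> I then f t else 0)"
    by eventually_elim auto
  ultimately show ?thesis unfolding ae_simple_limit_def
    by (intro exI[of _ "\<lambda>n t. if t \<in> I then s n t else 0"]) auto
qed

lemma lebesgue_measurable_AE_cong:
  fixes f g :: "real \<Rightarrow> real"
  assumes "f \<in> borel_measurable lebesgue" "AE t in lebesgue. f t = g t"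
  shows "g \<in> borel_measurable lebesgue"
proof -
  show ?thesis
  proof (rule measurableI)
    fix B :: "real set" assume "B \<in> sets borel"
    with assms(1) have "f -` B \<inter> space lebesgue \<in> sets lebesgue" by (rule measurable_sets)
    then show "g -` B \<inter> space lebesgue \<in> sets lebesgue"
      by (rule completion.in_sets_AE[rotated]) (use assms(2) in auto)
  qed auto
qed

text \<open>With \<open>F\<close> a norm or a functional this gives access to scalar Lebesgue theory for functions
with values in a nonseparable space.\<close>

lemma ae_simple_limit_compose_measurable:
  fixes f :: "real \<Rightarrow> 'b::real_normed_vector" and F :: "'b \<Rightarrow> real"
  assumes "ae_simple_limit f" "continuous_on UNIV F"
  shows "(\<lambda>t. F (f t)) \<in> borel_measurable lebesgue"
proof -
  obtain s where s: "\<And>n. simple_function lebesgue (s n)"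
    and ae: "AE t in lebesgue. (\<lambda>n. s n t) \<longlonglongrightarrow> f t"
    using assms(1) unfolding ae_simple_limit_def by blast
  have m: "(\<lambda>t. F (s n t)) \<in> borel_measurable lebesgue" for n
    using simple_function_compose[OF s[of n], of F] by (auto simp: o_def intro: borel_measurable_simple_function)
  have 1: "(\<lambda>t. lim (\<lambda>n. F (s n t))) \<in> borel_measurable lebesgue"
    by (intro borel_measurable_lim_metric m)
  have 2: "AE t in lebesgue. lim (\<lambda>n. F (s n t)) = F (f t)"
    using ae
  proof eventually_elim
    case (elim t)
    have "(\<lambda>n. F (s n t)) \<longlonglongrightarrow> F (f t)"
      by (rule continuous_on_tendsto_compose[OF assms(2) elim]) auto
    then show ?case by (rule limI)
  qed
  show ?thesis by (rule lebesgue_measurable_AE_cong[OF 1 2])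
qed

lemma simple_function_integrable_on:
  fixes s :: "real \<Rightarrow> 'b::banach"
  assumes "simple_function lebesgue s" "\<And>t. norm (s t) \<le> h t" "integrable lebesgue h"
  shows "s integrable_on UNIV"
proof -
  have fin: "finite (range s)" using assms(1) by (simp add: simple_function_def)
  have eq: "s t = (\<Sum>y\<in>range s. indicat_real (s -` {y}) t *\<^sub>R y)" for t
  proof -
    have "(\<Sum>y\<in>range s. indicat_real (s -` {y}) t *\<^sub>R y) = (\<Sum>y\<in>{s t}. indicat_real (s -` {y}) t *\<^sub>R y)"
      by (rule sum.mono_neutral_right) (use fin in \<open>auto simp: indicator_def\<close>)
    then show ?thesis by simp
  qed
  have "(\<lambda>t. indicat_real (s -` {y}) t *\<^sub>R y) integrable_on UNIV" if "y \<in> range s" for y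
  proof (cases "y = 0")
    case True then show ?thesis by (simp add: integrable_0)
  next
    case False
    have m: "s -` {y} \<in> sets lebesgue" using assms(1) that by (auto simp: simple_function_def)
    have hb: "norm (indicat_real (s -` {y}) t * norm y) \<le> norm (h t)" for t
      using order_trans[OF assms(2)[of t] abs_ge_self] by (auto simp: indicator_def)
    have "integrable lebesgue (\<lambda>t. indicat_real (s -` {y}) t * norm y)"
      by (rule Bochner_Integration.integrable_bound[OF assms(3)])
        (use m hb in auto)
    then have "integrable lebesgue (indicat_real (s -` {y}))" using False by simp
    then have "indicat_real (s -` {y}) integrable_on UNIV" by (rule integrable_on_lebesgue)
    then have "(indicat_real (s -` {y}) has_integral integral UNIV (indicat_real (s -` {y}))) UNIV"
      by (rule integrable_integral)
    then show ?thesis by (rule has_integral_integrable[OF has_integral_scaleR_left])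
  qed
  then have "(\<lambda>t. \<Sum>y\<in>range s. indicat_real (s -` {y}) t *\<^sub>R y) integrable_on UNIV"
    by (rule integrable_sum[OF fin])
  then show ?thesis by (rule integrable_eq) (simp only: eq[symmetric])
qed

text \<open>The approximating simple functions are cut off where they exceed twice the norm of \<open>f\<close>;
they are then dominated by \<open>2 norm f\<close>, and dominated convergence for the real functions
\<open>norm (f - r n)\<close> supplies the \<open>L\<^sup>1\<close>-approximation. In this way Bochner integrable functions
enter the theory of the gauge integral.\<close>

lemma ae_simple_limit_integrable_on:
  fixes f :: "real \<Rightarrow> 'b::banach"
  assumes "ae_simple_limit f" "integrable lebesgue (\<lambda>t. norm (f t))"
  shows "f integrable_on UNIV"
proof -
  obtain s where s: "\<And>n. simple_function lebesgue (s n)"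
    and ae: "AE t in lebesgue. (\<lambda>n. s n t) \<longlonglongrightarrow> f t"
    using assms(1) unfolding ae_simple_limit_def by blast
  obtain N where N: "N \<in> null_sets lebesgue" "\<And>t. t \<notin> N \<Longrightarrow> (\<lambda>n. s n t) \<longlonglongrightarrow> f t"
    using AE_E3[OF ae] by auto
  define f' where "f' t = (if t \<in> N then 0 else f t)" for t
  have nN: "negligible N" using N(1) by (simp add: negligible_iff_null_sets)
  have NL: "N \<in> sets lebesgue" using N(1) by auto
  have nf: "(\<lambda>t. norm (f t)) \<in> borel_measurable lebesgue" using assms(2) by auto
  define r where "r n t = (if norm (s n t) \<le> 2 * norm (f t) \<and> t \<notin> N then s n t else 0)" for n t
  have nf': "norm (f' t) \<le> norm (f t)" for t by (simp add: f'_def)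
  have rs: "simple_function lebesgue (r n)" for n
    unfolding r_def
  proof (rule simple_function_If)
    have "(\<lambda>t. norm (s n t)) \<in> borel_measurable lebesgue"
      using simple_function_compose[OF s[of n], of norm] by (auto simp: o_def intro: borel_measurable_simple_function)
    then have "{x \<in> space lebesgue. norm (s n x) \<le> 2 * norm (f x)} \<in> sets lebesgue"
      using nf by measurable
    then have "{x \<in> space lebesgue. norm (s n x) \<le> 2 * norm (f x)} - N \<in> sets lebesgue" using NL by auto
    moreover have "{x \<in> space lebesgue. norm (s n x) \<le> 2 * norm (f x)} - N
       = {x \<in> space lebesgue. norm (s n x) \<le> 2 * norm (f x) \<and> x \<notin> N}" by auto
    ultimately show "{x \<in> space lebesgue. norm (s n x) \<le> 2 * norm (f x) \<and> x \<notin> N} \<in> sets lebesgue" by simp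
  qed (use s in auto)
  have rb: "norm (r n t) \<le> 2 * norm (f t)" for n t by (simp add: r_def)
  have rl: "(\<lambda>n. r n t) \<longlonglongrightarrow> f' t" for t
  proof (cases "t \<in> N \<or> f t = 0")
    case True
    have "r n t = 0" for n using True by (auto simp: r_def)
    then show ?thesis using True by (auto simp: f'_def)
  next
    case False
    have "(\<lambda>n. norm (s n t)) \<longlonglongrightarrow> norm (f t)" using N(2) False by (intro tendsto_norm) auto
    then have "\<forall>\<^sub>F n in sequentially. norm (s n t) < 2 * norm (f t)"
      using False by (intro order_tendstoD) auto
    then have "\<forall>\<^sub>F n in sequentially. s n t = r n t"
      by eventually_elim (use False in \<open>auto simp: r_def\<close>)
    then show ?thesis using N(2)[of t] False by (auto simp: f'_def intro: Lim_transform_eventually)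
  qed
  have ri: "r n integrable_on UNIV" for n
    by (rule simple_function_integrable_on[OF rs rb]) (use assms(2) in simp)
  have rlim: "ae_simple_limit f'" unfolding ae_simple_limit_def using rs rl by blast
  have mh: "(\<lambda>t. norm (f' t - r n t)) \<in> borel_measurable lebesgue" for n
  proof -
    have "ae_simple_limit (\<lambda>t. f' t - r n t)" unfolding ae_simple_limit_def
    proof (intro exI[of _ "\<lambda>m t. r m t - r n t"] conjI allI)
      show "simple_function lebesgue (\<lambda>t. r m t - r n t)" for m
        using rs by (rule simple_function_compose2[OF rs])
      show "AE t in lebesgue. (\<lambda>m. r m t - r n t) \<longlonglongrightarrow> f' t - r n t"
        by (intro AE_I2 tendsto_diff rl tendsto_const)
    qed
    then show ?thesis by (rule ae_simple_limit_compose_measurable) (intro continuous_intros)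
  qed
  have hb: "norm (f' t - r n t) \<le> 3 * norm (f t)" for n t
    using norm_triangle_ineq4[of "f' t" "r n t"] nf'[of t] rb[of n t] by linarith
  have i3: "integrable lebesgue (\<lambda>t. 3 * norm (f t))" using assms(2) by simp
  have hi: "integrable lebesgue (\<lambda>t. norm (f' t - r n t))" for n
    by (rule Bochner_Integration.integrable_bound[OF i3 mh]) (use hb in \<open>auto intro!: AE_I2\<close>)
  have "(\<lambda>n. integral\<^sup>L lebesgue (\<lambda>t. norm (f' t - r n t))) \<longlonglongrightarrow> integral\<^sup>L lebesgue (\<lambda>t::real. 0::real)"
  proof (rule integral_dominated_convergence[OF _ mh i3])
    have "(\<lambda>n. norm (f' t - r n t)) \<longlonglongrightarrow> norm (f' t - f' t)" for t
      by (intro tendsto_intros rl)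
    then show "AE x in lebesgue. (\<lambda>i. norm (f' x - r i x)) \<longlonglongrightarrow> 0" by simp
    show "AE x in lebesgue. norm (norm (f' x - r n x)) \<le> 3 * norm (f x)" for n using hb by simp
  qed simp
  then have lim0: "(\<lambda>n. integral\<^sup>L lebesgue (\<lambda>t. norm (f' t - r n t))) \<longlonglongrightarrow> 0" by simp
  have "f' integrable_on UNIV"
  proof (rule integrable_on_UNIV_approx)
    fix e :: real assume "e > 0"
    then obtain n where n: "integral\<^sup>L lebesgue (\<lambda>t. norm (f' t - r n t)) < e"
      using order_tendstoD(2)[OF lim0 \<open>e > 0\<close>] by (auto simp: eventually_sequentially)
    show "\<exists>g h. g integrable_on UNIV \<and> h integrable_on UNIV \<and>
        integral UNIV h < e \<and> (\<forall>x. norm (f' x - g x) \<le> h x)"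
      using ri[of n] integrable_on_lebesgue[OF hi[of n]] n integral_lebesgue[OF hi[of n]]
      by (intro exI[of _ "r n"] exI[of _ "\<lambda>t. norm (f' t - r n t)"]) auto
  qed
  then show ?thesis by (rule integrable_spike[OF _ nN]) (auto simp: f'_def)
qed

lemma ae_simple_limit_scaleR:
  fixes f :: "real \<Rightarrow> 'b::real_normed_vector"
  assumes "ae_simple_limit f" "c \<in> borel_measurable lebesgue"
  shows "ae_simple_limit (\<lambda>t. c t *\<^sub>R f t)"
proof -
  obtain s where s: "\<And>n. simple_function lebesgue (s n)"
    and ae: "AE t in lebesgue. (\<lambda>n. s n t) \<longlonglongrightarrow> f t"
    using assms(1) unfolding ae_simple_limit_def by blast
  obtain q where q: "\<And>n. simple_function lebesgue (q n)" "\<And>t. (\<lambda>n. q n t) \<longlonglongrightarrow> (c t :: real)"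
    using borel_measurable_implies_sequence_metric[OF assms(2), of 0] by auto
  show ?thesis unfolding ae_simple_limit_def
  proof (intro exI[of _ "\<lambda>n t. q n t *\<^sub>R s n t"] conjI allI)
    show "simple_function lebesgue (\<lambda>t. q n t *\<^sub>R s n t)" for n
      by (rule simple_function_compose2[OF q(1) s])
    show "AE t in lebesgue. (\<lambda>n. q n t *\<^sub>R s n t) \<longlonglongrightarrow> c t *\<^sub>R f t"
      using ae by eventually_elim (intro tendsto_scaleR q(2))
  qed
qed

section \<open>A norming functional\<close>

text \<open>One-dimensional extension step. A functional dominated by the norm is represented by
its graph \<open>G\<close>, a subspace of the product; the bound \<open>d \<le> norm y\<close> on \<open>G\<close> makes \<open>G\<close> single valued,
so functions with varying domains need not be handled. The new value \<open>c\<close> at \<open>z\<close> is squeezed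
between \<open>d - norm (y - z)\<close> and \<open>norm (y + z) - d\<close>.\<close>

lemma hahn_banach_extend:
  fixes G :: "('b::real_normed_vector \<times> real) set"
  assumes sub: "subspace G" and bound: "\<And>y d. (y, d) \<in> G \<Longrightarrow> d \<le> norm y"
  shows "\<exists>G'. subspace G' \<and> G \<subseteq> G' \<and> (\<forall>(y, d)\<in>G'. d \<le> norm y) \<and> (\<exists>c. (z, c) \<in> G')"
proof -
  have sep: "d1 - norm (y1 - z) \<le> norm (y2 + z) - d2" if "(y1, d1) \<in> G" "(y2, d2) \<in> G" for y1 d1 y2 d2
  proof -
    have "(y1 + y2, d1 + d2) \<in> G" using subspace_add[OF sub that] by simp
    then have "d1 + d2 \<le> norm ((y1 - z) + (y2 + z))" using bound by simp
    then show ?thesis using norm_triangle_ineq[of "y1 - z" "y2 + z"] by linarith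
  qed
  have z: "(0, 0) \<in> G" using subspace_0[OF sub] by (simp add: zero_prod_def)
  define L where "L = (\<lambda>(y, d). d - norm (y - z)) ` G"
  define c where "c = Sup L"
  have L: "bdd_above L" "L \<noteq> {}"
    using sep[OF _ z] z unfolding L_def by (auto intro!: bdd_aboveI[of _ "norm (0 + z) - 0"])
  have c1: "d - norm (y - z) \<le> c" if "(y, d) \<in> G" for y d
    unfolding c_def by (rule cSup_upper) (use that L in \<open>auto simp: L_def\<close>)
  have c2: "c \<le> norm (y + z) - d" if "(y, d) \<in> G" for y d
    unfolding c_def by (rule cSup_least[OF L(2)]) (use that sep in \<open>auto simp: L_def\<close>)
  define G' where "G' = {(y + a *\<^sub>R z, d + a * c) | y d a. (y, d) \<in> G}"
  have "subspace G'"
    unfolding subspace_def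
  proof (intro conjI ballI allI)
    show "0 \<in> G'" unfolding G'_def using z by (force simp: zero_prod_def)
    fix p q assume "p \<in> G'" "q \<in> G'"
    then obtain y d a y' d' a' where *: "p = (y + a *\<^sub>R z, d + a * c)" "(y, d) \<in> G"
      "q = (y' + a' *\<^sub>R z, d' + a' * c)" "(y', d') \<in> G" unfolding G'_def by blast
    have "p + q = ((y + y') + (a + a') *\<^sub>R z, (d + d') + (a + a') * c)"
      using * by (simp add: algebra_simps)
    moreover have "(y + y', d + d') \<in> G" using subspace_add[OF sub *(2,4)] by simp
    ultimately show "p + q \<in> G'" unfolding G'_def by blast
  next
    fix r :: real and p assume "p \<in> G'"
    then obtain y d a where *: "p = (y + a *\<^sub>R z, d + a * c)" "(y, d) \<in> G" unfolding G'_def by blast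
    have "r *\<^sub>R p = (r *\<^sub>R y + (r * a) *\<^sub>R z, r * d + (r * a) * c)"
      using * by (simp add: algebra_simps)
    moreover have "(r *\<^sub>R y, r * d) \<in> G" using subspace_scale[OF sub *(2), of r] by simp
    ultimately show "r *\<^sub>R p \<in> G'" unfolding G'_def by blast
  qed
  moreover have "G \<subseteq> G'"
  proof
    fix p assume "p \<in> G"
    then have "(fst p, snd p) \<in> G" by simp
    then have "(fst p + 0 *\<^sub>R z, snd p + 0 * c) \<in> G'" unfolding G'_def by blast
    then show "p \<in> G'" by simp
  qed
  moreover have "d + a * c \<le> norm (y + a *\<^sub>R z)" if yd: "(y, d) \<in> G" for y d a
  proof -
    consider "a = 0" | "a > 0" | "a < 0" by linarith
    then show ?thesis
    proof cases
      case 1 then show ?thesis using bound[OF yd] by simp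
    next
      case 2
      have "((1/a) *\<^sub>R y, d / a) \<in> G" using subspace_scale[OF sub yd, of "1/a"] by simp
      then have "c \<le> norm ((1/a) *\<^sub>R y + z) - d / a" by (rule c2)
      then have "a * c \<le> a * (norm ((1/a) *\<^sub>R y + z) - d / a)" using 2 by (intro mult_left_mono) auto
      also have "\<dots> = norm (a *\<^sub>R ((1/a) *\<^sub>R y + z)) - d" using 2 by (simp add: right_diff_distrib)
      also have "a *\<^sub>R ((1/a) *\<^sub>R y + z) = y + a *\<^sub>R z" using 2 by (simp add: scaleR_add_right)
      finally show ?thesis by simp
    next
      case 3
      define b where "b = - a"
      have b: "b > 0" "a = - b" using 3 by (auto simp: b_def)
      have "((1/b) *\<^sub>R y, d / b) \<in> G" using subspace_scale[OF sub yd, of "1/b"] by simp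
      then have "d / b - norm ((1/b) *\<^sub>R y - z) \<le> c" by (rule c1)
      then have "b * (d / b - norm ((1/b) *\<^sub>R y - z)) \<le> b * c" using b by (intro mult_left_mono) auto
      also have "b * (d / b - norm ((1/b) *\<^sub>R y - z)) = d - norm (b *\<^sub>R ((1/b) *\<^sub>R y - z))"
        using b by (simp add: right_diff_distrib)
      also have "b *\<^sub>R ((1/b) *\<^sub>R y - z) = y + a *\<^sub>R z" using b by (simp add: scaleR_diff_right)
      finally show ?thesis using b by simp
    qed
  qed
  then have "\<forall>(y, d)\<in>G'. d \<le> norm y" unfolding G'_def by auto
  moreover have "(0 + 1 *\<^sub>R z, 0 + 1 * c) \<in> G'" unfolding G'_def using z by blast
  ultimately show ?thesis by (intro exI[of _ G']) auto
qed

text \<open>The Hahn-Banach theorem: Zorn's lemma gives a maximal graph containing \<open>(x, norm x)\<close>, and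
the extension step shows that its domain is everything.\<close>

lemma norming_functional_exists:
  fixes x :: "'b::real_normed_vector"
  obtains l :: "'b \<Rightarrow> real" where "bounded_linear l" "\<And>y. \<bar>l y\<bar> \<le> norm y" "l x = norm x"
proof -
  define P where "P = {G :: ('b \<times> real) set. subspace G \<and> (\<forall>(y, d)\<in>G. d \<le> norm y) \<and> (x, norm x) \<in> G}"
  define G0 where "G0 = range (\<lambda>a. (a *\<^sub>R x, a * norm x))"
  have "subspace G0"
    unfolding subspace_def G0_def
  proof (intro conjI ballI allI)
    have "0 = (0 *\<^sub>R x, 0 * norm x)" by (simp add: zero_prod_def)
    then show "0 \<in> range (\<lambda>a. (a *\<^sub>R x, a * norm x))" by blast
  next
    fix p q assume "p \<in> range (\<lambda>a. (a *\<^sub>R x, a * norm x))" "q \<in> range (\<lambda>a. (a *\<^sub>R x, a * norm x))"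
    then obtain a b where "p = (a *\<^sub>R x, a * norm x)" "q = (b *\<^sub>R x, b * norm x)" by auto
    then have "p + q = ((a + b) *\<^sub>R x, (a + b) * norm x)" by (simp add: algebra_simps)
    then show "p + q \<in> range (\<lambda>a. (a *\<^sub>R x, a * norm x))" by blast
  next
    fix r :: real and p assume "p \<in> range (\<lambda>a. (a *\<^sub>R x, a * norm x))"
    then obtain a where "p = (a *\<^sub>R x, a * norm x)" by auto
    then have "r *\<^sub>R p = ((r * a) *\<^sub>R x, (r * a) * norm x)" by simp
    then show "r *\<^sub>R p \<in> range (\<lambda>a. (a *\<^sub>R x, a * norm x))" by blast
  qed
  moreover have "d \<le> norm y" if "(y, d) \<in> G0" for y d
    using that by (auto simp: G0_def intro!: mult_right_mono)
  moreover have "(1 *\<^sub>R x, 1 * norm x) \<in> G0" unfolding G0_def by blast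
  ultimately have "G0 \<in> P" unfolding P_def by auto
  have "\<exists>G\<in>P. \<forall>G'\<in>P. G \<subseteq> G' \<longrightarrow> G' = G"
  proof (rule subset_Zorn_nonempty)
    show "P \<noteq> {}" using \<open>G0 \<in> P\<close> by auto
    fix C assume C: "C \<noteq> {}" "subset.chain P C"
    have "subspace (\<Union>C)"
      unfolding subspace_def
    proof (intro conjI ballI allI)
      obtain G where "G \<in> C" using C(1) by auto
      moreover then have "subspace G" using C by (auto simp: subset_chain_def P_def)
      ultimately show "0 \<in> \<Union>C" using subspace_0 by blast
      fix p q assume "p \<in> \<Union>C" "q \<in> \<Union>C"
      then obtain G H where *: "G \<in> C" "H \<in> C" "p \<in> G" "q \<in> H" by auto
      then have "G \<subseteq> H \<or> H \<subseteq> G" using C by (auto simp: subset_chain_def)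
      then obtain K where "K \<in> C" "p \<in> K" "q \<in> K" using * by auto
      moreover then have "subspace K" using C by (auto simp: subset_chain_def P_def)
      ultimately show "p + q \<in> \<Union>C" using subspace_add by blast
    next
      fix r :: real and p assume "p \<in> \<Union>C"
      then obtain G where "G \<in> C" "p \<in> G" by auto
      moreover then have "subspace G" using C by (auto simp: subset_chain_def P_def)
      ultimately show "r *\<^sub>R p \<in> \<Union>C" using subspace_scale by blast
    qed
    then show "\<Union>C \<in> P" using C unfolding P_def subset_chain_def by blast
  qed
  then obtain G where G: "G \<in> P" "\<And>G'. G' \<in> P \<Longrightarrow> G \<subseteq> G' \<Longrightarrow> G' = G" by auto
  have sub: "subspace G" and bd: "\<And>y d. (y, d) \<in> G \<Longrightarrow> d \<le> norm y" and xG: "(x, norm x) \<in> G"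
    using G(1) unfolding P_def by auto
  have tot: "\<exists>c. (z, c) \<in> G" for z
  proof -
    obtain G' where "subspace G'" "G \<subseteq> G'" "\<forall>(y, d)\<in>G'. d \<le> norm y" "\<exists>c. (z, c) \<in> G'"
      using hahn_banach_extend[OF sub bd] by blast
    then show ?thesis using G(2)[of G'] xG unfolding P_def by auto
  qed
  have abs: "\<bar>d\<bar> \<le> norm y" if "(y, d) \<in> G" for y d
    using bd[OF that] bd[of "- y" "- d"] subspace_neg[OF sub that] by auto
  have uniq: "c = d" if "(y, c) \<in> G" "(y, d) \<in> G" for y c d
    using abs[of 0 "c - d"] subspace_diff[OF sub that] by simp
  define l where "l y = (THE c. (y, c) \<in> G)" for y
  have l: "(y, l y) \<in> G" for y
    unfolding l_def by (rule theI') (use tot uniq in blast)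
  have lab: "\<bar>l y\<bar> \<le> norm y" for y using abs[OF l] .
  show ?thesis
  proof
    show "bounded_linear l"
    proof (rule bounded_linear_intro)
      show "l (y + z) = l y + l z" for y z
        by (rule uniq[OF l]) (use subspace_add[OF sub l[of y] l[of z]] in simp)
      show "l (r *\<^sub>R y) = r *\<^sub>R l y" for r y
        by (rule uniq[OF l]) (use subspace_scale[OF sub l[of y], of r] in simp)
      show "norm (l y) \<le> norm y * 1" for y using lab by simp
    qed
    show "\<bar>l y\<bar> \<le> norm y" for y by (rule lab)
    show "l x = norm x" by (rule uniq[OF l xG])
  qed
qed

lemma functionals_separate_points:
  fixes x y :: "'b::real_normed_vector"
  assumes "\<And>l :: 'b \<Rightarrow> real. bounded_linear l \<Longrightarrow> l x = l y"
  shows "x = y"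
proof -
  obtain l :: "'b \<Rightarrow> real" where l: "bounded_linear l" "l (x - y) = norm (x - y)"
    by (rule norming_functional_exists[of "x - y"])
  then show ?thesis using assms[OF l(1)] by (simp add: linear_diff bounded_linear.linear)
qed

section \<open>Functional calculus of a decaying semigroup\<close>

text \<open>Kernels against which every orbit bounded by a multiple of \<open>exp (- w t)\<close> is integrable.
The value is zero on \<open>t \<le> 0\<close>, so that integrals run over the whole line and the values of
\<open>S\<close> at negative times do not enter.\<close>

definition decay_kernel :: "real \<Rightarrow> (real \<Rightarrow> real) \<Rightarrow> bool" where
  "decay_kernel w a \<longleftrightarrow> a \<in> borel_measurable borel \<and> (\<forall>t. 0 \<le> a t) \<and> (\<forall>t\<le>0. a t = 0) \<and>
     integrable lborel (\<lambda>t. a t * exp (- w * t))"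

text \<open>Fubini for \<open>a(\<sigma>) b(r - \<sigma>) F(r)\<close>, which is dominated by a multiple of the integrable
function \<open>a(\<sigma>) e\<^sup>-\<^sup>w\<^sup>\<sigma> b(r - \<sigma>) e\<^sup>-\<^sup>w\<^sup>(\<^sup>r\<^sup>-\<^sup>\<sigma>\<^sup>)\<close>.\<close>

lemma convolution_integral_borel:
  fixes F :: "real \<Rightarrow> real"
  assumes a: "decay_kernel w a" and b: "decay_kernel w b"
    and F[measurable]: "F \<in> borel_measurable borel" and FC: "\<And>r. \<bar>F r\<bar> \<le> C * exp (- w * r)"
  shows "(\<integral>\<sigma>. a \<sigma> * (\<integral>\<tau>. b \<tau> * F (\<sigma> + \<tau>) \<partial>lborel) \<partial>lborel)
       = (\<integral>r. (\<integral>\<sigma>. a \<sigma> * b (r - \<sigma>) \<partial>lborel) * F r \<partial>lborel)"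
proof -
  have am[measurable]: "a \<in> borel_measurable borel" and a0: "\<And>t. 0 \<le> a t"
    and ai: "integrable lborel (\<lambda>t. a t * exp (- w * t))"
    using a by (auto simp: decay_kernel_def)
  have bm[measurable]: "b \<in> borel_measurable borel" and b0: "\<And>t. 0 \<le> b t"
    and bi: "integrable lborel (\<lambda>t. b t * exp (- w * t))"
    using b by (auto simp: decay_kernel_def)
  define K where "K = (\<lambda>(\<sigma>, r). (a \<sigma> * exp (- w * \<sigma>)) * (b (r - \<sigma>) * exp (- w * (r - \<sigma>))))"
  have bis: "integrable lborel (\<lambda>r. b (r - \<sigma>) * exp (- w * (r - \<sigma>)))" for \<sigma>
    using lborel_integrable_real_affine[OF bi, of 1 "-\<sigma>"] by simp
  have bI: "(\<integral>r. b (r - \<sigma>) * exp (- w * (r - \<sigma>)) \<partial>lborel) = (\<integral>r. b r * exp (- w * r) \<partial>lborel)" for \<sigma>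
    using lborel_integral_real_affine[of 1 "\<lambda>t. b t * exp (- w * t)" "-\<sigma>"] by simp
  have Ki: "integrable (lborel \<Otimes>\<^sub>M lborel) K"
  proof (rule lborel_pair.Fubini_integrable)
    show "K \<in> borel_measurable (lborel \<Otimes>\<^sub>M lborel)" unfolding K_def by measurable
    have "(\<integral>r. norm (K (\<sigma>, r)) \<partial>lborel)
        = (a \<sigma> * exp (- w * \<sigma>)) * (\<integral>r. b r * exp (- w * r) \<partial>lborel)" for \<sigma>
    proof -
      have "norm (K (\<sigma>, r)) = (a \<sigma> * exp (- w * \<sigma>)) * (b (r - \<sigma>) * exp (- w * (r - \<sigma>)))" for r
        using a0 b0 by (simp add: K_def abs_mult)
      then show ?thesis using bI[of \<sigma>] by simp
    qed
    then show "integrable lborel (\<lambda>\<sigma>. \<integral>r. norm (K (\<sigma>, r)) \<partial>lborel)" using ai by simp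
    show "AE \<sigma> in lborel. integrable lborel (\<lambda>r. K (\<sigma>, r))" using bis by (simp add: K_def)
  qed
  define H where "H = (\<lambda>\<sigma> r. a \<sigma> * b (r - \<sigma>) * F r)"
  have Hi: "integrable (lborel \<Otimes>\<^sub>M lborel) (case_prod H)"
  proof (rule Bochner_Integration.integrable_bound)
    show "integrable (lborel \<Otimes>\<^sub>M lborel) (\<lambda>p. C * K p)" using Ki by simp
    show "case_prod H \<in> borel_measurable (lborel \<Otimes>\<^sub>M lborel)" unfolding H_def by measurable
    have "\<bar>a \<sigma> * b (r - \<sigma>) * F r\<bar> \<le> \<bar>C * K (\<sigma>, r)\<bar>" for \<sigma> r
    proof -
      have "a \<sigma> * b (r - \<sigma>) * \<bar>F r\<bar> \<le> a \<sigma> * b (r - \<sigma>) * (C * exp (- w * r))"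
        by (intro mult_left_mono FC mult_nonneg_nonneg a0 b0)
      also have "\<dots> = C * K (\<sigma>, r)" by (simp add: K_def exp_add[symmetric] algebra_simps mult_exp_exp)
      also have "\<dots> \<le> \<bar>C * K (\<sigma>, r)\<bar>" by (rule abs_ge_self)
      finally show ?thesis using a0[of \<sigma>] b0[of "r - \<sigma>"] by (simp only: abs_mult abs_of_nonneg)
    qed
    then show "AE p in lborel \<Otimes>\<^sub>M lborel. norm (case_prod H p) \<le> norm (C * K p)"
      by (auto simp: H_def)
  qed
  have "(\<integral>\<sigma>. a \<sigma> * (\<integral>\<tau>. b \<tau> * F (\<sigma> + \<tau>) \<partial>lborel) \<partial>lborel) = (\<integral>\<sigma>. (\<integral>r. H \<sigma> r \<partial>lborel) \<partial>lborel)"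
  proof (rule Bochner_Integration.integral_cong[OF refl])
    fix \<sigma>
    have "(\<integral>r. H \<sigma> r \<partial>lborel) = a \<sigma> * (\<integral>r. b (r - \<sigma>) * F r \<partial>lborel)"
      unfolding H_def by (simp add: mult.assoc)
    also have "(\<integral>r. b (r - \<sigma>) * F r \<partial>lborel) = (\<integral>\<tau>. b \<tau> * F (\<sigma> + \<tau>) \<partial>lborel)"
      using lborel_integral_real_affine[of 1 "\<lambda>r. b (r - \<sigma>) * F r" \<sigma>] by simp
    finally show "a \<sigma> * (\<integral>\<tau>. b \<tau> * F (\<sigma> + \<tau>) \<partial>lborel) = (\<integral>r. H \<sigma> r \<partial>lborel)" by simp
  qed
  also have "\<dots> = (\<integral>r. (\<integral>\<sigma>. H \<sigma> r \<partial>lborel) \<partial>lborel)"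
    by (rule lborel_pair.Fubini_integral[OF Hi, symmetric])
  finally show ?thesis by (simp add: H_def)
qed

text \<open>For Lebesgue measurable \<open>F\<close>, the function \<open>(\<sigma>, \<tau>) \<mapsto> F (\<sigma> + \<tau>)\<close> is in general not measurable
for the product of the Borel \<open>\<sigma>\<close>-algebras. Therefore \<open>F\<close> is replaced by a Borel version with
the same bound; translates of the exceptional null set are null, so no inner integral
changes.\<close>

lemma convolution_integral_lebesgue:
  fixes F :: "real \<Rightarrow> real"
  assumes a: "decay_kernel w a" and b: "decay_kernel w b"
    and F: "F \<in> borel_measurable lebesgue" and FC: "\<And>r. \<bar>F r\<bar> \<le> C * exp (- w * r)"
  shows "(\<integral>\<sigma>. a \<sigma> * (\<integral>\<tau>. b \<tau> * F (\<sigma> + \<tau>) \<partial>lebesgue) \<partial>lebesgue)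
       = (\<integral>r. (\<integral>\<sigma>. a \<sigma> * b (r - \<sigma>) \<partial>lborel) * F r \<partial>lebesgue)"
proof -
  have am[measurable]: "a \<in> borel_measurable borel" using a by (auto simp: decay_kernel_def)
  have bm[measurable]: "b \<in> borel_measurable borel" using b by (auto simp: decay_kernel_def)
  obtain F0 where F0[measurable]: "F0 \<in> borel_measurable lborel" and ae0: "AE x in lborel. F x = F0 x"
    using completion_ex_borel_measurable_real[OF F] by auto
  have C0: "0 \<le> C" using order_trans[OF abs_ge_zero FC[of 0]] by simp
  \<comment> \<open>Truncation restores the pointwise bound, which the Borel version inherits only almost everywhere.\<close>
  define G where "G r = (if \<bar>F0 r\<bar> \<le> C * exp (- w * r) then F0 r else 0)" for r
  have G[measurable]: "G \<in> borel_measurable borel" using F0 unfolding G_def by measurable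
  have GC: "\<bar>G r\<bar> \<le> C * exp (- w * r)" for r using C0 by (simp add: G_def)
  have ae: "AE x in lebesgue. G x = F x"
    using AE_completion[OF ae0]
  proof eventually_elim
    case (elim x) then show ?case using FC[of x] by (simp add: G_def)
  qed
  have null: "negligible {x. G x \<noteq> F x}"
    using ae unfolding negligible_iff_null_sets completion.AE_iff_null_sets by simp
  have aet: "AE \<tau> in lebesgue. G (\<sigma> + \<tau>) = F (\<sigma> + \<tau>)" for \<sigma>
  proof -
    have "{\<tau>. G (\<sigma> + \<tau>) \<noteq> F (\<sigma> + \<tau>)} = (+) (-\<sigma>) ` {x. G x \<noteq> F x}"
      by (force simp: image_iff intro: exI[of _ "\<sigma> + _"])
    then have "negligible {\<tau>. G (\<sigma> + \<tau>) \<noteq> F (\<sigma> + \<tau>)}" using negligible_translation[OF null] by (simp only:)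
    then show ?thesis unfolding negligible_iff_null_sets completion.AE_iff_null_sets by simp
  qed
  have lm: "f \<in> borel_measurable lebesgue" if "f \<in> borel_measurable borel" for f :: "real \<Rightarrow> real"
    using that by (intro measurable_completion) simp
  have inner: "(\<integral>\<tau>. b \<tau> * F (\<sigma> + \<tau>) \<partial>lebesgue) = (\<integral>\<tau>. b \<tau> * G (\<sigma> + \<tau>) \<partial>lborel)" for \<sigma>
  proof -
    have Gt: "(\<lambda>\<tau>. b \<tau> * G (\<sigma> + \<tau>)) \<in> borel_measurable borel" by measurable
    have ae': "AE \<tau> in lebesgue. b \<tau> * G (\<sigma> + \<tau>) = b \<tau> * F (\<sigma> + \<tau>)" using aet[of \<sigma>] by auto
    have "(\<integral>\<tau>. b \<tau> * G (\<sigma> + \<tau>) \<partial>lebesgue) = (\<integral>\<tau>. b \<tau> * F (\<sigma> + \<tau>) \<partial>lebesgue)"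
      by (rule integral_cong_AE[OF lm[OF Gt] lebesgue_measurable_AE_cong[OF lm[OF Gt] ae'] ae'])
    then show ?thesis using Gt by (simp add: integral_completion)
  qed
  have cm: "(\<lambda>r. \<integral>\<sigma>. a \<sigma> * b (r - \<sigma>) \<partial>lborel) \<in> borel_measurable borel" by measurable
  have "(\<integral>\<sigma>. a \<sigma> * (\<integral>\<tau>. b \<tau> * F (\<sigma> + \<tau>) \<partial>lebesgue) \<partial>lebesgue)
      = (\<integral>\<sigma>. a \<sigma> * (\<integral>\<tau>. b \<tau> * G (\<sigma> + \<tau>) \<partial>lborel) \<partial>lebesgue)" by (simp add: inner)
  also have "\<dots> = (\<integral>\<sigma>. a \<sigma> * (\<integral>\<tau>. b \<tau> * G (\<sigma> + \<tau>) \<partial>lborel) \<partial>lborel)"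
    by (rule integral_completion) measurable
  also have "\<dots> = (\<integral>r. (\<integral>\<sigma>. a \<sigma> * b (r - \<sigma>) \<partial>lborel) * G r \<partial>lborel)"
    by (rule convolution_integral_borel[OF a b G GC])
  also have "\<dots> = (\<integral>r. (\<integral>\<sigma>. a \<sigma> * b (r - \<sigma>) \<partial>lborel) * G r \<partial>lebesgue)"
    by (rule integral_completion[symmetric]) (use cm in simp)
  also have "\<dots> = (\<integral>r. (\<integral>\<sigma>. a \<sigma> * b (r - \<sigma>) \<partial>lborel) * F r \<partial>lebesgue)"
  proof (rule integral_cong_AE)
    show 1: "(\<lambda>r. (\<integral>\<sigma>. a \<sigma> * b (r - \<sigma>) \<partial>lborel) * G r) \<in> borel_measurable lebesgue"
      by (rule lm) (use cm G in measurable)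
    show 2: "AE r in lebesgue. (\<integral>\<sigma>. a \<sigma> * b (r - \<sigma>) \<partial>lborel) * G r = (\<integral>\<sigma>. a \<sigma> * b (r - \<sigma>) \<partial>lborel) * F r"
      using ae by auto
    show "(\<lambda>r. (\<integral>\<sigma>. a \<sigma> * b (r - \<sigma>) \<partial>lborel) * F r) \<in> borel_measurable lebesgue"
      by (rule lebesgue_measurable_AE_cong[OF 1 2])
  qed
  finally show ?thesis .
qed

text \<open>The Phillips functional calculus: for \<open>a t = exp (- \<mu> t)\<close> it yields the resolvent, for
\<open>a t = t powr (\<alpha> - 1) / Gamma \<alpha>\<close> the negative power of order \<open>\<alpha>\<close>.\<close>

definition phillips :: "(real \<Rightarrow> 'a::complex_banach \<Rightarrow> 'a) \<Rightarrow> (real \<Rightarrow> real) \<Rightarrow> 'a \<Rightarrow> 'a" where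
  "phillips S a x = integral UNIV (\<lambda>t. a t *\<^sub>R S t x)"

locale decaying_semigroup =
  fixes S :: "real \<Rightarrow> 'a::complex_banach \<Rightarrow> 'a" and M0 w :: real
  assumes semigroup: "strongly_measurable_semigroup S"
    and M0_ge_1: "1 \<le> M0"
    and decay: "\<forall>t\<ge>0. onorm (S t) \<le> M0 * exp (- w * t)"
begin

lemma semigroup_clinear: "0 \<le> t \<Longrightarrow> bounded_clinear (S t)"
  using semigroup by (simp add: strongly_measurable_semigroup_def)

lemma semigroup_linear: "0 \<le> t \<Longrightarrow> bounded_linear (S t)"
  using semigroup_clinear by (simp add: bounded_clinear_def)

lemma semigroup_add: "0 \<le> t \<Longrightarrow> 0 \<le> r \<Longrightarrow> S (t + r) x = S t (S r x)"
  using semigroup by (simp add: strongly_measurable_semigroup_def)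

lemma semigroup_decay: "0 \<le> t \<Longrightarrow> norm (S t x) \<le> M0 * norm x * exp (- w * t)"
proof -
  assume t: "0 \<le> t"
  have "norm (S t x) \<le> onorm (S t) * norm x" by (rule onorm[OF semigroup_linear[OF t]])
  also have "\<dots> \<le> (M0 * exp (- w * t)) * norm x" using decay t by (intro mult_right_mono) auto
  finally show ?thesis by (simp add: algebra_simps)
qed

lemma orbit_measurable: "ae_simple_limit (\<lambda>t. if 0 \<le> t then S t x else 0)"
proof -
  have "strongly_measurable_into UNIV {0..} (\<lambda>t. S t x)"
    using semigroup by (simp add: strongly_measurable_semigroup_def)
  from strongly_measurable_into_extend_zero[OF this] show ?thesis by simp
qed

lemma functional_orbit_measurable:
  assumes "bounded_linear l"
  shows "(\<lambda>t. if 0 \<le> t then l (S t x) else 0 :: real) \<in> borel_measurable lebesgue"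
proof -
  have "(\<lambda>t. l (if 0 \<le> t then S t x else 0)) \<in> borel_measurable lebesgue"
    by (rule ae_simple_limit_compose_measurable[OF orbit_measurable])
      (rule linear_continuous_on[OF assms])
  also have "(\<lambda>t. l (if 0 \<le> t then S t x else 0)) = (\<lambda>t. if 0 \<le> t then l (S t x) else 0)"
    using assms by (auto simp: linear_0 bounded_linear.linear)
  finally show ?thesis .
qed

text \<open>Domination by \<open>M0 norm x a(t) exp (- w t)\<close>.\<close>

lemma kernel_orbit_norm_integrable:
  assumes a: "decay_kernel w a"
  shows "ae_simple_limit (\<lambda>t. a t *\<^sub>R S t x)" "integrable lebesgue (\<lambda>t. norm (a t *\<^sub>R S t x))"
proof -
  have am: "a \<in> borel_measurable borel" and a0: "\<And>t. 0 \<le> a t" and an: "\<And>t. t \<le> 0 \<Longrightarrow> a t = 0"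
    and ai: "integrable lborel (\<lambda>t. a t * exp (- w * t))"
    using a by (auto simp: decay_kernel_def)
  have "a \<in> borel_measurable lebesgue" using am by (intro measurable_completion) simp
  then have "ae_simple_limit (\<lambda>t. a t *\<^sub>R (if 0 \<le> t then S t x else 0))"
    by (rule ae_simple_limit_scaleR[OF orbit_measurable])
  moreover have "(\<lambda>t. a t *\<^sub>R (if 0 \<le> t then S t x else 0)) = (\<lambda>t. a t *\<^sub>R S t x)"
    using an by auto
  ultimately show lim: "ae_simple_limit (\<lambda>t. a t *\<^sub>R S t x)" by simp
  show "integrable lebesgue (\<lambda>t. norm (a t *\<^sub>R S t x))"
  proof (rule Bochner_Integration.integrable_bound)
    show "integrable lebesgue (\<lambda>t. (M0 * norm x) * (a t * exp (- w * t)))"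
      using ai am by (intro integrable_mult_right) (simp add: integrable_completion)
    show "(\<lambda>t. norm (a t *\<^sub>R S t x)) \<in> borel_measurable lebesgue"
      by (rule ae_simple_limit_compose_measurable[OF lim]) (intro continuous_intros)
    have "norm (a t *\<^sub>R S t x) \<le> (M0 * norm x) * (a t * exp (- w * t))" for t
    proof (cases "t \<le> 0")
      case False
      then have "a t * norm (S t x) \<le> a t * (M0 * norm x * exp (- w * t))"
        by (intro mult_left_mono semigroup_decay a0) auto
      then show ?thesis using a0[of t] by (simp add: algebra_simps)
    qed (simp add: an)
    then show "AE t in lebesgue. norm (norm (a t *\<^sub>R S t x)) \<le> norm ((M0 * norm x) * (a t * exp (- w * t)))"
      by (intro AE_I2) (use order_trans[OF _ abs_ge_self] in force)
  qed
qed

lemma phillips_has_integral: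
  assumes "decay_kernel w a"
  shows "((\<lambda>t. a t *\<^sub>R S t x) has_integral phillips S a x) UNIV"
  unfolding phillips_def
  by (rule integrable_integral[OF ae_simple_limit_integrable_on])
    (rule kernel_orbit_norm_integrable[OF assms])+

text \<open>Functionals commute with the integral; the scalar integral is a Lebesgue integral, to
which Fubini applies.\<close>

lemma functional_phillips:
  fixes l :: "'a \<Rightarrow> real"
  assumes a: "decay_kernel w a" and l: "bounded_linear l"
  shows "l (phillips S a x) = (\<integral>t. a t * l (S t x) \<partial>lebesgue)"
proof -
  obtain K where K: "\<And>y. norm (l y) \<le> norm y * K" using bounded_linear.bounded[OF l] by blast
  have hl: "((\<lambda>t. a t * l (S t x)) has_integral l (phillips S a x)) UNIV"
    using has_integral_linear[OF phillips_has_integral[OF a] l, of x]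
    by (simp add: o_def linear_scale[OF bounded_linear.linear[OF l]])
  have i: "integrable lebesgue (\<lambda>t. a t * l (S t x))"
  proof (rule Bochner_Integration.integrable_bound)
    show "integrable lebesgue (\<lambda>t. K * norm (a t *\<^sub>R S t x))"
      using kernel_orbit_norm_integrable(2)[OF a] by (rule integrable_mult_right)
    have "(\<lambda>t. l (a t *\<^sub>R S t x)) \<in> borel_measurable lebesgue"
      by (rule ae_simple_limit_compose_measurable[OF kernel_orbit_norm_integrable(1)[OF a]])
        (rule linear_continuous_on[OF l])
    then show "(\<lambda>t. a t * l (S t x)) \<in> borel_measurable lebesgue"
      by (simp add: linear_scale[OF bounded_linear.linear[OF l]])
    have "\<bar>a t * l (S t x)\<bar> \<le> \<bar>K * norm (a t *\<^sub>R S t x)\<bar>" for t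
      using order_trans[OF K[of "a t *\<^sub>R S t x"] abs_ge_self]
      by (simp add: linear_scale[OF bounded_linear.linear[OF l]] mult_ac)
    then show "AE t in lebesgue. norm (a t * l (S t x)) \<le> norm (K * norm (a t *\<^sub>R S t x))" by simp
  qed
  from integral_lebesgue[OF i] hl show "l (phillips S a x) = (\<integral>t. a t * l (S t x) \<partial>lebesgue)"
    by (simp add: integral_unique)
qed

lemma phillips_commute_semigroup:
  assumes a: "decay_kernel w a" and t: "0 \<le> t"
  shows "S t (phillips S a x) = phillips S a (S t x)"
proof -
  have an: "\<And>t. t \<le> 0 \<Longrightarrow> a t = 0" using a by (auto simp: decay_kernel_def)
  have "((\<lambda>r. S t (a r *\<^sub>R S r x)) has_integral S t (phillips S a x)) UNIV"
    using has_integral_linear[OF phillips_has_integral[OF a] semigroup_linear[OF t], of x]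
    by (simp add: o_def)
  also have "(\<lambda>r. S t (a r *\<^sub>R S r x)) = (\<lambda>r. a r *\<^sub>R S r (S t x))"
  proof
    fix r
    show "S t (a r *\<^sub>R S r x) = a r *\<^sub>R S r (S t x)"
      using semigroup_add[OF t, of r x] semigroup_add[OF _ t, of r x] an[of r]
        linear_scale[OF bounded_linear.linear[OF semigroup_linear[OF t]]]
      by (cases "r \<le> 0") (auto simp: add.commute linear_0[OF bounded_linear.linear[OF semigroup_linear[OF t]]])
  qed
  finally show ?thesis using phillips_has_integral[OF a] has_integral_unique by blast
qed

text \<open>For a functional \<open>l\<close>, each \<open>l \<circ> S(\<sigma>)\<close> is again a functional, so that both integrals can be
taken inside. The semigroup law makes the integrand a function of \<open>\<sigma> + \<tau>\<close>, to which the
scalar convolution formula applies, and functionals separate points.\<close>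

theorem phillips_convolution:
  assumes a: "decay_kernel w a" and b: "decay_kernel w b" and c: "decay_kernel w c"
    and conv: "\<And>r. 0 < r \<Longrightarrow> (\<integral>\<sigma>. a \<sigma> * b (r - \<sigma>) \<partial>lborel) = c r"
  shows "phillips S a (phillips S b x) = phillips S c x"
proof (rule functionals_separate_points)
  fix l :: "'a \<Rightarrow> real" assume l: "bounded_linear l"
  have an: "\<And>t. t \<le> 0 \<Longrightarrow> a t = 0" and bn: "\<And>t. t \<le> 0 \<Longrightarrow> b t = 0" and cn: "\<And>t. t \<le> 0 \<Longrightarrow> c t = 0"
    using a b c by (auto simp: decay_kernel_def)
  have conv': "(\<integral>\<sigma>. a \<sigma> * b (r - \<sigma>) \<partial>lborel) = c r" for r
  proof (cases "0 < r")
    case False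
    have "(\<lambda>\<sigma>. a \<sigma> * b (r - \<sigma>)) = (\<lambda>\<sigma>. 0)"
    proof
      show "a \<sigma> * b (r - \<sigma>) = 0" for \<sigma>
        using an[of \<sigma>] bn[of "r - \<sigma>"] False by (cases "\<sigma> \<le> 0") auto
    qed
    then show ?thesis using cn[of r] False by simp
  qed (rule conv)
  obtain K where K: "0 \<le> K" "\<And>y. norm (l y) \<le> norm y * K" using bounded_linear.nonneg_bounded[OF l] by blast
  define F where "F r = (if 0 \<le> r then l (S r x) else 0)" for r
  have FC: "\<bar>F r\<bar> \<le> (M0 * norm x * K) * exp (- w * r)" for r
  proof (cases "0 \<le> r")
    case True
    have "\<bar>l (S r x)\<bar> \<le> norm (S r x) * K" using K(2)[of "S r x"] by simp
    also have "\<dots> \<le> (M0 * norm x * exp (- w * r)) * K"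
      by (intro mult_right_mono semigroup_decay True K)
    finally show ?thesis using True by (simp add: F_def algebra_simps)
  qed (use K M0_ge_1 in \<open>simp add: F_def\<close>)
  have Fm: "F \<in> borel_measurable lebesgue" unfolding F_def by (rule functional_orbit_measurable[OF l])
  have "l (phillips S a (phillips S b x)) = (\<integral>\<sigma>. a \<sigma> * l (S \<sigma> (phillips S b x)) \<partial>lebesgue)"
    by (rule functional_phillips[OF a l])
  also have "\<dots> = (\<integral>\<sigma>. a \<sigma> * (\<integral>\<tau>. b \<tau> * F (\<sigma> + \<tau>) \<partial>lebesgue) \<partial>lebesgue)"
  proof (rule Bochner_Integration.integral_cong[OF refl])
    fix \<sigma>
    show "a \<sigma> * l (S \<sigma> (phillips S b x)) = a \<sigma> * (\<integral>\<tau>. b \<tau> * F (\<sigma> + \<tau>) \<partial>lebesgue)"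
    proof (cases "\<sigma> \<le> 0")
      case False
      then have s: "0 \<le> \<sigma>" by simp
      have "bounded_linear (\<lambda>y. l (S \<sigma> y))" by (rule bounded_linear_compose[OF l semigroup_linear[OF s]])
      from functional_phillips[OF b this]
      have "l (S \<sigma> (phillips S b x)) = (\<integral>\<tau>. b \<tau> * l (S \<sigma> (S \<tau> x)) \<partial>lebesgue)" .
      also have "\<dots> = (\<integral>\<tau>. b \<tau> * F (\<sigma> + \<tau>) \<partial>lebesgue)"
      proof (rule Bochner_Integration.integral_cong[OF refl])
        fix \<tau>
        show "b \<tau> * l (S \<sigma> (S \<tau> x)) = b \<tau> * F (\<sigma> + \<tau>)"
          using s semigroup_add[OF s, of \<tau> x] bn[of \<tau>] by (cases "\<tau> \<le> 0") (auto simp: F_def)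
      qed
      finally show ?thesis by simp
    qed (simp add: an)
  qed
  also have "\<dots> = (\<integral>r. (\<integral>\<sigma>. a \<sigma> * b (r - \<sigma>) \<partial>lborel) * F r \<partial>lebesgue)"
    by (rule convolution_integral_lebesgue[OF a b Fm FC])
  also have "\<dots> = (\<integral>r. c r * l (S r x) \<partial>lebesgue)"
    by (rule Bochner_Integration.integral_cong[OF refl]) (use cn in \<open>auto simp: conv' F_def\<close>)
  also have "\<dots> = l (phillips S c x)" by (rule functional_phillips[OF c l, symmetric])
  finally show "l (phillips S a (phillips S b x)) = l (phillips S c x)" .
qed

end

section \<open>Negative powers and the generator\<close>

lemma nonneg_has_integral_bochner:
  fixes f :: "real \<Rightarrow> real"
  assumes "f \<in> borel_measurable borel" "\<And>x. 0 \<le> f x" "(f has_integral I) UNIV"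
  shows "has_bochner_integral lborel f I"
proof -
  have "integral\<^sup>N lborel f = I" by (rule nn_integral_has_integral_lborel[OF assms])
  then have i: "integrable lborel f"
    by (intro integrableI_nn_integral_finite[where x=I]) (use assms in auto)
  have "integral\<^sup>L lborel f = I"
    by (rule has_integral_unique[OF has_integral_integral_lborel[OF i] assms(3)])
  with i show ?thesis by (simp add: has_bochner_integral_iff)
qed

text \<open>Euler's integral, rescaled by \<open>t \<mapsto> y t\<close>.\<close>

lemma Gamma_integral_scaled:
  fixes \<alpha> y :: real
  assumes "0 < \<alpha>" "0 < y"
  shows "has_bochner_integral lborel (\<lambda>t. if 0 < t then t powr (\<alpha> - 1) * exp (- y * t) else 0)
     (Gamma \<alpha> * y powr (- \<alpha>))"
proof -
  define g where "g t = (if 0 < t then t powr (\<alpha> - 1) * exp (- t) else 0)" for t :: real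
  have "((\<lambda>t. if t \<in> {0..} then t powr (\<alpha> - 1) / exp t else 0) has_integral Gamma \<alpha>) UNIV"
    using Gamma_integral_real[OF assms(1)] by (simp only: has_integral_restrict_UNIV)
  also have "(\<lambda>t. if t \<in> {0..} then t powr (\<alpha> - 1) / exp t else 0) = g"
    by (auto simp: g_def exp_minus field_simps fun_eq_iff)
  finally have gi: "(g has_integral Gamma \<alpha>) UNIV" .
  have "g \<in> borel_measurable borel" unfolding g_def by measurable
  then have g: "has_bochner_integral lborel g (Gamma \<alpha>)"
    by (rule nonneg_has_integral_bochner[OF _ _ gi]) (auto simp: g_def)
  have "has_bochner_integral lborel (\<lambda>t. g (0 + y * t)) (Gamma \<alpha> /\<^sub>R \<bar>y\<bar>)"
    using g lborel_has_bochner_integral_real_affine_iff[of y g "Gamma \<alpha>" 0] assms by simp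
  then have "has_bochner_integral lborel (\<lambda>t. y powr (1 - \<alpha>) * g (0 + y * t)) (y powr (1 - \<alpha>) * (Gamma \<alpha> /\<^sub>R \<bar>y\<bar>))"
    by (rule has_bochner_integral_mult_right) 
  moreover have "y powr (1 - \<alpha>) * g (0 + y * t) = (if 0 < t then t powr (\<alpha> - 1) * exp (- y * t) else 0)" for t
    using assms by (auto simp: g_def powr_mult powr_add[symmetric] zero_less_mult_iff)
  moreover have "y powr (1 - \<alpha>) * (Gamma \<alpha> /\<^sub>R \<bar>y\<bar>) = Gamma \<alpha> * y powr (- \<alpha>)"
    using assms by (simp add: powr_diff powr_minus field_simps)
  ultimately show ?thesis by (simp only:)
qed

lemma Beta_convolution:
  fixes \<alpha> \<beta> r :: real
  assumes "0 < \<alpha>" "0 < \<beta>" "0 < r"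
  shows "(\<integral>\<sigma>. (if 0 < \<sigma> then \<sigma> powr (\<alpha> - 1) else 0) * (if 0 < r - \<sigma> then (r - \<sigma>) powr (\<beta> - 1) else 0) \<partial>lborel)
     = Beta \<alpha> \<beta> * r powr (\<alpha> + \<beta> - 1)"
proof -
  define h where "h u = (if 0 < u then u powr (\<alpha> - 1) else 0) * (if 0 < 1 - u then (1 - u) powr (\<beta> - 1) else 0)" for u :: real
  have "((\<lambda>u. if u \<in> {0..1} then u powr (\<alpha> - 1) * (1 - u) powr (\<beta> - 1) else 0) has_integral Beta \<alpha> \<beta>) UNIV"
    using has_integral_Beta_real[OF assms(1,2)] by (simp only: has_integral_restrict_UNIV)
  also have "(\<lambda>u. if u \<in> {0..1} then u powr (\<alpha> - 1) * (1 - u) powr (\<beta> - 1) else 0) = h"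
    by (auto simp: h_def fun_eq_iff)
  finally have hi: "(h has_integral Beta \<alpha> \<beta>) UNIV" .
  have "h \<in> borel_measurable borel" unfolding h_def by measurable
  then have h: "has_bochner_integral lborel h (Beta \<alpha> \<beta>)"
    by (rule nonneg_has_integral_bochner[OF _ _ hi]) (auto simp: h_def)
  have "(\<integral>\<sigma>. (if 0 < \<sigma> then \<sigma> powr (\<alpha> - 1) else 0) * (if 0 < r - \<sigma> then (r - \<sigma>) powr (\<beta> - 1) else 0) \<partial>lborel)
     = r * (\<integral>u. (if 0 < r * u then (r * u) powr (\<alpha> - 1) else 0) * (if 0 < r - r * u then (r - r * u) powr (\<beta> - 1) else 0) \<partial>lborel)"
    by (subst lborel_integral_real_affine[of r _ 0], use assms in simp)
      (simp only: real_scaleR_def add_0_left abs_of_pos[OF assms(3)])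
  also have "(\<lambda>u. (if 0 < r * u then (r * u) powr (\<alpha> - 1) else 0) * (if 0 < r - r * u then (r - r * u) powr (\<beta> - 1) else 0))
     = (\<lambda>u. r powr (\<alpha> - 1) * r powr (\<beta> - 1) * h u)"
  proof
    fix u
    have 1: "0 < r * u \<longleftrightarrow> 0 < u" using assms by (simp add: zero_less_mult_iff)
    have 2: "r - r * u = r * (1 - u)" by (simp add: algebra_simps)
    have 3: "0 < r * (1 - u) \<longleftrightarrow> 0 < 1 - u" using assms by (simp add: zero_less_mult_iff)
    show "(if 0 < r * u then (r * u) powr (\<alpha> - 1) else 0) * (if 0 < r - r * u then (r - r * u) powr (\<beta> - 1) else 0)
      = r powr (\<alpha> - 1) * r powr (\<beta> - 1) * h u"
      unfolding 1 2 3 h_def by (auto simp: powr_mult assms less_imp_le)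
  qed
  also have "r * (\<integral>u. r powr (\<alpha> - 1) * r powr (\<beta> - 1) * h u \<partial>lborel) = (r * (r powr (\<alpha> - 1) * r powr (\<beta> - 1))) * Beta \<alpha> \<beta>"
    using h by (simp add: has_bochner_integral_iff)
  also have "r * (r powr (\<alpha> - 1) * r powr (\<beta> - 1)) = r powr (\<alpha> + \<beta> - 1)"
  proof -
    have "r powr 1 * (r powr (\<alpha> - 1) * r powr (\<beta> - 1)) = r powr (1 + ((\<alpha> - 1) + (\<beta> - 1)))"
      by (simp only: powr_add)
    then show ?thesis using assms by (simp add: algebra_simps)
  qed
  finally show ?thesis by simp
qed

definition power_kernel :: "real \<Rightarrow> real \<Rightarrow> real" where
  "power_kernel \<alpha> t = (if 0 < t then t powr (\<alpha> - 1) else 0) / Gamma \<alpha>"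

lemma decay_kernel_power:
  assumes "0 < w" "0 < \<alpha>"
  shows "decay_kernel w (power_kernel \<alpha>)"
proof -
  have "integrable lborel (\<lambda>t. (1 / Gamma \<alpha>) * (if 0 < t then t powr (\<alpha> - 1) * exp (- w * t) else 0))"
    using Gamma_integral_scaled[OF assms(2,1)] by (intro integrable_mult_right) (simp add: has_bochner_integral_iff)
  moreover have "(\<lambda>t. (1 / Gamma \<alpha>) * (if 0 < t then t powr (\<alpha> - 1) * exp (- w * t) else 0))
      = (\<lambda>t. power_kernel \<alpha> t * exp (- w * t))"
    by (auto simp: power_kernel_def)
  moreover have "power_kernel \<alpha> \<in> borel_measurable borel" unfolding power_kernel_def by measurable
  ultimately show ?thesis
    using assms by (auto simp: decay_kernel_def power_kernel_def Gamma_real_pos intro!: divide_nonneg_pos)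
qed

lemma power_kernel_convolution:
  assumes "0 < \<alpha>" "0 < \<beta>" "0 < r"
  shows "(\<integral>\<sigma>. power_kernel \<alpha> \<sigma> * power_kernel \<beta> (r - \<sigma>) \<partial>lborel) = power_kernel (\<alpha> + \<beta>) r"
proof -
  have "(\<integral>\<sigma>. power_kernel \<alpha> \<sigma> * power_kernel \<beta> (r - \<sigma>) \<partial>lborel)
    = (\<integral>\<sigma>. (1 / (Gamma \<alpha> * Gamma \<beta>)) * ((if 0 < \<sigma> then \<sigma> powr (\<alpha> - 1) else 0) * (if 0 < r - \<sigma> then (r - \<sigma>) powr (\<beta> - 1) else 0)) \<partial>lborel)"
    by (intro Bochner_Integration.integral_cong) (auto simp: power_kernel_def)
  also have "\<dots> = (1 / (Gamma \<alpha> * Gamma \<beta>)) * (Beta \<alpha> \<beta> * r powr (\<alpha> + \<beta> - 1))"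
    by (subst integral_mult_right_zero) (simp only: Beta_convolution[OF assms])
  also have "\<dots> = power_kernel (\<alpha> + \<beta>) r"
    using assms less_imp_neq[OF Gamma_real_pos[OF assms(1)]] less_imp_neq[OF Gamma_real_pos[OF assms(2)]]
    by (simp add: power_kernel_def Beta_def field_simps)
  finally show ?thesis .
qed

definition exp_kernel :: "real \<Rightarrow> real \<Rightarrow> real" where
  "exp_kernel \<mu> t = (if 0 < t then exp (- \<mu> * t) else 0)"

lemma decay_kernel_exp:
  assumes "0 < w" "0 < \<mu>"
  shows "decay_kernel w (exp_kernel \<mu>)"
proof -
  have "integrable lborel (\<lambda>t. if 0 < t then t powr (1 - 1) * exp (- (\<mu> + w) * t) else 0)"
    using Gamma_integral_scaled[of 1 "\<mu> + w"] assms by (simp add: has_bochner_integral_iff)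
  moreover have "(\<lambda>t. if 0 < t then t powr (1 - 1) * exp (- (\<mu> + w) * t) else 0)
      = (\<lambda>t. exp_kernel \<mu> t * exp (- w * t))"
    by (auto simp: exp_kernel_def fun_eq_iff exp_add[symmetric] algebra_simps mult_exp_exp)
  moreover have "exp_kernel \<mu> \<in> borel_measurable borel" unfolding exp_kernel_def by measurable
  ultimately show ?thesis by (auto simp: decay_kernel_def exp_kernel_def)
qed

text \<open>The convolution of \<open>exp (- \<mu> t)\<close> with the constant 1 is \<open>(1 - exp (- \<mu> r)) / \<mu>\<close>. Read
through the functional calculus this is the resolvent identity between \<open>\<mu>\<close> and \<open>0\<close>.\<close>

lemma exp_kernel_primitive:
  assumes "0 < w" "0 < \<mu>"
  shows "decay_kernel w (\<lambda>t. (power_kernel 1 t - exp_kernel \<mu> t) / \<mu>)"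
    and "0 < r \<Longrightarrow> (\<integral>\<sigma>. exp_kernel \<mu> \<sigma> * power_kernel 1 (r - \<sigma>) \<partial>lborel) = (power_kernel 1 r - exp_kernel \<mu> r) / \<mu>"
proof -
  have k: "decay_kernel w (power_kernel 1)" "decay_kernel w (exp_kernel \<mu>)"
    using assms by (auto intro: decay_kernel_power decay_kernel_exp)
  have i: "integrable lborel (\<lambda>t. (power_kernel 1 t * exp (- w * t) - exp_kernel \<mu> t * exp (- w * t)) / \<mu>)"
    using k by (intro integrable_divide_zero Bochner_Integration.integrable_diff) (auto simp: decay_kernel_def)
  have m: "power_kernel 1 \<in> borel_measurable borel" "exp_kernel \<mu> \<in> borel_measurable borel"
    using k by (auto simp: decay_kernel_def)
  have "(\<lambda>t. (power_kernel 1 t - exp_kernel \<mu> t) / \<mu>) \<in> borel_measurable borel"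
    using m by measurable
  moreover have "0 \<le> (power_kernel 1 t - exp_kernel \<mu> t) / \<mu>" for t
    using assms by (auto simp: power_kernel_def exp_kernel_def)
  ultimately show "decay_kernel w (\<lambda>t. (power_kernel 1 t - exp_kernel \<mu> t) / \<mu>)"
    using i by (auto simp: decay_kernel_def diff_divide_distrib left_diff_distrib power_kernel_def exp_kernel_def)
  assume r: "0 < r"
  show "(\<integral>\<sigma>. exp_kernel \<mu> \<sigma> * power_kernel 1 (r - \<sigma>) \<partial>lborel) = (power_kernel 1 r - exp_kernel \<mu> r) / \<mu>"
  proof -
    have "((\<lambda>\<sigma>. exp (- \<mu> * \<sigma>)) has_integral (- exp (- \<mu> * r) / \<mu>) - (- exp (- \<mu> * 0) / \<mu>)) {0..r}"
      by (rule fundamental_theorem_of_calculus)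
        (use r assms in \<open>auto intro!: derivative_eq_intros simp: has_real_derivative_iff_has_vector_derivative[symmetric]\<close>)
    then have "((\<lambda>\<sigma>. exp (- \<mu> * \<sigma>)) has_integral (1 - exp (- \<mu> * r)) / \<mu>) {0..r}"
      by (simp add: diff_divide_distrib)
    then have "((\<lambda>\<sigma>. if \<sigma> \<in> {0..r} then exp (- \<mu> * \<sigma>) else 0) has_integral (1 - exp (- \<mu> * r)) / \<mu>) UNIV"
      by (simp only: has_integral_restrict_UNIV)
    then have "((\<lambda>\<sigma>. exp_kernel \<mu> \<sigma> * power_kernel 1 (r - \<sigma>)) has_integral (1 - exp (- \<mu> * r)) / \<mu>) UNIV"
      by (rule has_integral_spike[of "{0, r}", rotated 2])
        (auto simp: exp_kernel_def power_kernel_def)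
    then have "has_bochner_integral lborel (\<lambda>\<sigma>. exp_kernel \<mu> \<sigma> * power_kernel 1 (r - \<sigma>)) ((1 - exp (- \<mu> * r)) / \<mu>)"
      by (rule nonneg_has_integral_bochner[rotated 2])
        (use m in \<open>measurable, auto simp: exp_kernel_def power_kernel_def\<close>)
    then show ?thesis using r by (simp add: has_bochner_integral_iff power_kernel_def exp_kernel_def)
  qed
qed

text \<open>With \<open>w > 0\<close> the constant 1 and all powers are decay kernels, so negative powers are
available.\<close>

locale stable_semigroup_generator = decaying_semigroup S M0 w
  for S :: "real \<Rightarrow> 'a::complex_banach \<Rightarrow> 'a" and M0 w :: real +
  fixes D :: "'a set" and A :: "'a \<Rightarrow> 'a"
  assumes w_pos: "0 < w"
    and generator: "infinitesimal_generator w S D (\<lambda>y. - A y)"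
begin

lemma neg_power_eq_phillips:
  assumes "0 < \<alpha>"
  shows "neg_power S \<alpha> x = phillips S (power_kernel \<alpha>) x"
proof -
  have "phillips S (power_kernel \<alpha>) x
     = integral UNIV (\<lambda>t. (1 / Gamma \<alpha>) *\<^sub>R (if t \<in> {0..} then (t powr (\<alpha> - 1)) *\<^sub>R S t x else 0))"
    unfolding phillips_def by (rule integral_cong) (auto simp: power_kernel_def)
  also have "\<dots> = (1 / Gamma \<alpha>) *\<^sub>R integral UNIV (\<lambda>t. if t \<in> {0..} then (t powr (\<alpha> - 1)) *\<^sub>R S t x else 0)"
    by (rule integral_cmul)
  also have "\<dots> = neg_power S \<alpha> x" by (simp only: integral_restrict_UNIV neg_power_def)
  finally show ?thesis by simp
qed

lemma neg_power_add:
  assumes "0 < \<alpha>" "0 < \<beta>"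
  shows "neg_power S \<alpha> (neg_power S \<beta> x) = neg_power S (\<alpha> + \<beta>) x"
  using assms w_pos
  by (simp add: neg_power_eq_phillips phillips_convolution[where c = "power_kernel (\<alpha> + \<beta>)"]
      decay_kernel_power power_kernel_convolution)

lemma neg_power_commute_semigroup:
  assumes "0 < \<alpha>" "0 \<le> t"
  shows "S t (neg_power S \<alpha> x) = neg_power S \<alpha> (S t x)"
  using assms w_pos by (simp add: neg_power_eq_phillips phillips_commute_semigroup decay_kernel_power)

lemma neg_power_zero: "0 < \<alpha> \<Longrightarrow> neg_power S \<alpha> 0 = 0"
proof -
  assume a: "0 < \<alpha>"
  have "integral {0..} (\<lambda>\<sigma>. \<sigma> powr (\<alpha> - 1) *\<^sub>R S \<sigma> 0) = integral {0..} (\<lambda>\<sigma> :: real. 0 :: 'a)"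
    by (rule integral_cong) (simp add: linear_0 bounded_linear.linear semigroup_linear)
  then show ?thesis by (simp add: neg_power_def)
qed

text \<open>The resolvent is given by its values under complex-linear functionals. A real
functional \<open>l\<close> is the real part of the complex-linear functional \<open>y \<mapsto> l y - \<i> l (\<i> y)\<close>, so
real functionals, which separate points, suffice to identify it with the strong
integral.\<close>

lemma resolvent_eq_phillips:
  assumes "w < \<mu>"
  obtains R where "bounded_clinear R" "\<And>y. R y \<in> D" "\<And>y. \<mu> *\<^sub>R R y + A (R y) = y" "R = phillips S (exp_kernel \<mu>)"
proof -
  have mu: "0 < \<mu>" using assms w_pos by simp
  have "w < Re (complex_of_real \<mu>)" using assms by simp
  then obtain R where R: "bounded_clinear R" "\<And>y. R y \<in> D" "\<And>y. complex_of_real \<mu> *\<^sub>C R y - - A (R y) = y"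
    and int: "\<And>x f. dual_functional f \<Longrightarrow> ((\<lambda>t. exp (- complex_of_real \<mu> * complex_of_real t) * f (S t x)) has_integral f (R x)) {0..}"
    using generator unfolding infinitesimal_generator_def by blast
  have "R x = phillips S (exp_kernel \<mu>) x" for x
  proof (rule functionals_separate_points)
    fix l :: "'a \<Rightarrow> real" assume l: "bounded_linear l"
    have i_bl: "bounded_linear (\<lambda>y :: 'a. \<i> *\<^sub>C y)"
      by (rule bounded_linear_intro[where K=1])
        (simp_all add: scaleC_add_right norm_scaleC scaleC_of_real[symmetric] scaleC_scaleC mult.commute)
    define f where "f y = complex_of_real (l y) - \<i> * complex_of_real (l (\<i> *\<^sub>C y))" for y
    have lin: "linear l" using l by (rule bounded_linear.linear)
    have ii: "l (\<i> *\<^sub>C \<i> *\<^sub>C y) = - l y" for y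
    proof -
      have "\<i> *\<^sub>C \<i> *\<^sub>C y = complex_of_real (-1) *\<^sub>C y" by (simp add: scaleC_scaleC)
      also have "\<dots> = - y" by (subst scaleC_of_real) simp
      finally show ?thesis using linear_neg[OF lin] by simp
    qed
    have "bounded_linear f"
      unfolding f_def
      by (intro bounded_linear_sub bounded_linear_compose[OF bounded_linear_of_real l]
          bounded_linear_const_mult bounded_linear_compose[OF bounded_linear_of_real]
          bounded_linear_compose[OF l i_bl])
    moreover have "f (c *\<^sub>C y) = c * f y" for c y
    proof -
      have c: "c = complex_of_real (Re c) + complex_of_real (Im c) * \<i>" by (metis complex_eq mult.commute)
      have cy: "c *\<^sub>C z = Re c *\<^sub>R z + Im c *\<^sub>R (\<i> *\<^sub>C z)" for z :: 'a
        by (subst c) (simp only: scaleC_add_left scaleC_scaleC[symmetric] scaleC_of_real)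
      have l1: "l (c *\<^sub>C y) = Re c * l y + Im c * l (\<i> *\<^sub>C y)"
        by (simp add: cy linear_add[OF lin] linear_scale[OF lin])
      have "\<i> *\<^sub>C c *\<^sub>C y = c *\<^sub>C (\<i> *\<^sub>C y)" by (simp add: scaleC_scaleC mult.commute)
      then have l2: "l (\<i> *\<^sub>C c *\<^sub>C y) = Re c * l (\<i> *\<^sub>C y) - Im c * l y"
        by (simp add: cy linear_add[OF lin] linear_scale[OF lin] ii)
      show ?thesis by (simp add: f_def l1 l2 complex_eq_iff)
    qed
    ultimately have "dual_functional f" by (simp add: dual_functional_def)
    from has_integral_linear[OF int[OF this, of x] bounded_linear_Re]
    have "((\<lambda>t. exp (- \<mu> * t) * l (S t x)) has_integral l (R x)) {0..}"
      by (simp add: o_def f_def Re_exp Im_exp)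
    then have "((\<lambda>t. if t \<in> {0..} then exp (- \<mu> * t) * l (S t x) else 0) has_integral l (R x)) UNIV"
      by (simp only: has_integral_restrict_UNIV)
    then have 1: "((\<lambda>t. exp_kernel \<mu> t * l (S t x)) has_integral l (R x)) UNIV"
      by (rule has_integral_spike[of "{0}", rotated 2]) (auto simp: exp_kernel_def)
    have "((\<lambda>t. exp_kernel \<mu> t * l (S t x)) has_integral l (phillips S (exp_kernel \<mu>) x)) UNIV"
      using has_integral_linear[OF phillips_has_integral[OF decay_kernel_exp[OF w_pos mu]] l, of x]
      by (simp add: o_def linear_scale[OF lin])
    with 1 show "l (R x) = l (phillips S (exp_kernel \<mu>) x)" by (rule has_integral_unique)
  qed
  then show ?thesis using R by (intro that[of R]) (auto simp: scaleC_of_real)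
qed

text \<open>Write \<open>B\<close> for \<open>neg_power S 1\<close> and \<open>R\<close> for the resolvent at \<open>\<mu>\<close>. The resolvent identity
\<open>\<mu> R B = B - R\<close> reads \<open>B y = R (y + \<mu> B y)\<close>. Hence \<open>B y\<close> lies in the range of \<open>R\<close>, that is, in
the domain, and applying \<open>\<mu> + A\<close> gives \<open>\<mu> B y + A (B y) = y + \<mu> B y\<close>.\<close>

lemma neg_power_one_inverse:
  shows "neg_power S 1 y \<in> D" "A (neg_power S 1 y) = y"
proof -
  \<comment> \<open>Any \<open>\<mu> > w\<close> will do.\<close>
  define \<mu> where "\<mu> = w + 1"
  have mu: "w < \<mu>" "0 < \<mu>" using w_pos by (auto simp: \<mu>_def)
  obtain R where R: "bounded_clinear R" "\<And>y. R y \<in> D" "\<And>y. \<mu> *\<^sub>R R y + A (R y) = y" and Rp: "R = phillips S (exp_kernel \<mu>)"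
    using resolvent_eq_phillips[OF mu(1)] by blast
  have lin: "linear R" using R(1) by (simp add: bounded_clinear_def bounded_linear.linear)
  define B where "B = neg_power S 1"
  have Bp: "B = phillips S (power_kernel 1)" by (auto simp: B_def neg_power_eq_phillips)
  have k: "decay_kernel w (power_kernel 1)" "decay_kernel w (exp_kernel \<mu>)"
    using mu w_pos by (auto intro: decay_kernel_power decay_kernel_exp)
  have P: "phillips S (\<lambda>t. (power_kernel 1 t - exp_kernel \<mu> t) / \<mu>) z = (1 / \<mu>) *\<^sub>R (B z - R z)" for z
  proof -
    have "((\<lambda>t. (1 / \<mu>) *\<^sub>R (power_kernel 1 t *\<^sub>R S t z - exp_kernel \<mu> t *\<^sub>R S t z)) has_integral (1 / \<mu>) *\<^sub>R (B z - R z)) UNIV"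
      unfolding Bp Rp by (intro has_integral_cmul has_integral_diff phillips_has_integral k)
    then show ?thesis by (simp add: phillips_def integral_unique scaleR_left_diff_distrib[symmetric])
  qed
  have RB: "R (B z) = (1 / \<mu>) *\<^sub>R (B z - R z)" for z
    using phillips_convolution[OF k(2,1) exp_kernel_primitive[OF w_pos mu(2)], of z]
    unfolding P unfolding Bp Rp .
  have *: "B y = R (y + \<mu> *\<^sub>R B y)" for y
    using mu by (simp add: linear_add[OF lin] linear_scale[OF lin] RB)
  show D: "neg_power S 1 y \<in> D" using *[of y] R(2)[of "y + \<mu> *\<^sub>R B y"] by (simp add: B_def)
  have "\<mu> *\<^sub>R B y + A (B y) = y + \<mu> *\<^sub>R B y" using R(3)[of "y + \<mu> *\<^sub>R B y"] *[of y] by simp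
  then show "A (neg_power S 1 y) = y" by (simp add: B_def)
qed

text \<open>Composition with the negative power of the complementary order \<open>m - \<alpha>\<close> reduces the claim
to the natural order \<open>m\<close>, where \<open>A\<close> is a left inverse of each factor.\<close>

lemma inj_neg_power:
  assumes "0 < \<alpha>"
  shows "inj (neg_power S \<alpha>)"
proof (rule injI)
  fix x y assume eq: "neg_power S \<alpha> x = neg_power S \<alpha> y"
  \<comment> \<open>The successor ensures \<open>m > \<alpha>\<close> also for integral \<open>\<alpha>\<close>.\<close>
  define m where "m = Suc (nat \<lceil>\<alpha>\<rceil>)"
  have m: "0 < real m - \<alpha>" using assms by (simp add: m_def) linarith
  have "neg_power S (real (Suc n)) x = neg_power S (real (Suc n)) y \<Longrightarrow> x = y" for n
  proof (induction n)
    case 0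
    then have "A (neg_power S 1 x) = A (neg_power S 1 y)" by simp
    then show ?case by (simp add: neg_power_one_inverse)
  next
    case (Suc n)
    have s: "neg_power S 1 (neg_power S (real (Suc n)) z) = neg_power S (real (Suc (Suc n))) z" for z
      by (subst neg_power_add) (simp_all add: algebra_simps)
    have "A (neg_power S 1 (neg_power S (real (Suc n)) x)) = A (neg_power S 1 (neg_power S (real (Suc n)) y))"
      using Suc.prems by (simp only: s)
    then show ?case using Suc.IH by (simp only: neg_power_one_inverse)
  qed
  moreover have "neg_power S (real m) x = neg_power S (real m) y"
    using neg_power_add[OF m assms, of x] neg_power_add[OF m assms, of y] eq by simp
  ultimately show "x = y" unfolding m_def by blast
qed

lemma frac_power_neg_power: "0 < \<alpha> \<Longrightarrow> frac_power S \<alpha> (neg_power S \<alpha> x) = x"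
  using inj_neg_power[of \<alpha>] by (simp add: frac_power_def the_inv_f_f)

end

section \<open>Uniqueness of weak derivatives\<close>

text \<open>Functions \<open>P / Q\<^sup>m exp (- 1 / Q)\<close>, extended by zero to the set where \<open>Q \<le> 0\<close>. They vanish to
infinite order at the boundary, and the class is closed under differentiation;
smoothness is then an induction that never computes a higher derivative.\<close>

definition flat_poly :: "real poly \<Rightarrow> real poly \<Rightarrow> nat \<Rightarrow> real \<Rightarrow> real" where
  "flat_poly Q P m t = (if 0 < poly Q t then poly P t / poly Q t ^ m * exp (- 1 / poly Q t) else 0)"

lemma power_div_fact_le_exp:
  fixes x :: real assumes "0 \<le> x" shows "x ^ n / fact n \<le> exp x"
proof -
  have "(\<Sum>k\<in>{n}. x ^ k /\<^sub>R fact k) \<le> (\<Sum>k. x ^ k /\<^sub>R fact k)"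
    by (rule sum_le_suminf[OF summable_exp_generic]) (use assms in auto)
  then show ?thesis by (simp add: exp_def divide_inverse mult.commute)
qed

text \<open>The factor \<open>exp (- 1 / Q)\<close> beats every power of \<open>1 / Q\<close>. Second order vanishing in \<open>Q\<close> is
what the derivative at the boundary requires.\<close>

lemma flat_poly_bound:
  "\<bar>flat_poly Q P m t\<bar> \<le> \<bar>poly P t\<bar> * fact (m + 2) * (max 0 (poly Q t))\<^sup>2"
proof (cases "0 < poly Q t")
  case True
  define q where "q = poly Q t"
  have q: "0 < q" using True by (simp add: q_def)
  have "(1 / q) ^ (m + 2) / fact (m + 2) \<le> exp (1 / q)"
    using power_div_fact_le_exp[of "1 / q" "m + 2"] q by simp
  then have "(1 / q) ^ (m + 2) \<le> fact (m + 2) * exp (1 / q)"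
    by (subst (asm) pos_divide_le_eq) (simp_all only: fact_gt_zero mult.commute)
  then have "inverse (q ^ m * q\<^sup>2) \<le> fact (m + 2) * exp (1 / q)"
    by (simp only: power_add[symmetric] power_one_over inverse_eq_divide)
  then have "exp (- 1 / q) * inverse (q ^ m * q\<^sup>2) \<le> exp (- 1 / q) * (fact (m + 2) * exp (1 / q))"
    by (intro mult_left_mono) auto
  also have "\<dots> = fact (m + 2)" by (simp add: mult_exp_exp mult.left_commute del: fact_Suc)
  finally have "exp (- 1 / q) * inverse (q ^ m * q\<^sup>2) * q\<^sup>2 \<le> fact (m + 2) * q\<^sup>2"
    by (intro mult_right_mono) auto
  also have "exp (- 1 / q) * inverse (q ^ m * q\<^sup>2) * q\<^sup>2 = exp (- 1 / q) / q ^ m"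
    using q by (simp add: field_simps)
  finally have "\<bar>poly P t\<bar> * (exp (- 1 / q) / q ^ m) \<le> \<bar>poly P t\<bar> * (fact (m + 2) * q\<^sup>2)"
    by (intro mult_left_mono) auto
  then show ?thesis using q by (simp add: flat_poly_def q_def[symmetric] abs_mult mult_ac del: fact_Suc)
qed (simp add: flat_poly_def)

text \<open>Where \<open>Q > 0\<close> this is the quotient rule. Where \<open>Q \<le> 0\<close> the difference quotient is bounded
by \<open>(Q s - Q t)\<^sup>2 / (s - t)\<close> up to a locally bounded factor and tends to zero, which covers
interior and boundary points alike.\<close>

lemma flat_poly_has_derivative:
  "(flat_poly Q P m has_real_derivative
     flat_poly Q (pderiv P * Q\<^sup>2 - of_nat m * P * Q * pderiv Q + P * pderiv Q) (m + 2) t) (at t)"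
proof (cases "0 < poly Q t")
  case True
  define q where "q = poly Q t"
  have q: "0 < q" using True by (simp add: q_def)
  have "((\<lambda>t. poly P t / poly Q t ^ m * exp (- 1 / poly Q t)) has_real_derivative
     poly (pderiv P * Q\<^sup>2 - of_nat m * P * Q * pderiv Q + P * pderiv Q) t / poly Q t ^ (m + 2) * exp (- 1 / poly Q t)) (at t)"
    using q
    by (auto intro!: derivative_eq_intros simp: q_def[symmetric])
      (cases m; simp add: field_simps power2_eq_square)
  moreover have "\<forall>\<^sub>F s in nhds t. 0 < poly Q s"
  proof -
    have "(poly Q \<longlongrightarrow> poly Q t) (nhds t)" using isCont_def continuous_within poly_isCont tendsto_nhds_iff by blast
    then show ?thesis using True by (rule order_tendstoD)
  qed
  then have "\<forall>\<^sub>F s in nhds t. flat_poly Q P m s = poly P s / poly Q s ^ m * exp (- 1 / poly Q s)"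
    by eventually_elim (simp add: flat_poly_def)
  ultimately show ?thesis using True by (subst DERIV_cong_ev[OF refl _ refl]) (auto simp: flat_poly_def)
next
  case False
  have g0: "flat_poly Q P m t = 0" using False by (simp add: flat_poly_def)
  have "((\<lambda>s. (flat_poly Q P m s - flat_poly Q P m t) / (s - t)) \<longlongrightarrow> 0) (at t)"
  proof (rule Lim_null_comparison)
    have "\<bar>(flat_poly Q P m s - flat_poly Q P m t) / (s - t)\<bar>
       \<le> \<bar>poly P s\<bar> * fact (m + 2) * \<bar>poly Q s - poly Q t\<bar> * \<bar>(poly Q s - poly Q t) / (s - t)\<bar>" for s
    proof -
      have "max 0 (poly Q s) \<le> \<bar>poly Q s - poly Q t\<bar>" using False by auto
      then have "(max 0 (poly Q s))\<^sup>2 \<le> \<bar>poly Q s - poly Q t\<bar>\<^sup>2" by (intro power_mono) auto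
      then have "\<bar>flat_poly Q P m s\<bar> \<le> \<bar>poly P s\<bar> * fact (m + 2) * \<bar>poly Q s - poly Q t\<bar>\<^sup>2"
        using flat_poly_bound[of Q P m s]
        by (meson abs_ge_zero fact_ge_zero mult_left_mono mult_nonneg_nonneg order_trans)
      then have "\<bar>flat_poly Q P m s\<bar> / \<bar>s - t\<bar> \<le> \<bar>poly P s\<bar> * fact (m + 2) * \<bar>poly Q s - poly Q t\<bar>\<^sup>2 / \<bar>s - t\<bar>"
        by (intro divide_right_mono) auto
      then show ?thesis by (simp add: g0 power2_eq_square mult.assoc del: fact_Suc)
    qed
    then show "\<forall>\<^sub>F s in at t. norm ((flat_poly Q P m s - flat_poly Q P m t) / (s - t))
       \<le> \<bar>poly P s\<bar> * fact (m + 2) * \<bar>poly Q s - poly Q t\<bar> * \<bar>(poly Q s - poly Q t) / (s - t)\<bar>"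
      by simp
    have "((\<lambda>s. (poly Q s - poly Q t) / (s - t)) \<longlongrightarrow> poly (pderiv Q) t) (at t)"
      using poly_DERIV[of Q t] by (simp add: has_field_derivative_iff)
    then have "((\<lambda>s. \<bar>poly P s\<bar> * fact (m + 2) * \<bar>poly Q s - poly Q t\<bar> * \<bar>(poly Q s - poly Q t) / (s - t)\<bar>)
        \<longlongrightarrow> \<bar>poly P t\<bar> * fact (m + 2) * \<bar>poly Q t - poly Q t\<bar> * \<bar>poly (pderiv Q) t\<bar>) (at t)"
      by (intro tendsto_intros isContD[OF poly_isCont])
    then show "((\<lambda>s. \<bar>poly P s\<bar> * fact (m + 2) * \<bar>poly Q s - poly Q t\<bar> * \<bar>(poly Q s - poly Q t) / (s - t)\<bar>)
        \<longlongrightarrow> 0) (at t)" by simp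
  qed
  then show ?thesis using False by (simp add: has_field_derivative_iff flat_poly_def)
qed

lemma flat_poly_smooth: "(deriv ^^ n) (flat_poly Q P m) differentiable_on UNIV"
proof (induction n arbitrary: P m)
  case 0
  then show ?case
    unfolding differentiable_on_def funpow_0
    using flat_poly_has_derivative real_differentiable_def by blast
next
  case (Suc n)
  have "deriv (flat_poly Q P m) = flat_poly Q (pderiv P * Q\<^sup>2 - of_nat m * P * Q * pderiv Q + P * pderiv Q) (m + 2)"
    by (intro ext DERIV_imp_deriv flat_poly_has_derivative)
  then show ?case using Suc.IH by (simp add: funpow_swap1)
qed

text \<open>As \<open>c \<rightarrow> \<infinity>\<close> these test functions increase to the indicator function of the open interval
from \<open>a\<close> to \<open>b\<close>, so that no mollification is needed to recover integrals over intervals.\<close>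

definition bump :: "real \<Rightarrow> real \<Rightarrow> real \<Rightarrow> real \<Rightarrow> real" where
  "bump a b c t = (if t \<in> {a<..<b} then exp (- 1 / (c * ((t - a) * (b - t)))) else 0)"

lemma bump_test_function:
  assumes "a < b" "b < t0" "0 < c"
  shows "test_function {..t0} (bump a b c)"
proof -
  \<comment> \<open>\<open>Q\<close> is the polynomial \<open>c (t - a) (b - t)\<close>, positive exactly between \<open>a\<close> and \<open>b\<close>.\<close>
  define Q where "Q = [:- (c * a * b), c * (a + b), - c:]"
  have Q: "poly Q t = c * ((t - a) * (b - t))" for t by (simp add: Q_def algebra_simps)
  have pos: "0 < poly Q t \<longleftrightarrow> t \<in> {a<..<b}" for t
    using assms by (auto simp: Q zero_less_mult_iff)
  have "flat_poly Q 1 0 = bump a b c"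
  proof
    fix t show "flat_poly Q 1 0 t = bump a b c t"
      unfolding flat_poly_def bump_def pos by (simp add: Q)
  qed
  then have "\<forall>n. (deriv ^^ n) (bump a b c) differentiable_on UNIV" using flat_poly_smooth by metis
  moreover have "compact {a..b}" "{a..b} \<subseteq> interior {..t0}" using assms by auto
  moreover have "\<forall>t. t \<notin> {a..b} \<longrightarrow> bump a b c t = 0" by (auto simp: bump_def)
  ultimately show ?thesis unfolding test_function_def by blast
qed

lemma bump_bounds: "0 < c \<Longrightarrow> 0 \<le> bump a b c t" "0 < c \<Longrightarrow> bump a b c t \<le> indicator {a..b} t"
proof -
  assume c: "0 < c"
  show "0 \<le> bump a b c t" by (simp add: bump_def)
  show "bump a b c t \<le> indicator {a..b} t" using c by (auto simp: bump_def zero_le_mult_iff)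
qed

lemma bump_measurable [measurable]: "bump a b c \<in> borel_measurable borel"
  unfolding bump_def by measurable

lemma bump_tendsto_indicator: "(\<lambda>n. bump a b (real (Suc n)) t) \<longlonglongrightarrow> indicator {a<..<b} t"
proof (cases "t \<in> {a<..<b}")
  case True
  define q where "q = (t - a) * (b - t)"
  have q: "c * ((t - a) * (b - t)) = c * q" for c by (simp add: q_def)
  have "(\<lambda>n. exp (- (1 / q) * inverse (real (Suc n)))) \<longlonglongrightarrow> exp (- (1 / q) * 0)"
    by (intro tendsto_intros LIMSEQ_inverse_real_of_nat)
  moreover have "bump a b (real (Suc n)) t = exp (- (1 / q) * inverse (real (Suc n)))" for n
    using True unfolding bump_def q by (simp add: divide_inverse inverse_mult_distrib mult.commute del: of_nat_Suc)
  ultimately show ?thesis using True by simp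
next
  case False
  then have "bump a b c t = 0" for c by (auto simp: bump_def)
  then show ?thesis using False by simp
qed

text \<open>The positive and the negative part of \<open>h\<close> are densities of two finite measures which
agree on all half-lines, hence coincide, and densities are unique almost everywhere.\<close>

lemma AE_zero_if_interval_integrals_zero:
  fixes h :: "real \<Rightarrow> real"
  assumes h: "integrable lborel h" and zero: "\<And>x. (\<integral>t. indicator {x<..} t * h t \<partial>lborel) = 0"
  shows "AE t in lborel. h t = 0"
proof -
  have hm[measurable]: "h \<in> borel_measurable borel" using h by simp
  have i1: "integrable lborel (\<lambda>t. indicator {x<..} t * max 0 (h t))" for x
    by (rule Bochner_Integration.integrable_bound[OF h]) (auto simp: indicator_def)
  have i2: "integrable lborel (\<lambda>t. indicator {x<..} t * max 0 (- h t))" for x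
    by (rule Bochner_Integration.integrable_bound[OF h]) (auto simp: indicator_def)
  have em: "emeasure (density lborel (\<lambda>t. ennreal (g t))) {x<..} = ennreal (\<integral>t. indicator {x<..} t * g t \<partial>lborel)"
    if "g \<in> borel_measurable borel" "\<And>t. 0 \<le> g t" "integrable lborel (\<lambda>t. indicator {x<..} t * g t)" for g :: "real \<Rightarrow> real" and x
  proof -
    have "emeasure (density lborel (\<lambda>t. ennreal (g t))) {x<..} = (\<integral>\<^sup>+ t. ennreal (g t) * indicator {x<..} t \<partial>lborel)"
      by (rule emeasure_density) (use that in auto)
    also have "\<dots> = (\<integral>\<^sup>+ t. ennreal (indicator {x<..} t * g t) \<partial>lborel)"
      by (intro nn_integral_cong) (auto simp: indicator_def)
    also have "\<dots> = ennreal (\<integral>t. indicator {x<..} t * g t \<partial>lborel)"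
      by (rule nn_integral_eq_integral) (use that in auto)
    finally show ?thesis .
  qed
  have d: "(\<integral>t. indicator {x<..} t * max 0 (h t) \<partial>lborel) - (\<integral>t. indicator {x<..} t * max 0 (- h t) \<partial>lborel)
     = (\<integral>t. indicator {x<..} t * h t \<partial>lborel)" for x
    by (subst Bochner_Integration.integral_diff[OF i1 i2, symmetric])
      (auto intro!: Bochner_Integration.integral_cong simp: indicator_def)
  have eq: "(\<integral>t. indicator {x<..} t * max 0 (h t) \<partial>lborel) = (\<integral>t. indicator {x<..} t * max 0 (- h t) \<partial>lborel)" for x
    using zero[of x] d[of x] by linarith
  have "density lborel (\<lambda>t. ennreal (max 0 (h t))) = density lborel (\<lambda>t. ennreal (max 0 (- h t)))"
  proof (rule measure_eqI_lessThan)
    show "emeasure (density lborel (\<lambda>t. ennreal (max 0 (h t)))) {x<..} < \<infinity>" for x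
      by (subst em[OF _ _ i1]) auto
    show "emeasure (density lborel (\<lambda>t. ennreal (max 0 (h t)))) {x<..}
        = emeasure (density lborel (\<lambda>t. ennreal (max 0 (- h t)))) {x<..}" for x
      by (subst em[OF _ _ i1], simp, simp, subst em[OF _ _ i2], simp, simp, simp add: eq)
  qed auto
  then have "AE t in lborel. ennreal (max 0 (h t)) = ennreal (max 0 (- h t))"
    by (subst (asm) sigma_finite_measure.density_unique_iff[OF sigma_finite_lborel]) auto
  then show ?thesis by eventually_elim (auto simp: max_def split: if_splits)
qed

text \<open>Letting \<open>c \<rightarrow> \<infinity>\<close> in the bump functions shows that \<open>f\<close> integrates to zero over all intervals
to the left of \<open>t0\<close>.\<close>

lemma du_Bois_Reymond_real:
  fixes f :: "real \<Rightarrow> real"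
  assumes loc: "\<And>a b. integrable lebesgue (\<lambda>t. indicator {a..b} t * f t)"
    and zero: "\<And>a b c. a < b \<Longrightarrow> b < t0 \<Longrightarrow> 0 < c \<Longrightarrow> (\<integral>t. bump a b c t * f t \<partial>lebesgue) = 0"
  shows "AE t in lebesgue. t < t0 \<longrightarrow> f t = 0"
proof -
  have lm: "g \<in> borel_measurable lebesgue" if "g \<in> borel_measurable borel" for g :: "real \<Rightarrow> real"
    using that by (intro measurable_completion) simp
  have int0: "(\<integral>t. indicator {a<..<b} t * f t \<partial>lebesgue) = 0" if ab: "a < b" "b < t0" for a b
  proof -
    have fm: "(\<lambda>t. indicator {a..b} t * f t) \<in> borel_measurable lebesgue" using loc[of a b] by simp
    have "(\<lambda>n. \<integral>t. bump a b (real (Suc n)) t * f t \<partial>lebesgue) \<longlonglongrightarrow> (\<integral>t. indicator {a<..<b} t * f t \<partial>lebesgue)"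
    proof (rule integral_dominated_convergence)
      show "integrable lebesgue (\<lambda>t. \<bar>indicator {a..b} t * f t\<bar>)" using loc[of a b] by simp
      have "(\<lambda>t. indicator {a<..<b} t * (indicator {a..b} t * f t)) \<in> borel_measurable lebesgue"
        by (intro borel_measurable_times fm lm) measurable
      also have "(\<lambda>t. indicator {a<..<b} t * (indicator {a..b} t * f t)) = (\<lambda>t. indicator {a<..<b} t * f t)"
        by (auto simp: indicator_def)
      finally show "(\<lambda>t. indicator {a<..<b} t * f t) \<in> borel_measurable lebesgue" .
      fix n
      have "(\<lambda>t. bump a b (real (Suc n)) t * (indicator {a..b} t * f t)) \<in> borel_measurable lebesgue"
        by (intro borel_measurable_times fm lm bump_measurable)
      also have "(\<lambda>t. bump a b (real (Suc n)) t * (indicator {a..b} t * f t)) = (\<lambda>t. bump a b (real (Suc n)) t * f t)"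
        by (auto simp: indicator_def bump_def)
      finally show "(\<lambda>t. bump a b (real (Suc n)) t * f t) \<in> borel_measurable lebesgue" .
      have "norm (bump a b (real (Suc n)) t * f t) \<le> \<bar>indicator {a..b} t * f t\<bar>" for t
        using bump_bounds[of "real (Suc n)" a b t] by (simp add: abs_mult mult_right_mono del: of_nat_Suc)
      then show "AE t in lebesgue. norm (bump a b (real (Suc n)) t * f t) \<le> \<bar>indicator {a..b} t * f t\<bar>" by simp
    next
      show "AE t in lebesgue. (\<lambda>n. bump a b (real (Suc n)) t * f t) \<longlonglongrightarrow> indicator {a<..<b} t * f t"
        by (intro AE_I2 tendsto_mult bump_tendsto_indicator tendsto_const)
    qed
    moreover have "(\<integral>t. bump a b (real (Suc n)) t * f t \<partial>lebesgue) = 0" for n by (rule zero) (use ab in auto)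
    ultimately show ?thesis by (simp add: LIMSEQ_const_iff)
  qed
  have part: "AE t in lebesgue. t \<in> {a<..<b} \<longrightarrow> f t = 0" if ab: "a < b" "b < t0" for a b
  proof -
    define g where "g t = indicator {a<..<b} t * f t" for t
    have gi: "integrable lebesgue g"
    proof (rule Bochner_Integration.integrable_bound[OF loc[of a b]])
      have "(\<lambda>t. indicator {a<..<b} t * (indicator {a..b} t * f t)) \<in> borel_measurable lebesgue"
        by (intro borel_measurable_times borel_measurable_integrable[OF loc] lm) measurable
      also have "(\<lambda>t. indicator {a<..<b} t * (indicator {a..b} t * f t)) = g"
        by (auto simp: indicator_def g_def)
      finally show "g \<in> borel_measurable lebesgue" .
      show "AE t in lebesgue. norm (g t) \<le> norm (indicator {a..b} t * f t)"
        by (intro AE_I2) (auto simp: g_def indicator_def)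
    qed
    obtain h where h[measurable]: "h \<in> borel_measurable lborel" and ae0: "AE t in lborel. g t = h t"
      using completion_ex_borel_measurable_real[OF borel_measurable_integrable[OF gi]] by auto
    have ae: "AE t in lebesgue. g t = h t" by (rule AE_completion[OF ae0])
    have hl: "h \<in> borel_measurable lebesgue" using h by (intro lm) simp
    have "integrable lebesgue h"
      using gi integrable_cong_AE[OF borel_measurable_integrable[OF gi] hl ae] by simp
    then have hi: "integrable lborel h" using h by (simp add: integrable_completion)
    have "(\<integral>t. indicator {x<..} t * h t \<partial>lborel) = 0" for x
    proof -
      have "(\<integral>t. indicator {x<..} t * h t \<partial>lborel) = (\<integral>t. indicator {x<..} t * h t \<partial>lebesgue)"
        by (rule integral_completion[symmetric]) measurable
      also have "\<dots> = (\<integral>t. indicator {x<..} t * g t \<partial>lebesgue)"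
        by (rule integral_cong_AE)
          (use ae in \<open>auto intro!: borel_measurable_times lm[OF borel_measurable_indicator] hl borel_measurable_integrable[OF gi]\<close>)
      also have "\<dots> = (\<integral>t. indicator {max x a<..<b} t * f t \<partial>lebesgue)"
        by (rule Bochner_Integration.integral_cong) (auto simp: g_def indicator_def)
      also have "\<dots> = 0"
      proof (cases "max x a < b")
        case True then show ?thesis using int0 ab by blast
      next
        case False then have "{max x a<..<b} = {}" by auto
        then show ?thesis by simp
      qed
      finally show ?thesis .
    qed
    from AE_completion[OF AE_zero_if_interval_integrals_zero[OF hi this]] ae
    show ?thesis by eventually_elim (auto simp: g_def indicator_def)
  qed
  \<comment> \<open>These intervals exhaust the open half-line; the offset 2 keeps the first one nonempty.\<close>
  have "AE t in lebesgue. \<forall>n::nat. t \<in> {t0 - real n - 2<..<t0 - 1 / real (Suc n)} \<longrightarrow> f t = 0"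
  proof (subst AE_all_countable, intro allI part)
    fix n :: nat
    have "1 / real (Suc n) \<le> 1" by simp
    then show "t0 - real n - 2 < t0 - 1 / real (Suc n)" by linarith
  qed simp
  then show ?thesis
  proof eventually_elim
    case (elim t)
    show ?case
    proof
      assume t: "t < t0"
      obtain n1 where n1: "inverse (real (Suc n1)) < t0 - t" using reals_Archimedean[of "t0 - t"] t by auto
      obtain n2 :: nat where n2: "t0 - t < real n2" using reals_Archimedean2 by blast
      define n where "n = max n1 n2"
      have "1 / real (Suc n) \<le> inverse (real (Suc n1))" by (simp add: n_def field_simps)
      moreover have "real n2 \<le> real n" by (simp add: n_def)
      ultimately have "t \<in> {t0 - real n - 2<..<t0 - 1 / real (Suc n)}" using n1 n2 by auto
      then show "f t = 0" using elim by blast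
    qed
  qed
qed

section \<open>The parabolic operator on constants\<close>

lemma bump_scaleR_integrable:
  fixes V :: "real \<Rightarrow> 'b::banach"
  assumes V: "ae_simple_limit V" and loc: "\<And>a b. integrable lebesgue (\<lambda>t. indicator {a..b} t * norm (V t))"
    and c: "0 < c"
  shows "ae_simple_limit (\<lambda>t. bump a b c t *\<^sub>R V t)"
    and "integrable lebesgue (\<lambda>t. norm (bump a b c t *\<^sub>R V t))"
    and "(\<lambda>t. bump a b c t *\<^sub>R V t) integrable_on UNIV"
proof -
  have "bump a b c \<in> borel_measurable lebesgue" by (intro measurable_completion) simp
  then show l: "ae_simple_limit (\<lambda>t. bump a b c t *\<^sub>R V t)" by (rule ae_simple_limit_scaleR[OF V])
  show i: "integrable lebesgue (\<lambda>t. norm (bump a b c t *\<^sub>R V t))"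
  proof (rule Bochner_Integration.integrable_bound[OF loc[of a b]])
    show "(\<lambda>t. norm (bump a b c t *\<^sub>R V t)) \<in> borel_measurable lebesgue"
      by (rule ae_simple_limit_compose_measurable[OF l]) (intro continuous_intros)
    have "norm (norm (bump a b c t *\<^sub>R V t)) \<le> norm (indicator {a..b} t * norm (V t))" for t
      using bump_bounds[OF c, of a b t] by (simp add: abs_mult mult_right_mono)
    then show "AE t in lebesgue. norm (norm (bump a b c t *\<^sub>R V t)) \<le> norm (indicator {a..b} t * norm (V t))" by simp
  qed
  show "(\<lambda>t. bump a b c t *\<^sub>R V t) integrable_on UNIV" by (rule ae_simple_limit_integrable_on[OF l i])
qed

text \<open>Almost all values of \<open>V\<close> are limits of elements of the countable set \<open>W\<close> of values of the
approximating simple functions. The scalar lemma, applied to a norming functional \<open>l w\<close> of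
each \<open>w\<close> in \<open>W\<close>, gives almost everywhere \<open>l w (V t) = 0\<close> for all these \<open>w\<close> at once. Choosing \<open>w\<close>
close to \<open>V t\<close> yields \<open>norm w = l w (w - V t) \<le> norm (w - V t)\<close>, so \<open>V t = 0\<close>.\<close>

lemma du_Bois_Reymond:
  fixes V :: "real \<Rightarrow> 'b::banach"
  assumes V: "ae_simple_limit V" and loc: "\<And>a b. integrable lebesgue (\<lambda>t. indicator {a..b} t * norm (V t))"
    and zero: "\<And>a b c. a < b \<Longrightarrow> b < t0 \<Longrightarrow> 0 < c \<Longrightarrow> integral UNIV (\<lambda>t. bump a b c t *\<^sub>R V t) = 0"
  shows "AE t in lebesgue. t < t0 \<longrightarrow> V t = 0"
proof -
  obtain s where s: "\<And>n. simple_function lebesgue (s n)"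
    and ae: "AE t in lebesgue. (\<lambda>n. s n t) \<longlonglongrightarrow> V t"
    using V unfolding ae_simple_limit_def by blast
  define W where "W = (\<Union>n. range (s n))"
  have "countable W" unfolding W_def
    using s by (intro countable_UN) (auto simp: simple_function_def intro: countable_finite)
  obtain l :: "'b \<Rightarrow> 'b \<Rightarrow> real" where l: "\<And>x. bounded_linear (l x)" "\<And>x y. \<bar>l x y\<bar> \<le> norm y" "\<And>x. l x x = norm x"
    using norming_functional_exists by metis
  have "AE t in lebesgue. t < t0 \<longrightarrow> l x (V t) = 0" for x
  proof (rule du_Bois_Reymond_real)
    have lV: "(\<lambda>t. l x (V t)) \<in> borel_measurable lebesgue"
      by (rule ae_simple_limit_compose_measurable[OF V linear_continuous_on[OF l(1)]])
    show "integrable lebesgue (\<lambda>t. indicator {a..b} t * l x (V t))" for a b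
    proof (rule Bochner_Integration.integrable_bound[OF loc[of a b]])
      show "(\<lambda>t. indicator {a..b} t * l x (V t)) \<in> borel_measurable lebesgue"
        by (intro borel_measurable_times lV borel_measurable_indicator) auto
      show "AE t in lebesgue. norm (indicator {a..b} t * l x (V t)) \<le> norm (indicator {a..b} t * norm (V t))"
        using l(2) by (intro AE_I2) (auto simp: indicator_def)
    qed
    fix a b c :: real assume abc: "a < b" "b < t0" "0 < c"
    note B = bump_scaleR_integrable[OF V loc abc(3), of a b]
    have "((\<lambda>t. bump a b c t * l x (V t)) has_integral l x 0) UNIV"
      using has_integral_linear[OF integrable_integral[OF B(3)] l(1)[of x]] zero[OF abc]
      by (simp add: o_def linear_scale[OF bounded_linear.linear[OF l(1)]])
    then have hi: "((\<lambda>t. bump a b c t * l x (V t)) has_integral 0) UNIV"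
      by (simp add: linear_0[OF bounded_linear.linear[OF l(1)]])
    have i: "integrable lebesgue (\<lambda>t. bump a b c t * l x (V t))"
    proof (rule Bochner_Integration.integrable_bound[OF B(2)])
      show "(\<lambda>t. bump a b c t * l x (V t)) \<in> borel_measurable lebesgue"
        by (intro borel_measurable_times lV measurable_completion) simp
      show "AE t in lebesgue. norm (bump a b c t * l x (V t)) \<le> norm (norm (bump a b c t *\<^sub>R V t))"
        using l(2) by (intro AE_I2) (simp add: abs_mult mult_left_mono)
    qed
    show "(\<integral>t. bump a b c t * l x (V t) \<partial>lebesgue) = 0"
      using has_integral_unique[OF has_integral_integral_lebesgue[OF i] hi] .
  qed
  then have "AE t in lebesgue. \<forall>x\<in>W. t < t0 \<longrightarrow> l x (V t) = 0"
    by (subst AE_ball_countable[OF \<open>countable W\<close>]) blast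
  with ae show ?thesis
  proof eventually_elim
    case (elim t)
    show ?case
    proof
      assume t: "t < t0"
      have "norm (s n t) \<le> norm (V t - s n t)" for n
      proof -
        have "s n t \<in> W" by (auto simp: W_def)
        then have "l (s n t) (V t) = 0" using elim t by blast
        then have "norm (s n t) = - l (s n t) (V t - s n t)"
          by (simp add: linear_diff[OF bounded_linear.linear[OF l(1)]] l(3))
        then show ?thesis using l(2)[of "s n t" "V t - s n t"] by linarith
      qed
      moreover have "(\<lambda>n. norm (s n t)) \<longlonglongrightarrow> norm (V t)" "(\<lambda>n. norm (V t - s n t)) \<longlonglongrightarrow> norm (V t - V t)"
        using elim(1) by (intro tendsto_intros; assumption)+
      ultimately have "norm (V t) \<le> norm (V t - V t)" by (intro LIMSEQ_le) auto
      then show "V t = 0" by simp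
    qed
  qed
qed

text \<open>For finite \<open>p\<close> the estimate \<open>z \<le> 1 + z powr p\<close> replaces Hoelder's inequality on bounded
intervals.\<close>

lemma Lp_locally_integrable:
  fixes v :: "real \<Rightarrow> 'b::real_normed_vector"
  assumes v: "v \<in> Lp p {..t0}" and p: "1 \<le> p"
  defines "V \<equiv> \<lambda>t. if t \<in> {..t0} then v t else 0"
  shows "ae_simple_limit V" and "integrable lebesgue (\<lambda>t. indicator {a..b} t * norm (V t))"
proof -
  show V: "ae_simple_limit V" unfolding V_def
    by (rule strongly_measurable_into_extend_zero[of UNIV]) (use v in \<open>auto simp: Lp_into_def\<close>)
  have nV: "(\<lambda>t. norm (V t)) \<in> borel_measurable lebesgue"
    by (rule ae_simple_limit_compose_measurable[OF V]) (intro continuous_intros)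
  have ind: "indicat_real {a..b} \<in> borel_measurable lebesgue"
    by (intro borel_measurable_indicator) auto
  have ii: "integrable lebesgue (indicat_real {a..b})"
    using emeasure_lborel_cbox_finite[of a b] by (simp add: integrable_indicator_iff del: emeasure_lborel_cbox)
  have m: "(\<lambda>t. indicator {a..b} t * norm (V t)) \<in> borel_measurable lebesgue"
    by (intro borel_measurable_times ind nV)
  show "integrable lebesgue (\<lambda>t. indicator {a..b} t * norm (V t))"
  proof (cases "p = \<infinity>")
    case True
    then obtain C where "AE t in lebesgue_on {..t0}. norm (v t) \<le> C" using v by (auto simp: Lp_into_def)
    then have ae: "AE t in lebesgue. t \<in> {..t0} \<longrightarrow> norm (v t) \<le> C"
      by (subst (asm) AE_restrict_space_iff) auto
    show ?thesis
    proof (rule Bochner_Integration.integrable_bound[OF _ m])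
      show "integrable lebesgue (\<lambda>t. \<bar>C\<bar> * indicat_real {a..b} t)" using ii by simp
      show "AE t in lebesgue. norm (indicator {a..b} t * norm (V t)) \<le> norm (\<bar>C\<bar> * indicat_real {a..b} t)"
        using ae by eventually_elim (auto simp: V_def indicator_def)
    qed
  next
    case False
    define r where "r = enn2real p"
    have r: "1 \<le> r" using p False unfolding r_def
      by (metis enn2real_1 enn2real_mono ennreal_top_neq_one infinity_ennreal_def less_top top.not_eq_extremum)
    have "integrable (lebesgue_on {..t0}) (\<lambda>t. norm (v t) powr r)"
      using v False by (auto simp: Lp_into_def r_def)
    then have i: "integrable lebesgue (\<lambda>t. indicator {..t0} t *\<^sub>R norm (v t) powr r)"
      by (subst (asm) integrable_restrict_space) auto
    show ?thesis
    proof (rule Bochner_Integration.integrable_bound[OF _ m])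
      show "integrable lebesgue (\<lambda>t. indicat_real {a..b} t + indicator {..t0} t *\<^sub>R norm (v t) powr r)"
        using ii i by (rule Bochner_Integration.integrable_add)
      have "z \<le> 1 + z powr r" if "0 \<le> z" for z :: real
      proof (cases "z \<le> 1")
        case True then show ?thesis using powr_ge_zero[of z r] by linarith
      next
        case False
        then have "z powr 1 \<le> z powr r" using r by (intro powr_mono) auto
        then show ?thesis using False by simp
      qed
      from this[OF norm_ge_zero]
      show "AE t in lebesgue. norm (indicator {a..b} t * norm (V t))
         \<le> norm (indicat_real {a..b} t + indicator {..t0} t *\<^sub>R norm (v t) powr r)"
        by (intro AE_I2) (auto simp: V_def indicator_def)
    qed
  qed
qed

text \<open>Elements of \<open>L\<^sup>p\<close> are locally integrable, so the two defining identities may be subtracted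
under the integral sign; the du Bois-Reymond lemma applies to the difference.\<close>

lemma weak_derivative_unique:
  fixes v1 v2 :: "real \<Rightarrow> 'a::complex_banach"
  assumes p: "1 \<le> p" and v1: "v1 \<in> Lp p {..t0}" and v2: "v2 \<in> Lp p {..t0}"
    and w1: "weak_derivative {..t0} v v1" and w2: "weak_derivative {..t0} v v2"
  shows "AE t in lebesgue_on {..t0}. v1 t = v2 t"
proof -
  define V1 where "V1 = (\<lambda>t. if t \<in> {..t0} then v1 t else 0)"
  define V2 where "V2 = (\<lambda>t. if t \<in> {..t0} then v2 t else 0)"
  have L1: "ae_simple_limit V1" "\<And>a b. integrable lebesgue (\<lambda>t. indicator {a..b} t * norm (V1 t))"
    unfolding V1_def by (rule Lp_locally_integrable[OF v1 p])+
  have L2: "ae_simple_limit V2" "\<And>a b. integrable lebesgue (\<lambda>t. indicator {a..b} t * norm (V2 t))"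
    unfolding V2_def by (rule Lp_locally_integrable[OF v2 p])+
  have lim: "ae_simple_limit (\<lambda>t. V1 t - V2 t)"
  proof -
    obtain s1 where s1: "\<And>n. simple_function lebesgue (s1 n)" "AE t in lebesgue. (\<lambda>n. s1 n t) \<longlonglongrightarrow> V1 t"
      using L1(1) unfolding ae_simple_limit_def by blast
    obtain s2 where s2: "\<And>n. simple_function lebesgue (s2 n)" "AE t in lebesgue. (\<lambda>n. s2 n t) \<longlonglongrightarrow> V2 t"
      using L2(1) unfolding ae_simple_limit_def by blast
    show ?thesis unfolding ae_simple_limit_def
    proof (intro exI[of _ "\<lambda>n t. s1 n t - s2 n t"] conjI allI)
      show "simple_function lebesgue (\<lambda>t. s1 n t - s2 n t)" for n
        by (rule simple_function_compose2[OF s1(1) s2(1)])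
      show "AE t in lebesgue. (\<lambda>n. s1 n t - s2 n t) \<longlonglongrightarrow> V1 t - V2 t"
        using s1(2) s2(2) by eventually_elim (rule tendsto_diff)
    qed
  qed
  have "AE t in lebesgue. t < t0 \<longrightarrow> V1 t - V2 t = 0"
  proof (rule du_Bois_Reymond[OF lim])
    fix a b :: real
    show "integrable lebesgue (\<lambda>t. indicator {a..b} t * norm (V1 t - V2 t))"
    proof (rule Bochner_Integration.integrable_bound[OF Bochner_Integration.integrable_add[OF L1(2)[of a b] L2(2)[of a b]]])
      have "(\<lambda>t. norm (V1 t - V2 t)) \<in> borel_measurable lebesgue"
        by (rule ae_simple_limit_compose_measurable[OF lim]) (intro continuous_intros)
      then show "(\<lambda>t. indicator {a..b} t * norm (V1 t - V2 t)) \<in> borel_measurable lebesgue"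
        by (intro borel_measurable_times borel_measurable_indicator) auto
      show "AE t in lebesgue. norm (indicator {a..b} t * norm (V1 t - V2 t))
         \<le> norm (indicator {a..b} t * norm (V1 t) + indicator {a..b} t * norm (V2 t))"
        by (intro AE_I2) (auto simp: indicator_def norm_triangle_ineq4)
    qed
  next
    fix a b c :: real assume abc: "a < b" "b < t0" "0 < c"
    have I: "integral UNIV (\<lambda>t. bump a b c t *\<^sub>R (if t \<in> {..t0} then u t else 0)) = integral {..t0} (\<lambda>t. bump a b c t *\<^sub>R u t)"
      for u :: "real \<Rightarrow> 'a"
    proof -
      have "(\<lambda>t. bump a b c t *\<^sub>R (if t \<in> {..t0} then u t else 0)) = (\<lambda>t. if t \<in> {..t0} then bump a b c t *\<^sub>R u t else 0)"
        by auto
      then show ?thesis by (simp only: integral_restrict_UNIV)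
    qed
    have t: "test_function {..t0} (bump a b c)" by (rule bump_test_function[OF abc])
    have "integral UNIV (\<lambda>t. bump a b c t *\<^sub>R (V1 t - V2 t))
      = integral UNIV (\<lambda>t. bump a b c t *\<^sub>R V1 t) - integral UNIV (\<lambda>t. bump a b c t *\<^sub>R V2 t)"
      unfolding scaleR_diff_right
      by (rule integral_diff[OF bump_scaleR_integrable(3)[OF L1 abc(3)] bump_scaleR_integrable(3)[OF L2 abc(3)]])
    also have "\<dots> = integral {..t0} (\<lambda>t. bump a b c t *\<^sub>R v1 t) - integral {..t0} (\<lambda>t. bump a b c t *\<^sub>R v2 t)"
      unfolding V1_def V2_def I ..
    also have "\<dots> = 0"
    proof -
      have "- integral {..t0} (\<lambda>t. bump a b c t *\<^sub>R v1 t) = - integral {..t0} (\<lambda>t. bump a b c t *\<^sub>R v2 t)"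
        using w1 w2 t unfolding weak_derivative_def by metis
      then show ?thesis by simp
    qed
    finally show "integral UNIV (\<lambda>t. bump a b c t *\<^sub>R (V1 t - V2 t)) = 0" .
  qed
  moreover have "AE t in lebesgue. t \<noteq> t0"
  proof -
    have "AE t in lborel. t \<noteq> t0" by (rule AE_lborel_singleton)
    then show ?thesis by (rule AE_completion)
  qed
  ultimately have "AE t in lebesgue. t \<in> {..t0} \<longrightarrow> v1 t = v2 t"
    by eventually_elim (auto simp: V1_def V2_def)
  then show ?thesis by (subst AE_restrict_space_iff) auto
qed

lemma weak_derivative_AE_cong:
  fixes v u v' :: "real \<Rightarrow> 'a::complex_banach"
  assumes ae: "AE t in lebesgue_on {..t0}. v t = u t" and w: "weak_derivative {..t0} v v'"
  shows "weak_derivative {..t0} u v'"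
proof -
  have "AE t in lebesgue. t \<in> {..t0} \<longrightarrow> v t = u t"
    using ae by (subst (asm) AE_restrict_space_iff) auto
  then have "negligible {t. \<not> (t \<in> {..t0} \<longrightarrow> v t = u t)}"
    unfolding negligible_iff_null_sets completion.AE_iff_null_sets by simp
  then have "integral {..t0} (\<lambda>t. c t *\<^sub>R v t) = integral {..t0} (\<lambda>t. c t *\<^sub>R u t)" for c :: "real \<Rightarrow> real"
    by (rule integral_spike) auto
  then show ?thesis using w unfolding weak_derivative_def by simp
qed

text \<open>The operator is single valued on equivalence classes; this makes its iterates single
valued although each step passes to an arbitrary representative.\<close>

lemma parabolic_operator_unique:
  assumes p: "1 \<le> p" and ae: "AE t in lebesgue_on {..t0}. v t = u t"
    and v: "parabolic_operator p {..t0} D A v h" and u: "parabolic_operator p {..t0} D A u k"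
  shows "AE t in lebesgue_on {..t0}. h t = k t"
proof -
  obtain v' where v': "v' \<in> Lp p {..t0}" "weak_derivative {..t0} v v'"
      "AE t in lebesgue_on {..t0}. h t = v' t + A (v t)"
    using v by (auto simp: parabolic_operator_def)
  obtain u' where u': "u' \<in> Lp p {..t0}" "weak_derivative {..t0} u u'"
      "AE t in lebesgue_on {..t0}. k t = u' t + A (u t)"
    using u by (auto simp: parabolic_operator_def)
  have "AE t in lebesgue_on {..t0}. v' t = u' t"
    by (rule weak_derivative_unique[OF p v'(1) u'(1) weak_derivative_AE_cong[OF ae v'(2)] u'(2)])
  with ae v'(3) u'(3) show ?thesis by eventually_elim simp
qed

lemma parabolic_operator_power_unique:
  assumes p: "1 \<le> p"
    and "(parabolic_operator p {..t0} D A ^^ n) v h" "(parabolic_operator p {..t0} D A ^^ n) v k"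
  shows "AE t in lebesgue_on {..t0}. h t = k t"
  using assms(2,3)
proof (induction n arbitrary: h k)
  case (Suc n)
  then obtain h' k' where "(parabolic_operator p {..t0} D A ^^ n) v h'" "parabolic_operator p {..t0} D A h' h"
     "(parabolic_operator p {..t0} D A ^^ n) v k'" "parabolic_operator p {..t0} D A k' k"
    by (auto elim!: relcomppE)
  then show ?case using Suc.IH parabolic_operator_unique[OF p] by blast
qed simp

text \<open>An inequality at \<open>t0\<close> would persist on an interval to the left of \<open>t0\<close>, and intervals are
not null sets.\<close>

lemma continuous_AE_eq_at_end:
  fixes f k :: "real \<Rightarrow> 'b::real_normed_vector"
  assumes f: "continuous_on {..t0} f" and k: "continuous_on {..t0} k"
    and ae: "AE t in lebesgue_on {..t0}. f t = k t"
  shows "f t0 = k t0"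
proof (rule ccontr)
  assume ne: "f t0 \<noteq> k t0"
  have "continuous_on {..t0} (\<lambda>t. norm (f t - k t))" by (intro continuous_intros f k)
  then have "((\<lambda>t. norm (f t - k t)) \<longlongrightarrow> norm (f t0 - k t0)) (at t0 within {..t0})"
    by (auto simp: continuous_on_def)
  then have "\<forall>\<^sub>F t in at t0 within {..t0}. 0 < norm (f t - k t)"
    by (rule order_tendstoD) (use ne in simp)
  then obtain d where d: "d > 0" "\<And>t. t \<le> t0 \<Longrightarrow> t \<noteq> t0 \<Longrightarrow> dist t t0 < d \<Longrightarrow> 0 < norm (f t - k t)"
    by (auto simp: eventually_at)
  have "AE t in lebesgue. t \<in> {..t0} \<longrightarrow> f t = k t"
    using ae by (subst (asm) AE_restrict_space_iff) auto
  then have "negligible {t. \<not> (t \<in> {..t0} \<longrightarrow> f t = k t)}"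
    unfolding negligible_iff_null_sets completion.AE_iff_null_sets by simp
  moreover have "{t0 - d<..<t0} \<subseteq> {t. \<not> (t \<in> {..t0} \<longrightarrow> f t = k t)}"
    using d(2) by (force simp: dist_real_def)
  ultimately have "negligible {t0 - d<..<t0}" by (rule negligible_subset)
  then have "negligible (box (t0 - d) t0)" by simp
  then have "box (t0 - d) t0 = {}" by (simp only: negligible_interval)
  then show False using d(1) by simp
qed

lemma parabolic_derivative_at_eq:
  assumes p: "1 \<le> p" and f: "parabolic_derivative S D A p {..t0} \<sigma> v f" "continuous_on {..t0} f"
  shows "parabolic_derivative_at S D A p t0 \<sigma> v = f t0"
  unfolding parabolic_derivative_at_def
proof (rule the_equality)
  show "\<exists>f'. parabolic_derivative S D A p {..t0} \<sigma> v f' \<and> continuous_on {..t0} f' \<and> f' t0 = f t0"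
    using f by blast
  fix y assume "\<exists>f'. parabolic_derivative S D A p {..t0} \<sigma> v f' \<and> continuous_on {..t0} f' \<and> f' t0 = y"
  then obtain f' where f': "parabolic_derivative S D A p {..t0} \<sigma> v f'" "continuous_on {..t0} f'" "f' t0 = y" by blast
  obtain h h' where h: "(parabolic_operator p {..t0} D A ^^ nat \<lceil>\<sigma>\<rceil>) (parabolic_integral S (of_int \<lceil>\<sigma>\<rceil> - \<sigma>) v) h"
      "AE t in lebesgue_on {..t0}. f t = h t"
    and h': "(parabolic_operator p {..t0} D A ^^ nat \<lceil>\<sigma>\<rceil>) (parabolic_integral S (of_int \<lceil>\<sigma>\<rceil> - \<sigma>) v) h'"
      "AE t in lebesgue_on {..t0}. f' t = h' t"
    using f(1) f'(1) unfolding parabolic_derivative_def by blast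
  have "AE t in lebesgue_on {..t0}. h t = h' t" by (rule parabolic_operator_power_unique[OF p h(1) h'(1)])
  with h(2) h'(2) have "AE t in lebesgue_on {..t0}. f t = f' t" by eventually_elim simp
  then have "f t0 = f' t0" by (rule continuous_AE_eq_at_end[OF f(2) f'(2)])
  then show "y = f t0" using f'(3) by simp
qed

lemma constant_strongly_measurable:
  assumes "c \<in> V" "\<And>t. t \<in> I \<Longrightarrow> f t = c"
  shows "strongly_measurable_into V I f"
proof -
  have "AE t in lebesgue_on I. f t \<in> V \<and> (\<lambda>n. c) \<longlonglongrightarrow> f t"
    using assms by (intro AE_I2) (auto simp: space_restrict_space)
  then show ?thesis unfolding strongly_measurable_into_def
    using assms(1) by (intro exI[of _ "\<lambda>n t. c"]) auto
qed

text \<open>On a half-line, constants belong to \<open>L\<^sup>p\<close> if \<open>p = \<infinity>\<close>, and only the zero constant belongs to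
the other spaces; stating both cases together lets the later lemmas treat all exponents
at once.\<close>

lemma constant_in_Lp:
  assumes "c \<in> V" "\<And>t. t \<in> I \<Longrightarrow> f t = c" "p = \<infinity> \<or> c = 0"
  shows "f \<in> Lp_into p I V"
proof -
  have "AE t in lebesgue_on I. norm (f t) \<le> norm c"
    using assms by (intro AE_I2) (auto simp: space_restrict_space)
  moreover have "integrable (lebesgue_on I) (\<lambda>t. norm (f t) powr enn2real p)" if "c = 0"
  proof -
    have "integrable (lebesgue_on I) (\<lambda>t. norm (f t) powr enn2real p) \<longleftrightarrow> integrable (lebesgue_on I) (\<lambda>t. 0 :: real)"
      by (rule Bochner_Integration.integrable_cong[OF refl]) (use assms(2) that in \<open>auto simp: space_restrict_space\<close>)
    then show ?thesis by simp
  qed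
  ultimately show ?thesis
    using constant_strongly_measurable[OF assms(1,2)] assms(3) by (auto simp: Lp_into_def)
qed

lemma weak_derivative_constant:
  fixes f :: "real \<Rightarrow> 'a::complex_banach"
  assumes "\<And>t. t \<le> t0 \<Longrightarrow> f t = c"
  shows "weak_derivative {..t0} f (\<lambda>t. 0)"
  unfolding weak_derivative_def
proof (intro allI impI)
  fix \<phi> assume \<phi>: "test_function {..t0} \<phi>"
  then obtain K where K: "compact K" "K \<subseteq> {..<t0}" "\<And>t. t \<notin> K \<Longrightarrow> \<phi> t = 0"
    by (auto simp: test_function_def)
  have "\<phi> differentiable_on UNIV" using \<phi> unfolding test_function_def by (metis funpow_0)
  then have D: "(\<phi> has_real_derivative deriv \<phi> t) (at t)" for t
    by (simp add: differentiable_on_def DERIV_deriv_iff_real_differentiable)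
  obtain a where a: "\<And>t. t \<in> K \<Longrightarrow> a < t" "a < t0"
  proof -
    obtain B where "\<And>t. t \<in> K \<Longrightarrow> \<bar>t\<bar> \<le> B" using compact_imp_bounded[OF K(1)] by (auto simp: bounded_iff)
    then show ?thesis by (intro that[of "min (- B - 1) (t0 - 1)"]) force+
  qed
  have d0: "deriv \<phi> t = 0" if "t \<notin> K" for t
  proof -
    have "open (- K)" using K(1) by (simp add: compact_imp_closed open_Compl)
    then have "\<forall>\<^sub>F s in nhds t. \<phi> s = 0"
      using K(3) that by (auto simp: eventually_nhds intro!: exI[of _ "- K"])
    then have "(\<phi> has_real_derivative 0) (at t)" by (subst DERIV_cong_ev[OF refl _ refl]) auto
    then show ?thesis by (rule DERIV_imp_deriv)
  qed
  have "(deriv \<phi> has_integral (\<phi> t0 - \<phi> a)) {a..t0}"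
    by (rule fundamental_theorem_of_calculus)
      (use a D in \<open>auto simp: has_real_derivative_iff_has_vector_derivative[symmetric] intro: has_field_derivative_at_within\<close>)
  moreover have "\<phi> t0 = 0" "\<phi> a = 0" using K a by force+
  ultimately have "(deriv \<phi> has_integral 0) {a..t0}" by simp
  then have "((\<lambda>t. deriv \<phi> t *\<^sub>R c) has_integral 0 *\<^sub>R c) {a..t0}" by (rule has_integral_scaleR_left)
  from has_integral_eq[OF _ this, of "\<lambda>t. deriv \<phi> t *\<^sub>R f t"]
  have "((\<lambda>t. deriv \<phi> t *\<^sub>R f t) has_integral 0) {a..t0}" using assms by simp
  then have "((\<lambda>t. deriv \<phi> t *\<^sub>R f t) has_integral 0) {..t0}"
  proof (rule has_integral_on_superset)
    fix t assume "t \<notin> {a..t0}"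
    then have "t \<notin> K" using a(1)[of t] K(2) by force
    then show "deriv \<phi> t *\<^sub>R f t = 0" by (simp add: d0)
  qed auto
  then show "integral {..t0} (\<lambda>t. deriv \<phi> t *\<^sub>R f t) = - integral {..t0} (\<lambda>t. \<phi> t *\<^sub>R 0)"
    by (simp add: integral_unique)
qed

lemma parabolic_operator_constant:
  assumes "\<And>t. t \<le> t0 \<Longrightarrow> v t = y" "y \<in> D" "p = \<infinity> \<or> (y = 0 \<and> A y = 0)"
  shows "parabolic_operator p {..t0} D A v (\<lambda>t. A y)"
  unfolding parabolic_operator_def
proof (intro conjI bexI[of _ "\<lambda>t. 0"])
  show "v \<in> Lp_domain p {..t0} D A"
    unfolding Lp_domain_def mem_Collect_eq
    by (rule constant_in_Lp[of "(y, A y)"]) (use assms in \<open>auto simp: operator_graph_def zero_prod_def\<close>)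
  show "v \<in> Lp p {..t0}" by (rule constant_in_Lp[of y]) (use assms in auto)
  show "weak_derivative {..t0} v (\<lambda>t. 0)" by (rule weak_derivative_constant[OF assms(1)])
  show "AE t in lebesgue_on {..t0}. A y = 0 + A (v t)"
    by (rule AE_I2) (use assms(1) in \<open>auto simp: space_restrict_space\<close>)
  show "(\<lambda>t. 0) \<in> Lp p {..t0}" by (rule constant_in_Lp[of 0]) auto
qed

section \<open>An integral representation of the incomplete gamma function\<close>

text \<open>Euler's reflection formula on the real line.\<close>

lemma Gamma_reflection_real:
  fixes \<alpha> :: real
  shows "Gamma \<alpha> * Gamma (1 - \<alpha>) = pi / sin (pi * \<alpha>)"
proof -
  have "1 - complex_of_real \<alpha> = complex_of_real (1 - \<alpha>)"
    and "complex_of_real pi * complex_of_real \<alpha> = complex_of_real (pi * \<alpha>)" by simp_all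
  then have "complex_of_real (Gamma \<alpha> * Gamma (1 - \<alpha>)) = complex_of_real (pi / sin (pi * \<alpha>))"
    using Gamma_reflection_complex[of "complex_of_real \<alpha>"]
    by (simp only: Gamma_complex_of_real sin_of_real[symmetric] of_real_mult of_real_divide)
  then show ?thesis by (simp only: of_real_eq_iff)
qed

lemma upper_gamma_eq_lborel:
  assumes "0 < \<alpha>" "0 \<le> z"
  shows "integrable lborel (\<lambda>\<zeta>. indicator {z<..} \<zeta> * (\<zeta> powr (\<alpha> - 1) * exp (- \<zeta>)))" (is "integrable _ ?g")
    and "upper_gamma \<alpha> z = (\<integral>\<zeta>. indicator {z<..} \<zeta> * (\<zeta> powr (\<alpha> - 1) * exp (- \<zeta>)) \<partial>lborel) / Gamma \<alpha>"
proof -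
  have "integrable lborel (\<lambda>\<zeta>. if 0 < \<zeta> then \<zeta> powr (\<alpha> - 1) * exp (- 1 * \<zeta>) else 0)"
    using Gamma_integral_scaled[of \<alpha> 1] assms by (simp add: has_bochner_integral_iff)
  then show i: "integrable lborel ?g"
    by (rule Bochner_Integration.integrable_bound) (use assms in \<open>auto simp: indicator_def\<close>)
  have "(?g has_integral integral\<^sup>L lborel ?g) UNIV" by (rule has_integral_integral_lborel[OF i])
  then have "((\<lambda>\<zeta>. if \<zeta> \<in> {z..} then \<zeta> powr (\<alpha> - 1) * exp (- \<zeta>) else 0) has_integral integral\<^sup>L lborel ?g) UNIV"
    by (rule has_integral_spike[of "{z}", rotated 2]) (auto simp: indicator_def)
  then have "((\<lambda>\<zeta>. \<zeta> powr (\<alpha> - 1) * exp (- \<zeta>)) has_integral integral\<^sup>L lborel ?g) {z..}"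
    by (simp only: has_integral_restrict_UNIV)
  then show "upper_gamma \<alpha> z = integral\<^sup>L lborel ?g / Gamma \<alpha>"
    by (simp add: upper_gamma_def integral_unique)
qed

lemma nn_integral_exp_tail:
  assumes "0 < s"
  shows "(\<integral>\<^sup>+ y. ennreal (indicator {w<..} y * exp (- s * y)) \<partial>lborel) = ennreal (exp (- s * w) / s)"
proof -
  have "((\<lambda>y. if y \<in> {w..} then exp (- s * y) else 0) has_integral exp (- s * w) / s) UNIV"
    using has_integral_exp_minus_to_infinity[OF assms, of w] by (simp only: has_integral_restrict_UNIV)
  then have "((\<lambda>y. indicator {w<..} y * exp (- s * y)) has_integral exp (- s * w) / s) UNIV"
    by (rule has_integral_spike[of "{w}", rotated 2]) (auto simp: indicator_def)
  then show ?thesis by (rule nn_integral_has_integral_lborel[rotated 2]) auto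
qed

text \<open>After the shift \<open>\<sigma> = t + \<tau>\<close>, insert \<open>exp (- w \<sigma>) / \<sigma> = \<integral>\<^sub>w\<^sup>\<infinity> exp (- \<sigma> y) dy\<close> and exchange the
integrals (Tonelli). The \<open>\<tau>\<close>-integral is then \<open>\<Gamma>(1 - \<alpha>) y\<^sup>\<alpha>\<^sup>-\<^sup>1\<close>, and \<open>\<zeta> = t y\<close> produces the
incomplete gamma integral from \<open>w t\<close>.\<close>

lemma shifted_power_exp_integral:
  fixes \<alpha> t w :: real
  assumes \<alpha>: "0 < \<alpha>" "\<alpha> < 1" and t: "0 < t" and w: "0 \<le> w"
  shows "((\<lambda>\<sigma>. inverse \<sigma> * (\<sigma> - t) powr (- \<alpha>) * exp (- w * \<sigma>)) has_integral
      Gamma (1 - \<alpha>) * t powr (- \<alpha>) * (Gamma \<alpha> * upper_gamma \<alpha> (w * t))) {t..}"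
proof -
  define G where "G = (\<integral>\<zeta>. indicator {w * t<..} \<zeta> * (\<zeta> powr (\<alpha> - 1) * exp (- \<zeta>)) \<partial>lborel)"
  have wt: "0 \<le> w * t" using w t by simp
  note ug = upper_gamma_eq_lborel[OF \<alpha>(1) wt]
  have G0: "0 \<le> G" unfolding G_def by (rule Bochner_Integration.integral_nonneg) simp
  have G: "Gamma \<alpha> * upper_gamma \<alpha> (w * t) = G"
    using ug(2) less_imp_neq[OF Gamma_real_pos[OF \<alpha>(1)]] by (simp add: G_def)
  define F where "F \<tau> = (if 0 < \<tau> then \<tau> powr (- \<alpha>) * (exp (- (t + \<tau>) * w) / (t + \<tau>)) else 0)" for \<tau>
  \<comment> \<open>The common integrand of the two iterated integrals.\<close>
  define K where "K y \<tau> = ennreal (if 0 < \<tau> then \<tau> powr (- \<alpha>) * (indicator {w<..} y * exp (- (t + \<tau>) * y)) else 0)" for y \<tau> :: real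
  have Fm: "F \<in> borel_measurable borel" unfolding F_def by measurable
  have F0: "0 \<le> F \<tau>" for \<tau> using t by (simp add: F_def)
  have inner: "(\<integral>\<^sup>+ \<tau>. K y \<tau> \<partial>lborel) = ennreal (Gamma (1 - \<alpha>) * (indicator {w<..} y * (y powr (\<alpha> - 1) * exp (- t * y))))" for y
  proof (cases "w < y")
    case True
    then have y: "0 < y" using w by simp
    define k where "k \<tau> = (if 0 < \<tau> then \<tau> powr (1 - \<alpha> - 1) * exp (- y * \<tau>) else 0)" for \<tau>
    have kb: "has_bochner_integral lborel k (Gamma (1 - \<alpha>) * y powr (- (1 - \<alpha>)))"
      unfolding k_def by (rule Gamma_integral_scaled) (use \<alpha> y in auto)
    have "K y \<tau> = ennreal (exp (- t * y) * k \<tau>)" for \<tau>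
      using True by (auto simp: K_def k_def exp_add[symmetric] algebra_simps mult_exp_exp)
    then have "(\<integral>\<^sup>+ \<tau>. K y \<tau> \<partial>lborel) = (\<integral>\<^sup>+ \<tau>. ennreal (exp (- t * y) * k \<tau>) \<partial>lborel)" by simp
    also have "\<dots> = ennreal (\<integral>\<tau>. exp (- t * y) * k \<tau> \<partial>lborel)"
    proof (rule nn_integral_eq_integral)
      show "integrable lborel (\<lambda>\<tau>. exp (- t * y) * k \<tau>)"
        using kb by (intro integrable_mult_right) (simp add: has_bochner_integral_iff)
    qed (simp add: k_def)
    also have "(\<integral>\<tau>. exp (- t * y) * k \<tau> \<partial>lborel) = exp (- t * y) * (Gamma (1 - \<alpha>) * y powr (- (1 - \<alpha>)))"
      using kb by (simp add: has_bochner_integral_iff)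
    finally show ?thesis using True by (simp add: algebra_simps)
  next
    case False
    then have "K y \<tau> = 0" for \<tau> by (simp add: K_def)
    then show ?thesis using False by simp
  qed
  have inner2: "(\<integral>\<^sup>+ y. K y \<tau> \<partial>lborel) = ennreal (F \<tau>)" for \<tau>
  proof (cases "0 < \<tau>")
    case True
    then have "(\<integral>\<^sup>+ y. K y \<tau> \<partial>lborel) = (\<integral>\<^sup>+ y. ennreal (\<tau> powr (- \<alpha>)) * ennreal (indicator {w<..} y * exp (- (t + \<tau>) * y)) \<partial>lborel)"
      by (simp add: K_def ennreal_mult)
    also have "\<dots> = ennreal (\<tau> powr (- \<alpha>)) * ennreal (exp (- (t + \<tau>) * w) / (t + \<tau>))"
    proof (subst nn_integral_cmult)
      show "(\<lambda>y. ennreal (indicator {w<..} y * exp (- (t + \<tau>) * y))) \<in> borel_measurable lborel"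
        by measurable
      show "ennreal (\<tau> powr (- \<alpha>)) * (\<integral>\<^sup>+ y. ennreal (indicator {w<..} y * exp (- (t + \<tau>) * y)) \<partial>lborel)
        = ennreal (\<tau> powr (- \<alpha>)) * ennreal (exp (- (t + \<tau>) * w) / (t + \<tau>))"
        by (subst nn_integral_exp_tail) (use True t in auto)
    qed
    also have "\<dots> = ennreal (F \<tau>)" using True t by (simp add: F_def ennreal_mult[symmetric])
    finally show ?thesis .
  qed (simp add: K_def F_def)
  have "(\<integral>\<^sup>+ \<tau>. ennreal (F \<tau>) \<partial>lborel) = (\<integral>\<^sup>+ \<tau>. (\<integral>\<^sup>+ y. K y \<tau> \<partial>lborel) \<partial>lborel)" by (simp add: inner2)
  also have "\<dots> = (\<integral>\<^sup>+ y. (\<integral>\<^sup>+ \<tau>. K y \<tau> \<partial>lborel) \<partial>lborel)"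
    by (rule lborel_pair.Fubini') (unfold K_def, measurable)
  also have "\<dots> = (\<integral>\<^sup>+ y. ennreal (Gamma (1 - \<alpha>) * (indicator {w<..} y * (y powr (\<alpha> - 1) * exp (- t * y)))) \<partial>lborel)"
    by (simp only: inner)
  also have "\<dots> = ennreal (Gamma (1 - \<alpha>) * t powr (- \<alpha>) * G)"
  proof -
    have "has_bochner_integral lborel (\<lambda>\<zeta>. indicator {w * t<..} \<zeta> * (\<zeta> powr (\<alpha> - 1) * exp (- \<zeta>))) G"
      using ug(1) by (simp add: has_bochner_integral_iff G_def)
    then have "has_bochner_integral lborel (\<lambda>y. indicator {w * t<..} (0 + t * y) * ((0 + t * y) powr (\<alpha> - 1) * exp (- (0 + t * y)))) (G /\<^sub>R \<bar>t\<bar>)"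
      using t by (subst (asm) lborel_has_bochner_integral_real_affine_iff[of t _ _ 0]) simp_all
    then have "has_bochner_integral lborel (\<lambda>y. Gamma (1 - \<alpha>) * t powr (1 - \<alpha>) * (indicator {w * t<..} (0 + t * y) * ((0 + t * y) powr (\<alpha> - 1) * exp (- (0 + t * y)))))
         (Gamma (1 - \<alpha>) * t powr (1 - \<alpha>) * (G /\<^sub>R \<bar>t\<bar>))"
      by (rule has_bochner_integral_mult_right)
    moreover have "Gamma (1 - \<alpha>) * t powr (1 - \<alpha>) * (indicator {w * t<..} (0 + t * y) * ((0 + t * y) powr (\<alpha> - 1) * exp (- (0 + t * y))))
        = Gamma (1 - \<alpha>) * (indicator {w<..} y * (y powr (\<alpha> - 1) * exp (- t * y)))" for y
    proof (cases "w < y")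
      case True
      then have "t powr (1 - \<alpha>) * (t * y) powr (\<alpha> - 1) = y powr (\<alpha> - 1)"
        using t w by (simp add: powr_mult powr_add[symmetric] mult.assoc[symmetric])
      then show ?thesis using True t by (simp add: indicator_def mult.commute[of w t] mult_ac)
    next
      case False
      then show ?thesis using t by (simp add: indicator_def mult.commute[of w t])
    qed
    moreover have "Gamma (1 - \<alpha>) * t powr (1 - \<alpha>) * (G /\<^sub>R \<bar>t\<bar>) = Gamma (1 - \<alpha>) * t powr (- \<alpha>) * G"
      using t by (simp add: powr_diff powr_minus field_simps)
    ultimately have "has_bochner_integral lborel (\<lambda>y. Gamma (1 - \<alpha>) * (indicator {w<..} y * (y powr (\<alpha> - 1) * exp (- t * y)))) (Gamma (1 - \<alpha>) * t powr (- \<alpha>) * G)"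
      by (simp only:)
    then show ?thesis
      by (subst nn_integral_eq_integral)
        (use \<alpha> Gamma_real_pos[of "1 - \<alpha>"] in \<open>auto simp: has_bochner_integral_iff mult.assoc\<close>)
  qed
  finally have nn: "(\<integral>\<^sup>+ \<tau>. ennreal (F \<tau>) \<partial>lborel) = ennreal (Gamma (1 - \<alpha>) * t powr (- \<alpha>) * G)" .
  have c0: "0 \<le> Gamma (1 - \<alpha>) * t powr (- \<alpha>) * G"
    using \<alpha> Gamma_real_pos[of "1 - \<alpha>"] G0 by simp
  have "(F has_integral (Gamma (1 - \<alpha>) * t powr (- \<alpha>) * G)) UNIV"
    by (rule nn_integral_has_integral[OF Fm F0 nn c0])
  then have "has_bochner_integral lborel F (Gamma (1 - \<alpha>) * t powr (- \<alpha>) * G)"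
    by (rule nonneg_has_integral_bochner[OF Fm F0])
  then have "has_bochner_integral lborel (\<lambda>\<sigma>. F (- t + 1 * \<sigma>)) (Gamma (1 - \<alpha>) * t powr (- \<alpha>) * G)"
    by (subst (asm) lborel_has_bochner_integral_real_affine_iff[of 1 _ _ "- t"]) simp_all
  then have "((\<lambda>\<sigma>. F (- t + 1 * \<sigma>)) has_integral (Gamma (1 - \<alpha>) * t powr (- \<alpha>) * G)) UNIV"
    using has_integral_integral_lborel[of "\<lambda>\<sigma>. F (- t + 1 * \<sigma>)"] by (simp only: has_bochner_integral_iff)
  also have "(\<lambda>\<sigma>. F (- t + 1 * \<sigma>)) = (\<lambda>\<sigma>. if \<sigma> \<in> {t..} then inverse \<sigma> * (\<sigma> - t) powr (- \<alpha>) * exp (- w * \<sigma>) else 0)"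
    by (auto simp: F_def fun_eq_iff field_simps)
  finally show ?thesis unfolding G by (simp only: has_integral_restrict_UNIV)
qed

text \<open>The formula defining \<open>upper_gamma_op\<close> for the scalar semigroup \<open>exp (- w \<sigma>)\<close>; the
reflection formula cancels \<open>\<Gamma>(\<alpha>) \<Gamma>(1 - \<alpha>)\<close> against \<open>sin (\<pi> \<alpha>) / \<pi>\<close>.\<close>

lemma upper_gamma_integral_representation:
  fixes \<alpha> t w :: real
  assumes "0 < \<alpha>" "\<alpha> < 1" "0 < t" "0 \<le> w"
  shows "((\<lambda>\<sigma>. t powr \<alpha> * sin (pi * \<alpha>) / pi * (inverse \<sigma> * (\<sigma> - t) powr (- \<alpha>) * exp (- w * \<sigma>)))
     has_integral upper_gamma \<alpha> (w * t)) {t..}"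
proof -
  have s: "sin (pi * \<alpha>) \<noteq> 0" using assms by (intro less_imp_neq[THEN not_sym] sin_gt_zero) auto
  have tt: "t powr \<alpha> * t powr (- \<alpha>) = 1" using assms by (simp add: powr_add[symmetric])
  have "t powr \<alpha> * sin (pi * \<alpha>) / pi * (Gamma (1 - \<alpha>) * t powr (- \<alpha>) * (Gamma \<alpha> * upper_gamma \<alpha> (w * t)))
     = (t powr \<alpha> * t powr (- \<alpha>)) * (Gamma \<alpha> * Gamma (1 - \<alpha>)) * sin (pi * \<alpha>) / pi * upper_gamma \<alpha> (w * t)"
    by (simp add: algebra_simps)
  also have "\<dots> = upper_gamma \<alpha> (w * t)" using s by (simp add: tt Gamma_reflection_real)
  finally show ?thesis using has_integral_mult_right[OF shifted_power_exp_integral[OF assms], of "t powr \<alpha> * sin (pi * \<alpha>) / pi"]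
    by simp
qed

section \<open>The mild solution with constant datum\<close>

text \<open>Affine substitution on the whole line, reduced to the one on compact intervals: the
image of a sufficiently large ball contains the ball prescribed by the definition of the
improper integral.\<close>

lemma has_integral_affine_UNIV:
  fixes f :: "real \<Rightarrow> 'b::banach"
  assumes f: "(f has_integral i) UNIV" and m: "0 < m"
  shows "((\<lambda>x. f (m * x + c)) has_integral i /\<^sub>R m) UNIV"
proof -
  have nc: "\<not> (\<exists>a b. (UNIV :: real set) = cbox a b)" using not_interval_UNIV by metis
  show ?thesis
  proof (subst has_integral_alt, subst if_not_P[OF nc], simp only: UNIV_I if_True, intro allI impI)
    fix e :: real assume "0 < e"
    then have "0 < e * m" using m by simp
    then obtain B where B: "0 < B" "\<And>a b. ball 0 B \<subseteq> cbox a b \<Longrightarrow>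
        \<exists>z. ((\<lambda>x. if x \<in> UNIV then f x else 0) has_integral z) (cbox a b) \<and> norm (z - i) < e * m"
      using has_integral_altD[OF f nc] by blast
    show "\<exists>B>0. \<forall>a b. ball 0 B \<subseteq> cbox a b \<longrightarrow>
        (\<exists>z. ((\<lambda>x. f (m * x + c)) has_integral z) (cbox a b) \<and> norm (z - i /\<^sub>R m) < e)"
    proof (intro exI[of _ "(B + \<bar>c\<bar>) / m"] conjI allI impI)
      show "0 < (B + \<bar>c\<bar>) / m" using B(1) m by simp
      fix a b :: real assume ab: "ball 0 ((B + \<bar>c\<bar>) / m) \<subseteq> cbox a b"
      have "ball 0 B \<subseteq> cbox (m * a + c) (m * b + c)"
      proof
        fix y :: real assume "y \<in> ball 0 B"
        then have "\<bar>y - c\<bar> < B + \<bar>c\<bar>" by (simp add: dist_norm)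
        then have "(y - c) / m \<in> ball 0 ((B + \<bar>c\<bar>) / m)" using m by (simp add: dist_norm divide_strict_right_mono)
        then have "(y - c) / m \<in> cbox a b" using ab by blast
        then show "y \<in> cbox (m * a + c) (m * b + c)" using m by (simp add: field_simps)
      qed
      from B(2)[OF this] obtain z
        where z: "(f has_integral z) (cbox (m * a + c) (m * b + c))" "norm (z - i) < e * m"
        by (simp only: UNIV_I if_True) blast
      from has_integral_affinity'[OF z(1) m, of c]
      have "((\<lambda>x. f (m * x + c)) has_integral z /\<^sub>R m) (cbox a b)"
        using m by (simp add: mult.assoc[symmetric])
      moreover have "norm (z /\<^sub>R m - i /\<^sub>R m) < e"
      proof -
        have "norm (z /\<^sub>R m - i /\<^sub>R m) = norm (inverse m *\<^sub>R (z - i))" by (simp add: scaleR_diff_right)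
        also have "\<dots> = norm (z - i) / m" using m by (simp add: divide_inverse mult.commute)
        finally show ?thesis using z(2) m by (simp add: pos_divide_less_eq)
      qed
      ultimately show "\<exists>z. ((\<lambda>x. f (m * x + c)) has_integral z) (cbox a b) \<and> norm (z - i /\<^sub>R m) < e" by blast
    qed
  qed
qed

text \<open>If one side is not integrable, neither is the other, and both integrals have the
default value zero.\<close>

lemma integral_affine_UNIV:
  fixes f :: "real \<Rightarrow> 'b::banach"
  assumes m: "0 < m"
  shows "integral UNIV (\<lambda>x. f (m * x + c)) = integral UNIV f /\<^sub>R m"
proof (cases "f integrable_on UNIV")
  case True
  then show ?thesis using has_integral_affine_UNIV[OF _ m] by (blast intro: integral_unique)
next
  case False
  have "\<not> (\<lambda>x. f (m * x + c)) integrable_on UNIV"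
  proof
    assume "(\<lambda>x. f (m * x + c)) integrable_on UNIV"
    then obtain i where "((\<lambda>x. f (m * x + c)) has_integral i) UNIV" by blast
    from has_integral_affine_UNIV[OF this, of "1 / m" "- c / m"]
    have "((\<lambda>x. f (m * (1 / m * x + - c / m) + c)) has_integral i /\<^sub>R (1 / m)) UNIV" using m by simp
    also have "(\<lambda>x. f (m * (1 / m * x + - c / m) + c)) = f" using m by (simp add: algebra_simps)
    finally show False using False by blast
  qed
  with False show ?thesis by (simp add: not_integrable_integral)
qed

lemma integral_atLeast_affine:
  fixes f :: "real \<Rightarrow> 'b::banach"
  assumes t: "0 < t"
  shows "integral {0..} (\<lambda>\<tau>. f (t * (\<tau> + 1))) = (1 / t) *\<^sub>R integral {t..} f"
proof -
  define h where "h \<sigma> = (if \<sigma> \<in> {t..} then f \<sigma> else 0)" for \<sigma>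
  have "integral {0..} (\<lambda>\<tau>. f (t * (\<tau> + 1))) = integral UNIV (\<lambda>\<tau>. if \<tau> \<in> {0..} then f (t * (\<tau> + 1)) else 0)"
    by (rule integral_restrict_UNIV[symmetric])
  also have "(\<lambda>\<tau>. if \<tau> \<in> {0..} then f (t * (\<tau> + 1)) else 0) = (\<lambda>\<tau>. h (t * \<tau> + t))"
    using t by (auto simp: h_def fun_eq_iff algebra_simps zero_le_mult_iff)
  also have "integral UNIV (\<lambda>\<tau>. h (t * \<tau> + t)) = (1 / t) *\<^sub>R integral UNIV h"
    using integral_affine_UNIV[OF t, of h t] by (simp add: divide_inverse)
  also have "integral UNIV h = integral {t..} f" unfolding h_def by (rule integral_restrict_UNIV)
  finally show ?thesis .
qed

text \<open>The integral over the half-line would exceed the length of each of its compact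
subintervals.\<close>

lemma integrable_constant_atMost:
  fixes t0 :: real
  assumes "integrable (lebesgue_on {..t0}) (\<lambda>t. c :: real)"
  shows "c = 0"
proof (rule ccontr)
  assume c: "c \<noteq> 0"
  have "integrable lebesgue (\<lambda>t. indicator {..t0} t *\<^sub>R c)"
    using assms by (subst (asm) integrable_restrict_space) auto
  then have "(\<lambda>t. indicator {..t0} t *\<^sub>R c) integrable_on UNIV" by (rule integrable_on_lebesgue)
  from integrable_on_cmult_left[OF this, of "inverse c"]
  have "(\<lambda>t. if t \<in> {..t0} then 1 else 0 :: real) integrable_on UNIV"
    by (rule integrable_eq) (use c in \<open>auto simp: indicator_def\<close>)
  then have i: "(\<lambda>t. 1 :: real) integrable_on {..t0}" by (simp only: integrable_restrict_UNIV)
  obtain n :: nat where n: "integral {..t0} (\<lambda>t. 1 :: real) < real n" using reals_Archimedean2 by blast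
  have "integral {t0 - real n..t0} (\<lambda>t. 1 :: real) \<le> integral {..t0} (\<lambda>t. 1)"
    by (rule integral_subset_le) (use i in auto)
  then show False using n by simp
qed

lemma parabolic_derivative_zero:
  assumes "v \<in> Lp p I"
  shows "parabolic_derivative S D A p I 0 v v"
  using assms unfolding parabolic_derivative_def
  by (auto intro!: exI[of _ v] simp: parabolic_integral_def fun_eq_iff)

context stable_semigroup_generator
begin

lemma frac_power_commute_semigroup:
  assumes "0 < \<alpha>" "0 \<le> t"
  shows "frac_power S \<alpha> (S t (neg_power S \<alpha> x)) = S t x"
  using assms by (simp add: neg_power_commute_semigroup frac_power_neg_power)

text \<open>The constants \<open>y j = A\<^sup>-\<^sup>j z\<close> form a chain with \<open>A (y (j + 1)) = y j\<close>. The parabolic integral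
of \<open>g\<close> is \<open>y n\<close> on the half-line, and each application of \<open>\<partial>\<^sub>t + A\<close> moves one step down, ending
at \<open>y 0 = z\<close>.\<close>

lemma parabolic_derivative_constant:
  assumes \<sigma>: "0 < \<sigma>" "\<sigma> \<notin> \<int>" and g: "\<And>t. t \<le> t0 \<Longrightarrow> g t = neg_power S \<sigma> z"
    and p: "p = \<infinity> \<or> z = 0"
  shows "parabolic_derivative S D A p {..t0} \<sigma> g (\<lambda>t. z)"
proof -
  define n where "n = nat \<lceil>\<sigma>\<rceil>"
  define \<theta> where "\<theta> = of_int \<lceil>\<sigma>\<rceil> - \<sigma>"
  have "of_int \<lceil>\<sigma>\<rceil> \<noteq> \<sigma>" using \<sigma>(2) by (metis Ints_of_int)
  then have \<theta>: "0 < \<theta>" unfolding \<theta>_def using le_of_int_ceiling[of \<sigma>] by linarith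
  have n: "real n = \<theta> + \<sigma>" "0 < n" using \<sigma>(1) by (auto simp: n_def \<theta>_def)
  define y where "y j = (if j = 0 then z else neg_power S (real j) z)" for j :: nat
  have ySuc: "y (Suc j) = neg_power S 1 (y j)" for j
    by (cases "j = 0") (auto simp: y_def neg_power_add)
  have yD: "y (Suc j) \<in> D" "A (y (Suc j)) = y j" for j
    by (simp_all add: ySuc neg_power_one_inverse)
  have y0: "y j = 0" if "z = 0" for j using that by (simp add: y_def neg_power_zero)
  define v where "v = parabolic_integral S \<theta> g"
  have v: "v t = y n" if t: "t \<le> t0" for t
  proof -
    have "integral {0..} (\<lambda>\<tau>. (\<tau> powr (\<theta> - 1)) *\<^sub>R S \<tau> (g (t - \<tau>)))
        = integral {0..} (\<lambda>\<tau>. (\<tau> powr (\<theta> - 1)) *\<^sub>R S \<tau> (neg_power S \<sigma> z))"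
      by (rule integral_cong) (use g t in auto)
    then have "v t = neg_power S \<theta> (neg_power S \<sigma> z)"
      using \<theta> by (simp add: v_def parabolic_integral_def neg_power_def)
    also have "\<dots> = y n" using \<theta> \<sigma>(1) n by (simp add: neg_power_add y_def)
    finally show ?thesis .
  qed
  have "\<exists>h. (parabolic_operator p {..t0} D A ^^ k) v h \<and> (\<forall>t\<le>t0. h t = y (n - k))" if "k \<le> n" for k
    using that
  proof (induction k)
    case 0 then show ?case using v by auto
  next
    case (Suc k)
    then obtain h where h: "(parabolic_operator p {..t0} D A ^^ k) v h" "\<And>t. t \<le> t0 \<Longrightarrow> h t = y (n - k)" by auto
    have k: "n - k = Suc (n - Suc k)" using Suc.prems by simp
    have "parabolic_operator p {..t0} D A h (\<lambda>t. A (y (n - k)))"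
      by (rule parabolic_operator_constant) (use h(2) p y0 yD(1) yD(2) in \<open>auto simp: k\<close>)
    then have "(parabolic_operator p {..t0} D A ^^ Suc k) v (\<lambda>t. A (y (n - k)))"
      using h(1) by (auto intro: relcomppI)
    then show ?case using yD(2) k by auto
  qed
  then obtain h where h: "(parabolic_operator p {..t0} D A ^^ n) v h" "\<And>t. t \<le> t0 \<Longrightarrow> h t = z"
    using y_def by force
  have "neg_power S \<sigma> z = 0" if "z = 0" using that \<sigma> by (simp add: neg_power_zero)
  then have "g \<in> Lp p {..t0}" using p g by (intro constant_in_Lp[of "neg_power S \<sigma> z"]) auto
  moreover have "AE t in lebesgue_on {..t0}. z = h t"
    by (rule AE_I2) (use h(2) in \<open>auto simp: space_restrict_space\<close>)
  ultimately show ?thesis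
    using h(1) unfolding parabolic_derivative_def n_def v_def \<theta>_def by blast
qed

end

text \<open>The substitution \<open>\<sigma> = t (\<tau> + 1)\<close>. The powers of \<open>t\<close> from \<open>\<tau> powr (- frac s)\<close>, \<open>1 / (\<tau> + 1)\<close> and
\<open>d\<tau>\<close> combine to \<open>t powr frac s\<close>.\<close>

lemma mild_solution_integral_part:
  assumes g: "\<forall>t\<le>t0. g t = x" and t: "0 < t"
  shows "(sin (pi * frac s) / pi) *\<^sub>R
          integral {0..} (\<lambda>\<tau>. (\<tau> powr (- frac s) / (\<tau> + 1)) *\<^sub>R S (t * (\<tau> + 1)) (g (t0 - t * \<tau>)))
    = (t powr frac s * sin (pi * frac s) / pi) *\<^sub>R
          integral {t..} (\<lambda>\<sigma>. (inverse \<sigma> * (\<sigma> - t) powr (- frac s)) *\<^sub>R (S \<sigma> x :: 'a::complex_banach))"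
proof -
  define f where "f \<sigma> = (inverse \<sigma> * (\<sigma> - t) powr (- frac s)) *\<^sub>R S \<sigma> x" for \<sigma>
  have "(\<tau> powr (- frac s) / (\<tau> + 1)) *\<^sub>R S (t * (\<tau> + 1)) (g (t0 - t * \<tau>))
      = (t * t powr frac s) *\<^sub>R f (t * (\<tau> + 1))" if "\<tau> \<in> {0..}" for \<tau>
  proof -
    have "t * (\<tau> + 1) - t = t * \<tau>" by (simp add: algebra_simps)
    then have "(t * (\<tau> + 1) - t) powr (- frac s) = t powr (- frac s) * \<tau> powr (- frac s)"
      using t that by (simp add: powr_mult)
    moreover have "t powr frac s * t powr (- frac s) = 1" using t by (simp add: powr_add[symmetric])
    moreover have "t * t powr frac s * (inverse (t * (\<tau> + 1)) * (t powr (- frac s) * \<tau> powr (- frac s)))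
        = (t * inverse t) * (t powr frac s * t powr (- frac s)) * (\<tau> powr (- frac s) / (\<tau> + 1))"
      by (simp only: inverse_mult_distrib divide_inverse mult_ac)
    ultimately have "t * t powr frac s * (inverse (t * (\<tau> + 1)) * (t * (\<tau> + 1) - t) powr (- frac s)) = \<tau> powr (- frac s) / (\<tau> + 1)"
      using t by simp
    moreover have "g (t0 - t * \<tau>) = x" using g t that by simp
    ultimately show ?thesis by (simp add: f_def)
  qed
  then have "integral {0..} (\<lambda>\<tau>. (\<tau> powr (- frac s) / (\<tau> + 1)) *\<^sub>R S (t * (\<tau> + 1)) (g (t0 - t * \<tau>)))
     = integral {0..} (\<lambda>\<tau>. (t * t powr frac s) *\<^sub>R f (t * (\<tau> + 1)))"
    by (rule integral_cong)
  also have "\<dots> = (t * t powr frac s) *\<^sub>R ((1 / t) *\<^sub>R integral {t..} f)"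
    by (simp only: integral_cmul integral_atLeast_affine[OF t])
  also have "\<dots> = t powr frac s *\<^sub>R integral {t..} f" using t by simp
  finally show ?thesis by (simp add: f_def[abs_def] mult.commute)
qed

text \<open>Domination of the orbit by \<open>M0 norm x exp (- w \<sigma>)\<close> and the integral representation of the
scalar incomplete gamma function.\<close>

lemma (in decaying_semigroup) integral_part_bound:
  assumes \<alpha>: "0 < \<alpha>" "\<alpha> < 1" and t: "0 < t" and w: "0 \<le> w"
  shows "norm ((t powr \<alpha> * sin (pi * \<alpha>) / pi) *\<^sub>R
          integral {t..} (\<lambda>\<sigma>. (inverse \<sigma> * (\<sigma> - t) powr (- \<alpha>)) *\<^sub>R S \<sigma> x))
    \<le> M0 * upper_gamma \<alpha> (w * t) * norm x"
proof -
  define c where "c = t powr \<alpha> * sin (pi * \<alpha>) / pi"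
  have c: "0 \<le> c" unfolding c_def using \<alpha> by (intro divide_nonneg_pos mult_nonneg_nonneg sin_ge_zero) auto
  define f where "f \<sigma> = c *\<^sub>R ((inverse \<sigma> * (\<sigma> - t) powr (- \<alpha>)) *\<^sub>R S \<sigma> x)" for \<sigma>
  define b where "b \<sigma> = c * (inverse \<sigma> * (\<sigma> - t) powr (- \<alpha>) * exp (- w * \<sigma>)) * (M0 * norm x)" for \<sigma>
  have b: "(b has_integral upper_gamma \<alpha> (w * t) * (M0 * norm x)) {t..}"
    unfolding b_def c_def
    by (rule has_integral_mult_left[OF upper_gamma_integral_representation[OF \<alpha> t w]])
  have fb: "norm (f \<sigma>) \<le> b \<sigma>" if "\<sigma> \<in> {t..}" for \<sigma>
  proof -
    have s: "0 \<le> \<sigma>" using that t by simp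
    have "norm (f \<sigma>) = c * (inverse \<sigma> * (\<sigma> - t) powr (- \<alpha>)) * norm (S \<sigma> x)"
      using c s by (simp add: f_def abs_mult)
    also have "\<dots> \<le> c * (inverse \<sigma> * (\<sigma> - t) powr (- \<alpha>)) * (M0 * norm x * exp (- w * \<sigma>))"
      using c s by (intro mult_left_mono semigroup_decay) auto
    finally show ?thesis by (simp add: b_def algebra_simps)
  qed
  have "norm (integral {t..} f) \<le> upper_gamma \<alpha> (w * t) * (M0 * norm x)"
  proof (cases "f integrable_on {t..}")
    case True
    have "norm (integral {t..} f) \<le> integral {t..} b"
      by (rule integral_norm_bound_integral[OF True]) (use b fb in auto)
    then show ?thesis using b by (simp add: integral_unique)
  next
    case False
    have "0 \<le> upper_gamma \<alpha> (w * t) * (M0 * norm x)"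
      by (rule has_integral_nonneg[OF b]) (use fb norm_ge_zero order_trans in blast)
    then show ?thesis using False by (simp add: not_integrable_integral)
  qed
  then show ?thesis unfolding f_def integral_cmul c_def by (simp only: mult_ac)
qed

lemma (in stable_semigroup_generator) parabolic_derivative_at_constant:
  assumes p: "1 \<le> p" "p = \<infinity> \<or> x = 0" and \<sigma>: "0 < \<sigma>" "\<sigma> \<notin> \<int>"
    and g: "\<And>t. t \<le> t0 \<Longrightarrow> g t = x" and x: "x = neg_power S \<sigma> z"
  shows "parabolic_derivative_at S D A p t0 \<sigma> g = z"
proof (rule parabolic_derivative_at_eq[OF p(1)])
  have "z = 0" if "x = 0"
    using injD[OF inj_neg_power[OF \<sigma>(1)], of z 0] x that by (simp add: neg_power_zero \<sigma>(1))
  then show "parabolic_derivative S D A p {..t0} \<sigma> g (\<lambda>t. z)"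
    using p(2) g x by (intro parabolic_derivative_constant[OF \<sigma>]) auto
qed simp

text \<open>Admissibility includes membership in \<open>L\<^sup>p\<close> of a half-line.\<close>

lemma constant_datum_zero:
  assumes g: "\<forall>t\<le>t0. g t = x" and adm: "admissible_datum S D A p t0 s g" and p: "p \<noteq> \<infinity>"
  shows "x = 0"
proof -
  have "g \<in> Lp p {..t0}" using adm by (auto simp: admissible_datum_def parabolic_derivative_def)
  then have "integrable (lebesgue_on {..t0}) (\<lambda>t. norm (g t) powr enn2real p)"
    using p by (simp add: Lp_into_def)
  also have "integrable (lebesgue_on {..t0}) (\<lambda>t. norm (g t) powr enn2real p)
      \<longleftrightarrow> integrable (lebesgue_on {..t0}) (\<lambda>t. norm x powr enn2real p)"
    by (rule Bochner_Integration.integrable_cong[OF refl]) (use g in \<open>auto simp: space_restrict_space\<close>)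
  finally have "norm x powr enn2real p = 0" by (rule integrable_constant_atMost)
  then show ?thesis by simp
qed

text \<open>Since \<open>A\<^sup>-\<^sup>\<beta> = A\<^sup>-\<^sup>\<alpha> A\<^sup>-\<^sup>(\<^sup>\<beta>\<^sup>-\<^sup>\<alpha>\<^sup>)\<close>, the domains of the fractional powers decrease with the order.\<close>

lemma (in stable_semigroup_generator) power_domain_lower:
  assumes x: "x \<in> power_domain S \<beta>" and "0 < \<alpha>" "\<alpha> \<le> \<beta>"
  obtains z where "x = neg_power S \<alpha> z"
proof -
  obtain z where z: "x = neg_power S \<beta> z" using assms by (auto simp: power_domain_def)
  show ?thesis
  proof (cases "\<alpha> = \<beta>")
    case False
    then have "x = neg_power S \<alpha> (neg_power S (\<beta> - \<alpha>) z)"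
      using z assms by (subst neg_power_add) auto
    then show ?thesis by (rule that)
  qed (use z that in auto)
qed

lemma constant_in_Cb:
  assumes "\<forall>t\<le>t0. g t = x"
  shows "g \<in> Cb {..t0}"
proof -
  have "continuous_on {..t0} g \<longleftrightarrow> continuous_on {..t0} (\<lambda>t. x)"
    by (rule continuous_on_cong) (use assms in auto)
  moreover have "g ` {..t0} \<subseteq> {x}" using assms by auto
  then have "bounded (g ` {..t0})" by (rule bounded_subset[rotated]) simp
  ultimately show ?thesis by (simp add: Cb_def)
qed

theorem corollary4p8:
  fixes S :: "real \<Rightarrow> 'a::complex_banach \<Rightarrow> 'a"
    and D :: "'a set" and A :: "'a \<Rightarrow> 'a"
    and M0 w s t0 :: real and p :: ennreal
    and x :: 'a and g u :: "real \<Rightarrow> 'a"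
  assumes "strongly_measurable_semigroup S"
    and "1 \<le> M0" and "0 \<le> w"
    and "\<forall>t\<ge>0. onorm (S t) \<le> M0 * exp (- w * t)"
    and "infinitesimal_generator w S D (\<lambda>y. - A y)"
    and "0 < s" and "s \<notin> \<nat>" and "1 \<le> p"
    and "s < 1 \<or> 0 < w"
    and "x \<in> power_domain S (max (s - 1) 0)"
    and "\<forall>t\<le>t0. g t = x"
    and "u = mild_solution S D A p t0 s g"
  shows "(p = \<infinity> \<longrightarrow> admissible_datum S D A p t0 s g)
    \<and> (s < 1 \<or> admissible_datum S D A p t0 s g \<longrightarrow>
        (\<forall>t>t0. u t = upper_gamma_op S s (t - t0) x)
        \<and> (\<forall>M :: real \<Rightarrow> real.
             (s < 1 \<or> bounded_analytic S)
             \<and> (\<forall>k\<in>{1..nat \<lfloor>s\<rfloor>}. analytic_estimate S w (frac s + real k - 1) (M (frac s + real k - 1)))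
             \<longrightarrow> (\<forall>t>t0. norm (u t) \<le>
                   (M0 * upper_gamma (frac s) (w * (t - t0))
                     + exp (- w * (t - t0)) *
                       (\<Sum>k = 1..nat \<lfloor>s\<rfloor>. M (frac s + real k - 1) / Gamma (frac s + real k)))
                   * norm x)))"
proof -
  interpret decaying_semigroup S M0 w
    using assms by unfold_locales auto
  have "s \<notin> \<int>" using assms(6,7) by (auto simp: Nats_altdef2)
  then have frac: "0 < frac s" "frac s < 1" by (simp_all add: frac_gt_0_iff frac_lt_1)
  define K where "K = nat \<lfloor>s\<rfloor>"
  have sK: "s = frac s + real K" using assms(6) by (simp add: K_def frac_def)
  have order: "0 < frac s + real k - 1" "frac s + real k - 1 \<le> s - 1" "frac s + real k - 1 \<notin> \<int>"
    if "k \<in> {1..K}" for k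
  proof -
    have "1 \<le> real k" "real k \<le> real K" using that by auto
    then show "0 < frac s + real k - 1" "frac s + real k - 1 \<le> s - 1" using frac sK by linarith+
    have "frac s + real k - 1 = s + of_int (int k - int K - 1)" using sK by simp
    then show "frac s + real k - 1 \<notin> \<int>" using \<open>s \<notin> \<int>\<close> by (metis Ints_of_int Ints_diff add_diff_cancel_right')
  qed
  have big: "1 < s" "0 < w" if "1 \<le> K"
  proof -
    have "1 \<le> real K" using that by simp
    then show "1 < s" using sK frac by linarith
    then show "0 < w" using assms(9) by simp
  qed
  have gC: "g \<in> Cb {..t0}" by (rule constant_in_Cb[OF assms(11)])
  have generator: "stable_semigroup_generator S M0 w D A" if "0 < w"
    using that assms(5) by unfold_locales
  have admissible: "admissible_datum S D A p t0 s g" if "p = \<infinity>"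
  proof (cases "s < 1")
    case True
    have "g \<in> Lp p {..t0}" by (rule constant_in_Lp[of x]) (use assms(11) that in auto)
    from parabolic_derivative_zero[OF this] show ?thesis
      using gC True unfolding admissible_datum_def by (auto simp: max_def)
  next
    case False
    then have s: "1 < s" "0 < w" using assms(7,9) by (auto simp: less_le)
    interpret stable_semigroup_generator S M0 w D A by (rule generator[OF s(2)])
    obtain z where z: "x = neg_power S (s - 1) z"
      using power_domain_lower[OF assms(10), of "s - 1"] s by auto
    have "parabolic_derivative S D A p {..t0} (s - 1) g (\<lambda>t. z)"
      by (rule parabolic_derivative_constant) (use s z assms(11) that \<open>s \<notin> \<int>\<close> in \<open>auto dest: Ints_add[OF _ Ints_1]\<close>)
    then show ?thesis
      using gC s constant_in_Cb[of t0 "\<lambda>t. z" z] unfolding admissible_datum_def by (auto simp: max_def)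
  qed
  show ?thesis
  proof (intro conjI impI)
    show "p = \<infinity> \<Longrightarrow> admissible_datum S D A p t0 s g" by (rule admissible)
    assume adm: "s < 1 \<or> admissible_datum S D A p t0 s g"
    show formula: "\<forall>t>t0. u t = upper_gamma_op S s (t - t0) x"
    proof (intro allI impI)
      fix t assume t: "t0 < t"
      have "S (t - t0) (parabolic_derivative_at S D A p t0 (frac s + real k - 1) g)
          = frac_power S (real k + frac s - 1) (S (t - t0) x)" if k: "k \<in> {1..K}" for k
      proof -
        have s: "1 < s" "0 < w" using big k by auto
        interpret stable_semigroup_generator S M0 w D A by (rule generator[OF s(2)])
        obtain z where z: "x = neg_power S (frac s + real k - 1) z"
          using power_domain_lower[OF assms(10) order(1)[OF k]] order(2)[OF k] s by auto
        have "p = \<infinity> \<or> x = 0" using constant_datum_zero[OF assms(11), of S D A p s] adm s by linarith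
        then have "parabolic_derivative_at S D A p t0 (frac s + real k - 1) g = z"
          by (rule parabolic_derivative_at_constant[OF assms(8)]) (use order k z assms(11) in auto)
        then show ?thesis
          using frac_power_commute_semigroup[OF order(1)[OF k], of "t - t0" z] z t
          by (simp add: add.commute)
      qed
      then have "(\<Sum>k = 1..K. ((t - t0) powr (frac s + real k - 1) / Gamma (frac s + real k)) *\<^sub>R
               S (t - t0) (parabolic_derivative_at S D A p t0 (frac s + real k - 1) g))
          = (\<Sum>k = 1..K. ((t - t0) powr (real k + frac s - 1) / Gamma (real k + frac s)) *\<^sub>R
            frac_power S (real k + frac s - 1) (S (t - t0) x))"
        by (intro sum.cong refl) (simp add: add.commute)
      then show "u t = upper_gamma_op S s (t - t0) x"
        using mild_solution_integral_part[OF assms(11), of "t - t0" s S] t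
        by (simp add: assms(12) mild_solution_def upper_gamma_op_def K_def)
    qed
    show "\<forall>M :: real \<Rightarrow> real.
             (s < 1 \<or> bounded_analytic S)
             \<and> (\<forall>k\<in>{1..nat \<lfloor>s\<rfloor>}. analytic_estimate S w (frac s + real k - 1) (M (frac s + real k - 1)))
             \<longrightarrow> (\<forall>t>t0. norm (u t) \<le>
                   (M0 * upper_gamma (frac s) (w * (t - t0))
                     + exp (- w * (t - t0)) *
                       (\<Sum>k = 1..nat \<lfloor>s\<rfloor>. M (frac s + real k - 1) / Gamma (frac s + real k)))
                   * norm x)"
    proof (intro allI impI, elim conjE)
      fix M :: "real \<Rightarrow> real" and t :: real
      assume M: "\<forall>k\<in>{1..nat \<lfloor>s\<rfloor>}. analytic_estimate S w (frac s + real k - 1) (M (frac s + real k - 1))"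
        and t: "t0 < t"
      define r where "r = t - t0"
      have r: "0 < r" using t by (simp add: r_def)
      let ?I = "(r powr frac s * sin (pi * frac s) / pi) *\<^sub>R
          integral {r..} (\<lambda>\<sigma>. (inverse \<sigma> * (\<sigma> - r) powr (- frac s)) *\<^sub>R S \<sigma> x)"
      let ?T = "\<lambda>k. (r powr (real k + frac s - 1) / Gamma (real k + frac s)) *\<^sub>R
            frac_power S (real k + frac s - 1) (S r x)"
      have T: "norm (?T k) \<le> exp (- w * r) * (M (frac s + real k - 1) / Gamma (frac s + real k)) * norm x"
        if k: "k \<in> {1..K}" for k
      proof -
        define \<beta> where "\<beta> = frac s + real k - 1"
        have \<beta>: "real k + frac s - 1 = \<beta>" "real k + frac s = \<beta> + 1" "frac s + real k = \<beta> + 1"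
          by (simp_all add: \<beta>_def)
        have \<beta>0: "0 < \<beta>" using order(1)[OF k] by (simp add: \<beta>_def)
        have "analytic_estimate S w \<beta> (M \<beta>)" using M k by (simp add: \<beta>_def K_def)
        then have "bounded_linear (\<lambda>x. frac_power S \<beta> (S r x))"
          and on: "onorm (\<lambda>x. frac_power S \<beta> (S r x)) \<le> M \<beta> * r powr (- \<beta>) * exp (- w * r)"
          using r by (auto simp: analytic_estimate_def bounded_clinear_def)
        then have "norm (frac_power S \<beta> (S r x)) \<le> (M \<beta> * r powr (- \<beta>) * exp (- w * r)) * norm x"
          using onorm[of "\<lambda>x. frac_power S \<beta> (S r x)" x] mult_right_mono[OF on norm_ge_zero[of x]] by linarith
        moreover have G: "0 < Gamma (\<beta> + 1)" using \<beta>0 by (simp add: Gamma_real_pos)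
        ultimately have "norm (?T k) \<le> (r powr \<beta> / Gamma (\<beta> + 1)) * ((M \<beta> * r powr (- \<beta>) * exp (- w * r)) * norm x)"
          unfolding \<beta> using r by (simp add: mult_left_mono divide_right_mono)
        also have "\<dots> = (r powr \<beta> * r powr (- \<beta>)) * (exp (- w * r) * (M \<beta> / Gamma (\<beta> + 1)) * norm x)"
          by (simp add: field_simps)
        also have "r powr \<beta> * r powr (- \<beta>) = 1" using r by (simp add: powr_add[symmetric])
        finally show ?thesis unfolding \<beta> by (simp add: \<beta>_def)
      qed
      have "norm (u t) = norm (?I + (\<Sum>k = 1..K. ?T k))"
        using formula t by (simp add: upper_gamma_op_def r_def K_def)
      also have "\<dots> \<le> norm ?I + (\<Sum>k = 1..K. norm (?T k))"
        by (intro norm_triangle_le add_left_mono norm_sum)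
      also have "\<dots> \<le> M0 * upper_gamma (frac s) (w * r) * norm x
          + (\<Sum>k = 1..K. exp (- w * r) * (M (frac s + real k - 1) / Gamma (frac s + real k)) * norm x)"
        by (intro add_mono integral_part_bound frac r assms(3) sum_mono T)
      also have "\<dots> = (M0 * upper_gamma (frac s) (w * r)
          + exp (- w * r) * (\<Sum>k = 1..K. M (frac s + real k - 1) / Gamma (frac s + real k))) * norm x"
        by (simp add: sum_distrib_left sum_distrib_right distrib_right)
      finally show "norm (u t) \<le> (M0 * upper_gamma (frac s) (w * (t - t0))
                     + exp (- w * (t - t0)) *
                       (\<Sum>k = 1..nat \<lfloor>s\<rfloor>. M (frac s + real k - 1) / Gamma (frac s + real k)))
                   * norm x" by (simp only: r_def K_def)
    qed
  qed
qed

end
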